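(* Let $G$ be a finite group. If $\lambda(G)<\frac{59}{8}$, then $G$ is solvable.
   Context: For a finite group $G$, $\mathrm{sub}(G)$ denotes the number of subgroups of $G$ (including the trivial subgroup and $G$), $\pi(G)$ denotes the number of distinct prime divisors of $|G|$ (so $\pi(1)=0$), and $\lambda(G)=\mathrm{sub}(G)/2^{\pi(G)}$. *)

theory Defs
  imports "HOL-Algebra.Algebra" "HOL-Computational_Algebra.Primes"
begin

definition num_subgroups :: "('a, 'b) monoid_scheme \<Rightarrow> nat" where
  "num_subgroups G = card {H. subgroup H G}"

definition num_prime_divisors :: "('a, 'b) monoid_scheme \<Rightarrow> nat" where
  "num_prime_divisors G = card (prime_factors (order G))"

definition subgroup_ratio :: "('a, 'b) monoid_scheme \<Rightarrow> real" where
  "subgroup_ratio G = real (num_subgroups G) / 2 ^ num_prime_divisors G"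

end

theory Submission
  imports Defs
begin

text \<open>
  Let \<open>G\<close> be a counterexample of least order, \<open>n\<^sub>q\<close> the number of its Sylow \<open>q\<close>-subgroups and \<open>\<pi>\<close> the set of
  primes dividing its order. Passing to the quotient by an abelian normal \<open>p\<close>-subgroup \<open>N\<close> does not increase
  the ratio: if \<open>N\<close> is a Sylow subgroup, every subgroup of \<open>G/N\<close> yields its preimage and a complement of \<open>N\<close>
  in it. Hence \<open>G\<close> has no nontrivial solvable normal subgroup.

  The subgroups in which a full Sylow \<open>q\<close>-subgroup \<open>Q\<close> of \<open>G\<close> is normal lie in the normalizer of \<open>Q\<close>; if this
  normalizer is solvable, it has a subgroup with any prescribed set of prime divisors of its order, so there are at
  least \<open>n\<^sub>q 2\<^sup>k\<close> of them, \<open>k\<close> being the number of primes other than \<open>q\<close> that divide the order of the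
  normalizer. The remaining primes divide \<open>n\<^sub>q\<close>, and so \<open>n\<^sub>q / 2\<^sup>\<omega> < 59/4\<close> where \<open>\<omega>\<close> is the number of primes
  dividing \<open>n\<^sub>q\<close>. This leaves finitely many \<open>n\<^sub>q\<close>. Moreover \<open>G\<close> acts faithfully on its Sylow \<open>q\<close>-subgroups,
  so every prime in \<open>\<pi>\<close> is at most \<open>n\<^sub>q\<close>.

  If \<open>n\<^sub>q = q + 1\<close>, the action is doubly transitive with order \<open>q (q + 1) c\<close>, \<open>c\<close> dividing \<open>q - 1\<close>, and the stabilizers
  of pairs contribute enough further subgroups; the bound is sharp for the alternating group of degree 5. Otherwise
  \<open>n\<^sub>p\<close> for the largest \<open>p\<close> in \<open>\<pi>\<close> takes one of 18 values, and adding the contributions of several primes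
  excludes each of them.
\<close>

hide_const (open) Divisibility.prime

section \<open>Group actions and Sylow subgroups\<close>

text \<open>The number 59/8 is the ratio of the alternating group of degree 5: 59 subgroups, and
  three primes dividing 60. Each prime absent from the order of the normalizer of \<open>Q\<close>
  costs the count a factor 2, but such a prime divides \<open>n\<^sub>q\<close> and contributes to
  it a factor at least 2, and at least 5 beyond 2 and 3; hence few are absent. The bound on the
  quotient is 59/4 and not 59/8 because \<open>q\<close> divides the order of every counted subgroup
  and yields no doubling of its own.

  The obstacle is a circle: the count and the faithfulness of the action both need solvable Sylow
  normalizers. If one is not solvable, minimality applied to its quotient by \<open>Q\<close>
  improves the count by the factor 59/8, which leaves only 3 Sylow 2-subgroups or 6 Sylow
  5-subgroups. Both are instances of \<open>q + 1\<close>, and they have to be excluded while the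
  action may still have a kernel; the centralizer of that kernel serves as a faithful substitute for
  \<open>G\<close>.\<close>

lemma card_eq_mult_fibres:
  fixes c :: nat
  assumes "finite A" "\<And>b. b \<in> f ` A \<Longrightarrow> card {a \<in> A. f a = b} = c"
  shows "card A = card (f ` A) * c"
proof -
  have "card A = (\<Sum>b\<in>f ` A. card {a \<in> A. f a = b})"
  proof -
    have "A = (\<Union>b\<in>f ` A. {a \<in> A. f a = b})" by auto
    then have "card A = card (\<Union>b\<in>f ` A. {a \<in> A. f a = b})" by simp
    also have "\<dots> = (\<Sum>b\<in>f ` A. card {a \<in> A. f a = b})"
      using assms(1) by (intro card_UN_disjoint) auto
    finally show ?thesis .
  qed
  then show ?thesis using assms(2) by simp
qed

section \<open>Orbits, stabilizers and fixed points modulo a prime\<close>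

locale grp_act = group G for G (structure) +
  fixes E :: "'e set" and act :: "'a \<Rightarrow> 'e \<Rightarrow> 'e"
  assumes act_closed: "g \<in> carrier G \<Longrightarrow> e \<in> E \<Longrightarrow> act g e \<in> E"
    and act_one: "e \<in> E \<Longrightarrow> act \<one> e = e"
    and act_mult: "g \<in> carrier G \<Longrightarrow> h \<in> carrier G \<Longrightarrow> e \<in> E \<Longrightarrow> act (g \<otimes> h) e = act g (act h e)"
begin

definition stab where "stab e = {g \<in> carrier G. act g e = e}"
definition orb where "orb e = (\<lambda>g. act g e) ` carrier G"

lemma act_inv: "g \<in> carrier G \<Longrightarrow> e \<in> E \<Longrightarrow> act (inv g) (act g e) = e"
  by (metis act_mult act_one inv_closed l_inv)

lemma stab_subgroup: assumes "e \<in> E" shows "subgroup (stab e) G"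
proof (rule subgroupI)
  show "stab e \<subseteq> carrier G" by (auto simp: stab_def)
  show "stab e \<noteq> {}" using act_one[OF assms] by (auto simp: stab_def)
  show "inv a \<in> stab e" if "a \<in> stab e" for a
    using that act_inv[of a e] assms by (auto simp: stab_def)
  show "a \<otimes> b \<in> stab e" if "a \<in> stab e" "b \<in> stab e" for a b
    using that assms by (auto simp: stab_def act_mult)
qed

lemma orbit_stabilizer:
  assumes "e \<in> E" "finite (carrier G)"
  shows "order G = card (orb e) * card (stab e)"
proof -
  have "card {a \<in> carrier G. act a e = b} = card (stab e)" if b: "b \<in> (\<lambda>g. act g e) ` carrier G" for b
  proof -
    obtain h where h: "h \<in> carrier G" "b = act h e" using b by auto
    have "bij_betw (\<lambda>s. h \<otimes> s) (stab e) {a \<in> carrier G. act a e = b}"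
    proof (rule bij_betwI[where g = "\<lambda>a. inv h \<otimes> a"])
      show "(\<lambda>s. h \<otimes> s) \<in> stab e \<rightarrow> {a \<in> carrier G. act a e = b}"
        using h assms(1) by (auto simp: stab_def act_mult)
      show "(\<lambda>a. inv h \<otimes> a) \<in> {a \<in> carrier G. act a e = b} \<rightarrow> stab e"
        using h assms(1) by (auto simp: stab_def act_mult act_inv)
    qed (use h in \<open>auto simp: stab_def m_assoc[symmetric]\<close>)
    then show ?thesis by (simp add: bij_betw_same_card)
  qed
  then show ?thesis unfolding order_def orb_def
    using card_eq_mult_fibres[OF assms(2), of "\<lambda>g. act g e" "card (stab e)"] by auto
qed

lemma orb_subset: "e \<in> E \<Longrightarrow> orb e \<subseteq> E" by (auto simp: orb_def act_closed)

lemma mem_orb: "e \<in> E \<Longrightarrow> e \<in> orb e"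
  using act_one[of e] unfolding orb_def by (metis image_eqI one_closed)

lemma orb_eq: assumes "e \<in> E" "f \<in> orb e" shows "orb f = orb e"
proof -
  obtain g where g: "g \<in> carrier G" "f = act g e" using assms(2) by (auto simp: orb_def)
  have "act h f = act (h \<otimes> g) e" if "h \<in> carrier G" for h using g that assms by (simp add: act_mult)
  moreover have "act h e = act (h \<otimes> inv g) f" if "h \<in> carrier G" for h
    using g that assms act_mult[of "h \<otimes> inv g" g e] by (simp add: m_assoc)
  ultimately have "act h f \<in> orb e" "act h e \<in> orb f" if "h \<in> carrier G" for h
    using that g(1) unfolding orb_def by auto
  then show ?thesis unfolding orb_def by auto
qed

lemma orb_disjoint: "e \<in> E \<Longrightarrow> f \<in> E \<Longrightarrow> orb e \<inter> orb f \<noteq> {} \<Longrightarrow> orb e = orb f"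
  using orb_eq by blast

definition fixpts where "fixpts = {e \<in> E. \<forall>g \<in> carrier G. act g e = e}"

lemma card_orb_dvd: "e \<in> E \<Longrightarrow> finite (carrier G) \<Longrightarrow> card (orb e) dvd order G"
  using orbit_stabilizer by simp

lemma card_eq_sum_orbits:
  assumes "finite E" shows "card E = (\<Sum>Y\<in>orb ` E. card Y)"
proof -
  have "E = \<Union>(orb ` E)" using mem_orb orb_subset by blast
  moreover have "card (\<Union>(orb ` E)) = sum card (orb ` E)"
  proof (rule card_Union_disjoint)
    show "pairwise disjnt (orb ` E)" unfolding pairwise_def disjnt_def using orb_disjoint by blast
    show "\<And>A. A \<in> orb ` E \<Longrightarrow> finite A" using orb_subset assms finite_subset by blast
  qed
  ultimately show ?thesis by simp
qed

text \<open>The points outside \<open>fixpts\<close> are permuted among themselves, and each of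
  their orbits has length a power of \<open>p\<close> other than 1, so they contribute a multiple of
  \<open>p\<close>.\<close>

lemma fixpts_cong:
  assumes "finite E" "prime p" "order G = p ^ k"
  shows "card E mod p = card fixpts mod p"
proof -
  have fin: "finite (carrier G)"
    using assms by (metis order_gt_0_iff_finite zero_less_power prime_gt_0_nat)
  interpret r: grp_act G "E - fixpts" act
  proof (unfold_locales)
    fix g e assume ge: "g \<in> carrier G" "e \<in> E - fixpts"
    have "act g e \<notin> fixpts"
    proof
      assume "act g e \<in> fixpts"
      then have "act (inv g) (act g e) = act g e" using ge by (auto simp: fixpts_def)
      then have "act g e = e" using ge act_inv by auto
      then show False using \<open>act g e \<in> fixpts\<close> ge by auto
    qed
    then show "act g e \<in> E - fixpts" using ge act_closed by auto
  qed (auto simp: act_one act_mult)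
  have "p dvd card Y" if Y: "Y \<in> r.orb ` (E - fixpts)" for Y
  proof -
    obtain e where e: "e \<in> E - fixpts" "Y = r.orb e" using Y by auto
    have "card Y dvd p ^ k" using r.card_orb_dvd[OF e(1) fin] assms e by simp
    then obtain j where j: "card Y = p ^ j" using assms(2) divides_primepow_nat by blast
    have "j \<noteq> 0"
    proof
      assume "j = 0"
      then obtain x where x: "Y = {x}" using j card_1_singletonE by auto
      then have "x = e" using r.mem_orb[OF e(1)] e by auto
      then have "\<forall>g\<in>carrier G. act g e = e" using x e by (auto simp: r.orb_def)
      then show False using e by (auto simp: fixpts_def)
    qed
    then show ?thesis using j by simp
  qed
  then have "p dvd card (E - fixpts)"
    using r.card_eq_sum_orbits assms(1) by (simp add: dvd_sum)
  moreover have "card E = card fixpts + card (E - fixpts)"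
    using assms(1) by (metis (no_types, lifting) card_Diff_subset card_mono fixpts_def finite_subset
        le_add_diff_inverse mem_Collect_eq subsetI)
  ultimately show ?thesis by (metis mod_add_eq add_0_right dvd_imp_mod_0 mod_mod_trivial)
qed

end

section \<open>Conjugation of subsets and normalizers\<close>

definition cnj :: "('a, 'b) monoid_scheme \<Rightarrow> 'a \<Rightarrow> 'a set \<Rightarrow> 'a set" where
  "cnj G g H = (\<lambda>x. g \<otimes>\<^bsub>G\<^esub> x \<otimes>\<^bsub>G\<^esub> inv\<^bsub>G\<^esub> g) ` H"

definition nrm :: "('a, 'b) monoid_scheme \<Rightarrow> 'a set \<Rightarrow> 'a set" where
  "nrm G H = {g \<in> carrier G. cnj G g H = H}"

text \<open>Divisibility of the order by \<open>p\<close> is not demanded: if \<open>p\<close> does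
  not divide the order of a finite group, the trivial subgroup is the only member.\<close>

definition Syl :: "nat \<Rightarrow> ('a, 'b) monoid_scheme \<Rightarrow> 'a set set" where
  "Syl p G = {P. subgroup P G \<and> card P = p ^ multiplicity p (order G)}"

context group
begin

lemma conj_mult: "g \<in> carrier G \<Longrightarrow> h \<in> carrier G \<Longrightarrow> x \<in> carrier G \<Longrightarrow>
  (g \<otimes> h) \<otimes> x \<otimes> inv (g \<otimes> h) = g \<otimes> (h \<otimes> x \<otimes> inv h) \<otimes> inv g"
  by (simp add: inv_mult_group m_assoc)

lemma cnj_mult: "g \<in> carrier G \<Longrightarrow> h \<in> carrier G \<Longrightarrow> H \<subseteq> carrier G \<Longrightarrow>
  cnj G (g \<otimes> h) H = cnj G g (cnj G h H)"
  unfolding cnj_def image_image by (intro image_cong) (auto simp: conj_mult)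

lemma cnj_one: "H \<subseteq> carrier G \<Longrightarrow> cnj G \<one> H = H"
  unfolding cnj_def by (subst image_cong[where g = "\<lambda>x. x"]) auto

lemma cnj_carrier: "g \<in> carrier G \<Longrightarrow> H \<subseteq> carrier G \<Longrightarrow> cnj G g H \<subseteq> carrier G"
  by (auto simp: cnj_def)

lemma conj_inj: "g \<in> carrier G \<Longrightarrow> inj_on (\<lambda>x. g \<otimes> x \<otimes> inv g) (carrier G)"
  by (rule inj_onI) simp

lemma conj_hom: "g \<in> carrier G \<Longrightarrow> group_hom G G (\<lambda>x. g \<otimes> x \<otimes> inv g)"
  by (unfold_locales) (auto simp: hom_def m_assoc inv_solve_left)

lemma card_cnj: "g \<in> carrier G \<Longrightarrow> H \<subseteq> carrier G \<Longrightarrow> card (cnj G g H) = card H"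
  unfolding cnj_def using conj_inj by (metis card_image inj_on_subset)

lemma cnj_subgroup: "g \<in> carrier G \<Longrightarrow> subgroup H G \<Longrightarrow> subgroup (cnj G g H) G"
  unfolding cnj_def using group_hom.subgroup_img_is_subgroup[OF conj_hom] by blast

lemma cnj_mono: "H \<subseteq> K \<Longrightarrow> cnj G g H \<subseteq> cnj G g K" by (auto simp: cnj_def)

lemma cnj_cnj_inv: "g \<in> carrier G \<Longrightarrow> H \<subseteq> carrier G \<Longrightarrow> cnj G g (cnj G (inv g) H) = H"
  by (metis cnj_mult cnj_one inv_closed r_inv)

lemma cnj_inv_cnj: "g \<in> carrier G \<Longrightarrow> H \<subseteq> carrier G \<Longrightarrow> cnj G (inv g) (cnj G g H) = H"
  by (metis cnj_mult cnj_one inv_closed l_inv)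

lemma cnj_self: assumes "subgroup H G" "h \<in> H" shows "cnj G h H = H"
proof -
  have *: "cnj G h H \<subseteq> H" if "h \<in> H" for h
    using that assms(1) subgroupE(3,4)[OF assms(1)] by (auto simp: cnj_def)
  have "H = cnj G h (cnj G (inv h) H)" using assms cnj_cnj_inv subgroup.subset by blast
  also have "\<dots> \<subseteq> cnj G h H" by (rule cnj_mono, rule *, rule subgroup.m_inv_closed[OF assms])
  finally show ?thesis using *[OF assms(2)] by auto
qed

lemma conj_act: assumes "subgroup K G" "E \<subseteq> Pow (carrier G)"
  "\<And>g H. g \<in> K \<Longrightarrow> H \<in> E \<Longrightarrow> cnj G g H \<in> E"
  shows "grp_act (G\<lparr>carrier := K\<rparr>) E (cnj G)"
proof -
  interpret K: group "G\<lparr>carrier := K\<rparr>" using assms(1) subgroup_imp_group by blast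
  show ?thesis
    by unfold_locales (use assms subgroup.subset[OF assms(1)] in \<open>auto simp: cnj_one cnj_mult subset_iff\<close>)
qed

lemma nrm_subgroup: assumes "H \<subseteq> carrier G" shows "subgroup (nrm G H) G"
proof -
  interpret grp_act G "Pow (carrier G)" "cnj G"
    using conj_act[OF subgroup_self, of "Pow (carrier G)"] by (auto simp: cnj_carrier)
  show ?thesis using stab_subgroup[of H] assms by (simp add: stab_def nrm_def)
qed

lemma subset_nrm: "subgroup H G \<Longrightarrow> H \<subseteq> nrm G H"
  using cnj_self subgroup.subset unfolding nrm_def by fastforce

lemma nrm_normal: assumes "subgroup H G" shows "H \<lhd> G\<lparr>carrier := nrm G H\<rparr>"
proof -
  interpret N: group "G\<lparr>carrier := nrm G H\<rparr>"
    using subgroup_imp_group nrm_subgroup subgroup.subset[OF assms] by blast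
  have s: "subgroup H (G\<lparr>carrier := nrm G H\<rparr>)"
    using subgroup_incl[OF assms nrm_subgroup subset_nrm] assms subgroup.subset by blast
  show ?thesis
  proof (rule N.normal_invI[OF s])
    fix x h assume "x \<in> carrier (G\<lparr>carrier := nrm G H\<rparr>)" "h \<in> H"
    then have "x \<in> nrm G H" "x \<otimes> h \<otimes> inv x \<in> cnj G x H" by (auto simp: cnj_def)
    then show "x \<otimes>\<^bsub>G\<lparr>carrier := nrm G H\<rparr>\<^esub> h \<otimes>\<^bsub>G\<lparr>carrier := nrm G H\<rparr>\<^esub> inv\<^bsub>G\<lparr>carrier := nrm G H\<rparr>\<^esub> x \<in> H"
      using m_inv_consistent[OF nrm_subgroup, of H x] subgroup.subset[OF assms] by (auto simp: nrm_def)
  qed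
qed

lemma normal_iff_cnj: "N \<lhd> G \<longleftrightarrow> subgroup N G \<and> (\<forall>g\<in>carrier G. cnj G g N \<subseteq> N)"
  unfolding normal_inv_iff cnj_def by auto

lemma normal_cnj_eq: assumes "N \<lhd> G" "g \<in> carrier G" shows "cnj G g N = N"
proof
  have s: "N \<subseteq> carrier G" using assms normal_imp_subgroup subgroup.subset by blast
  show "cnj G g N \<subseteq> N" using assms normal_iff_cnj by blast
  have "N = cnj G g (cnj G (inv g) N)" using s cnj_cnj_inv assms by simp
  also have "\<dots> \<subseteq> cnj G g N" using cnj_mono assms normal_iff_cnj by (metis inv_closed)
  finally show "N \<subseteq> cnj G g N" .
qed

lemma normal_iff_nrm: "subgroup N G \<Longrightarrow> N \<lhd> G \<longleftrightarrow> nrm G N = carrier G"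
  using normal_cnj_eq normal_iff_cnj unfolding nrm_def by auto

lemma cnj_consistent: "subgroup K G \<Longrightarrow> g \<in> K \<Longrightarrow> cnj (G\<lparr>carrier := K\<rparr>) g H = cnj G g H"
  by (simp add: cnj_def m_inv_consistent)

lemma nrm_consistent: "subgroup K G \<Longrightarrow> nrm (G\<lparr>carrier := K\<rparr>) H = nrm G H \<inter> K"
  using subgroup.subset by (fastforce simp: nrm_def cnj_consistent)

lemma order_dvd_if_pow:
  assumes "x \<in> carrier G" "x [^] (a::nat) = \<one>" "x [^] (b::nat) = \<one>" "coprime a b"
  shows "x = \<one>"
proof -
  have "ord x dvd a" "ord x dvd b" using assms pow_eq_id by auto
  then have "ord x = 1" using assms(4) by (metis coprime_common_divisor_nat)
  then show ?thesis using pow_eq_id[OF assms(1), of 1] assms(1) by simp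
qed

end

section \<open>Finite groups and Sylow's theorems\<close>

locale fin_group = group G for G (structure) + assumes fin: "finite (carrier G)"
begin

lemma order_pos: "order G > 0" using fin order_gt_0_iff_finite by blast

lemma fin_subgroup: "subgroup H G \<Longrightarrow> fin_group (G\<lparr>carrier := H\<rparr>)"
  unfolding fin_group_def fin_group_axioms_def
  using subgroup_imp_group subgroup.subset fin finite_subset by fastforce

lemma finite_sub: "subgroup H G \<Longrightarrow> finite H"
  using subgroup.subset fin finite_subset by blast

lemma card_sub_dvd: "subgroup H G \<Longrightarrow> card H dvd order G"
  using lagrange dvd_triv_right by metis

lemma card_sub_pos: "subgroup H G \<Longrightarrow> card H > 0"
  using finite_sub subgroup.one_closed card_gt_0_iff by blast

lemma finite_subs: "finite {H. subgroup H G}"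
  by (rule finite_subset[of _ "Pow (carrier G)"]) (use subgroup.subset fin in auto)

lemma pow_card_sub: assumes "subgroup H G" "x \<in> H" shows "x [^] card H = \<one>"
proof -
  interpret H: group "G\<lparr>carrier := H\<rparr>" using assms subgroup_imp_group by blast
  have "x [^]\<^bsub>G\<lparr>carrier := H\<rparr>\<^esub> order (G\<lparr>carrier := H\<rparr>) = \<one>\<^bsub>G\<lparr>carrier := H\<rparr>\<^esub>"
    using H.pow_order_eq_1 assms(2) by simp
  then show ?thesis using nat_pow_consistent by (simp add: order_def)
qed

text \<open>The order of the coset of \<open>x\<close> divides both \<open>a\<close> and the order
  of the quotient, so this coset is trivial.\<close>

lemma mem_normal_if_pow:
  assumes "N \<lhd> G" "x \<in> carrier G" "x [^] (a::nat) = \<one>" "coprime a (order (G Mod N))"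
  shows "x \<in> N"
proof -
  interpret N: normal N G by fact
  interpret Q: group "G Mod N" by (rule N.factorgroup_is_group)
  interpret h: group_hom G "G Mod N" "\<lambda>a. N #> a"
    by unfold_locales (rule N.r_coset_hom_Mod)
  have "(N #> x) [^]\<^bsub>G Mod N\<^esub> a = \<one>\<^bsub>G Mod N\<^esub>"
    using h.hom_nat_pow[OF assms(2), of a] assms(3) by (simp add: one_FactGroup)
  moreover have c: "N #> x \<in> carrier (G Mod N)" using assms(2) by (simp add: carrier_FactGroup)
  ultimately have "N #> x = \<one>\<^bsub>G Mod N\<^esub>"
    using Q.order_dvd_if_pow Q.pow_order_eq_1[OF c] assms(4) by blast
  then show ?thesis using assms(2) N.is_subgroup coset_join1 by auto
qed

lemma order_Mod: "N \<lhd> G \<Longrightarrow> order (G Mod N) * card N = order G"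
  using lagrange[of N] normal_imp_subgroup by (auto simp: order_def FactGroup_def)

lemma SylD: "P \<in> Syl p G \<Longrightarrow> subgroup P G" "P \<in> Syl p G \<Longrightarrow> card P = p ^ multiplicity p (order G)"
  by (auto simp: Syl_def)

lemma Syl_carrier: "P \<in> Syl p G \<Longrightarrow> P \<subseteq> carrier G"
  using SylD subgroup.subset by blast

lemma finite_Syl: "finite (Syl p G)"
  using finite_subs by (rule finite_subset[rotated]) (auto simp: Syl_def)

lemma Syl_ne: assumes "prime p" shows "Syl p G \<noteq> {}"
proof -
  obtain m where "order G = p ^ multiplicity p (order G) * m"
    using multiplicity_dvd by (metis dvdE)
  then show ?thesis using sylow_thm[OF assms is_group _ fin] unfolding Syl_def by auto
qed

lemma cnj_Syl: "g \<in> carrier G \<Longrightarrow> P \<in> Syl p G \<Longrightarrow> cnj G g P \<in> Syl p G"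
  using cnj_subgroup card_cnj subgroup.subset unfolding Syl_def by (metis (no_types, lifting) mem_Collect_eq)

lemma not_dvd_index_Syl:
  assumes "prime p" "P \<in> Syl p G" "P \<subseteq> H" "subgroup H G"
  shows "\<not> p dvd order G div card H" "\<not> p dvd card H div card P"
proof -
  interpret H: fin_group "G\<lparr>carrier := H\<rparr>" using assms fin_subgroup by blast
  have d1: "card P dvd card H"
    using H.card_sub_dvd[of P] subgroup_incl[of P H] assms SylD by (auto simp: order_def)
  have d2: "card H dvd order G" using assms card_sub_dvd by blast
  obtain m where m: "order G = p ^ multiplicity p (order G) * m" "\<not> p dvd m"
    using multiplicity_decompose'[of "order G" p] order_pos assms(1) by (metis not_prime_unit not_gr0)
  have cP: "card P = p ^ multiplicity p (order G)" using SylD assms by blast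
  obtain u where u: "card H = card P * u" using d1 by blast
  obtain v where v: "order G = card H * v" using d2 by blast
  have "card P > 0" "card H > 0" using card_sub_pos assms SylD by blast+
  have "card P * m = order G" using m(1) cP by simp
  also have "\<dots> = card P * (u * v)" using u v by (simp only: mult.assoc)
  finally have "m = u * v" using \<open>card P > 0\<close> by simp
  then have "\<not> p dvd u" "\<not> p dvd v" using m(2) by auto
  moreover have "order G div card H = v" using v \<open>card H > 0\<close>
    by (metis nonzero_mult_div_cancel_left less_numeral_extra(3))
  moreover have "card H div card P = u" using u \<open>card P > 0\<close>
    by (metis nonzero_mult_div_cancel_left less_numeral_extra(3))
  ultimately show "\<not> p dvd order G div card H" "\<not> p dvd card H div card P" by simp_all
qed

text \<open>The index of \<open>P\<close> in its normalizer is prime to \<open>p\<close>, so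
  elements of \<open>p\<close>-power order in the normalizer become trivial modulo
  \<open>P\<close>.\<close>

lemma p_subgroup_in_normal_Syl:
  assumes "prime p" "P \<in> Syl p G" "subgroup Q G" "card Q = p ^ k" "Q \<subseteq> nrm G P"
  shows "Q \<subseteq> P"
proof
  fix x assume x: "x \<in> Q"
  have sP: "subgroup P G" using assms SylD by blast
  have sN: "subgroup (nrm G P) G" using nrm_subgroup Syl_carrier assms by blast
  interpret N: fin_group "G\<lparr>carrier := nrm G P\<rparr>" using sN fin_subgroup by blast
  have n: "P \<lhd> G\<lparr>carrier := nrm G P\<rparr>" using nrm_normal[OF sP] .
  have "order (G\<lparr>carrier := nrm G P\<rparr> Mod P) * card P = card (nrm G P)"
    using N.order_Mod[OF n] by (simp add: order_def)
  then have "order (G\<lparr>carrier := nrm G P\<rparr> Mod P) = card (nrm G P) div card P"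
    using card_sub_pos[OF sP] by (metis nonzero_mult_div_cancel_right less_numeral_extra(3))
  then have "\<not> p dvd order (G\<lparr>carrier := nrm G P\<rparr> Mod P)"
    using not_dvd_index_Syl(2)[OF assms(1,2) subset_nrm[OF sP] sN] by simp
  then have "coprime (p ^ k) (order (G\<lparr>carrier := nrm G P\<rparr> Mod P))"
    using assms(1) by (simp add: prime_imp_coprime)
  moreover have "x [^]\<^bsub>G\<lparr>carrier := nrm G P\<rparr>\<^esub> (p ^ k) = \<one>"
    using pow_card_sub[OF assms(3) x] assms(4) nat_pow_consistent by metis
  ultimately show "x \<in> P" using N.mem_normal_if_pow[OF n, of x "p ^ k"] x assms(5) by auto
qed

text \<open>The number of conjugates of \<open>P\<close> is prime to \<open>p\<close>, so
  \<open>Q\<close>, acting on them, fixes one; it normalizes this conjugate and hence lies in it.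
  The action is on the orbit of \<open>P\<close> because the transitivity on \<open>Syl p G\<close>
  is derived from this lemma.\<close>

lemma p_subgroup_conj_in_Syl:
  assumes "prime p" "P \<in> Syl p G" "subgroup Q G" "card Q = p ^ k"
  shows "\<exists>g\<in>carrier G. Q \<subseteq> cnj G g P"
proof -
  interpret A: grp_act G "Syl p G" "cnj G"
    using conj_act[OF subgroup_self, of "Syl p G"] by (auto simp: cnj_Syl dest: Syl_carrier)
  have sP: "subgroup P G" using assms SylD by blast
  have stab: "A.stab P = nrm G P" by (auto simp: A.stab_def nrm_def)
  have "order G = card (A.orb P) * card (nrm G P)" using A.orbit_stabilizer[OF assms(2) fin] stab by simp
  moreover have "subgroup (nrm G P) G" using nrm_subgroup Syl_carrier assms by blast
  ultimately have o: "\<not> p dvd card (A.orb P)"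
    using not_dvd_index_Syl(1)[OF assms(1,2) subset_nrm[OF sP]] card_sub_pos
    by (metis nonzero_mult_div_cancel_right less_numeral_extra(3))
  have "A.orb P \<subseteq> Pow (carrier G)" using A.orb_subset[OF assms(2)] Syl_carrier by blast
  moreover have "cnj G g H \<in> A.orb P" if "g \<in> Q" "H \<in> A.orb P" for g H
  proof -
    have "g \<in> carrier G" using that assms subgroup.mem_carrier by metis
    moreover have "A.orb H = A.orb P" using A.orb_eq assms that by blast
    ultimately show ?thesis by (auto simp: A.orb_def)
  qed
  ultimately interpret B: grp_act "G\<lparr>carrier := Q\<rparr>" "A.orb P" "cnj G"
    using conj_act[OF assms(3)] by blast
  have "card (A.orb P) mod p = card B.fixpts mod p"
    using B.fixpts_cong[OF _ assms(1), of k] assms(4) finite_subset[OF A.orb_subset[OF assms(2)] finite_Syl]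
    by (simp add: order_def)
  then have "B.fixpts \<noteq> {}" using o by (metis card.empty dvd_eq_mod_eq_0 mod_0)
  then obtain R where R: "R \<in> A.orb P" "\<forall>g\<in>Q. cnj G g R = R" by (auto simp: B.fixpts_def)
  then obtain g where g: "g \<in> carrier G" "R = cnj G g P" by (auto simp: A.orb_def)
  have "Q \<subseteq> nrm G R" using R assms(3) subgroup.mem_carrier unfolding nrm_def by fastforce
  then have "Q \<subseteq> R" using p_subgroup_in_normal_Syl[OF assms(1) _ assms(3,4)] A.orb_subset[OF assms(2)] R
    by blast
  then show ?thesis using g by blast
qed

lemma Syl_conj:
  assumes "prime p" "P \<in> Syl p G" "Q \<in> Syl p G"
  shows "\<exists>g\<in>carrier G. Q = cnj G g P"
proof -
  obtain g where g: "g \<in> carrier G" "Q \<subseteq> cnj G g P"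
    using p_subgroup_conj_in_Syl[OF assms(1,2)] SylD assms(3) by blast
  moreover have "card (cnj G g P) = card Q" using SylD cnj_Syl g assms by metis
  ultimately show ?thesis
    using card_subset_eq finite_sub SylD cnj_Syl assms by metis
qed

lemma card_Syl_index:
  assumes "prime p" "P \<in> Syl p G"
  shows "order G = card (Syl p G) * card (nrm G P)"
proof -
  interpret A: grp_act G "Syl p G" "cnj G"
    using conj_act[OF subgroup_self, of "Syl p G"] by (auto simp: cnj_Syl dest: Syl_carrier)
  have stab: "A.stab P = nrm G P" by (auto simp: A.stab_def nrm_def)
  have "A.orb P = Syl p G" using Syl_conj[OF assms] cnj_Syl assms by (auto simp: A.orb_def)
  then show ?thesis using A.orbit_stabilizer[OF assms(2) fin] stab by simp
qed

text \<open>A Sylow subgroup acting on all of them fixes only itself, since it lies in any Sylow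
  subgroup that it normalizes.\<close>

lemma card_Syl_mod:
  assumes "prime p" shows "card (Syl p G) mod p = 1"
proof -
  obtain P where P: "P \<in> Syl p G" using Syl_ne assms by blast
  have sP: "subgroup P G" using P SylD by blast
  interpret B: grp_act "G\<lparr>carrier := P\<rparr>" "Syl p G" "cnj G"
    using conj_act[OF sP, of "Syl p G"] cnj_Syl Syl_carrier sP subgroup.mem_carrier by (metis PowI subsetI)
  have "B.fixpts = {P}"
  proof -
    have "P \<in> B.fixpts" using P cnj_self[OF sP] by (auto simp: B.fixpts_def)
    moreover have "R = P" if "R \<in> B.fixpts" for R
    proof -
      have R: "R \<in> Syl p G" "P \<subseteq> nrm G R" using that Syl_carrier[OF P] by (auto simp: B.fixpts_def nrm_def)
      then have "P \<subseteq> R" using p_subgroup_in_normal_Syl[OF assms _ sP] SylD P by blast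
      then show ?thesis using card_subset_eq finite_sub SylD R P by metis
    qed
    ultimately show ?thesis by blast
  qed
  then show ?thesis
    using B.fixpts_cong[OF finite_Syl assms] SylD(2)[OF P] prime_gt_1_nat[OF assms] by (simp add: order_def)
qed

end

section \<open>Complements of abelian normal subgroups\<close>

text \<open>With \<open>n\<close> the order of the normal subgroup and \<open>m\<close> its index,
  raising to the power \<open>m * k\<close> inverts the elements of the subgroup; the sign is chosen
  so that the correction cancels the factor set.\<close>

lemma ex_mult_cong_minus_one:
  fixes m n :: nat
  assumes "coprime m n" "n > 0"
  shows "\<exists>k. n dvd m * k + 1"
proof -
  obtain u v where uv: "u * int m + v * int n = 1"
    using bezout_int[of "int m" "int n"] assms(1) by auto
  define k where "k = nat ((- u) mod int n)"
  have "int k = (- u) mod int n" using assms(2) by (simp add: k_def)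
  then obtain w where w: "int n * w = int k + u"
    by (metis add.commute diff_minus_eq_add dvd_def mod_eq_dvd_iff mod_mod_trivial)
  have "int n * (v + int m * w) = v * int n + int m * (int n * w)" by (simp add: algebra_simps)
  also have "\<dots> = int (m * k + 1)" using uv unfolding w by (simp add: algebra_simps)
  finally show ?thesis by (metis dvd_triv_left of_nat_dvd_iff)
qed

context fin_group
begin

text \<open>
  For a section \<open>s\<close> of the quotient map with factor set \<open>f\<close>, the product \<open>e a\<close> of all \<open>f a c\<close> shows that the
  \<open>m\<close>-th power of \<open>f\<close> is a coboundary, \<open>m\<close> being the index; as \<open>m\<close> is invertible modulo the order of \<open>N\<close>, a power
  \<open>h\<close> of \<open>e\<close> corrects \<open>s\<close> to a homomorphism.
\<close>
proposition abelian_complement: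
  assumes N: "N \<lhd> G" and comm: "\<And>x y. x \<in> N \<Longrightarrow> y \<in> N \<Longrightarrow> x \<otimes> y = y \<otimes> x"
    and cop: "coprime (card N) (order (G Mod N))"
  shows "\<exists>K. subgroup K G \<and> card K = order (G Mod N) \<and> (\<forall>c\<in>carrier (G Mod N). c \<inter> K \<noteq> {})"
proof -
  interpret N: normal N G by fact
  have sN: "subgroup N G" by (rule N.is_subgroup)
  interpret Q: group "G Mod N" by (rule N.factorgroup_is_group)
  note mult_FactGroup [simp del]
  interpret CN: comm_group "G\<lparr>carrier := N\<rparr>"
    using group.group_comm_groupI[OF subgroup_imp_group[OF sN]] comm by simp
  let ?Q = "G Mod N" and ?C = "carrier (G Mod N)" and ?N = "G\<lparr>carrier := N\<rparr>"
  define m where "m = order ?Q"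
  have finQ: "finite ?C" using fin by (simp add: carrier_FactGroup)
  define s where "s c = (SOME x. x \<in> c)" for c :: "'a set"
  have coset: "\<exists>x\<in>carrier G. c = N #> x" if "c \<in> ?C" for c using that by (auto simp: carrier_FactGroup)
  have s_in: "s c \<in> c" if c: "c \<in> ?C" for c
  proof -
    obtain x where x: "x \<in> carrier G" "c = N #> x" using coset c by blast
    then have "x \<in> c" using rcos_self sN by blast
    then show ?thesis unfolding s_def by (rule someI)
  qed
  have s_cl[simp]: "s c \<in> carrier G" if c: "c \<in> ?C" for c
    using s_in[OF c] coset[OF c] N.rcosets_carrier c by (auto simp: FactGroup_def)
  have s_eq: "N #> s c = c" if c: "c \<in> ?C" for c
    using s_in[OF c] coset[OF c] repr_independence sN by metis
  have sab: "N #> (s a \<otimes> s b) = a \<otimes>\<^bsub>?Q\<^esub> b" if "a \<in> ?C" "b \<in> ?C" for a b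
    using N.rcos_sum[of "s a" "s b"] s_eq that by (simp add: mult_FactGroup)
  define f where "f a b = s a \<otimes> s b \<otimes> inv (s (a \<otimes>\<^bsub>?Q\<^esub> b))" for a b
  have f_in[simp]: "f a b \<in> N" if ab: "a \<in> ?C" "b \<in> ?C" for a b
  proof -
    have "s a \<otimes> s b \<in> N #> s (a \<otimes>\<^bsub>?Q\<^esub> b)"
      using sab[OF ab] s_eq[of "a \<otimes>\<^bsub>?Q\<^esub> b"] rcos_self[OF _ sN, of "s a \<otimes> s b"] ab by auto
    then obtain n where "n \<in> N" "s a \<otimes> s b = n \<otimes> s (a \<otimes>\<^bsub>?Q\<^esub> b)" by (auto simp: r_coset_def)
    then show ?thesis using ab by (simp add: f_def m_assoc)
  qed
  have NG[simp]: "x \<in> carrier G" if "x \<in> N" for x using that by simp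
  define al where "al a n = s a \<otimes> n \<otimes> inv (s a)" for a n
  have al_in[simp]: "al a n \<in> N" if "a \<in> ?C" "n \<in> N" for a n
    using N.inv_op_closed2 that by (simp add: al_def)
  have al_mult: "al a (x \<otimes> y) = al a x \<otimes> al a y" if "a \<in> ?C" "x \<in> N" "y \<in> N" for a x y
    using that by (simp add: al_def m_assoc inv_solve_left)
  have cocycle: "f a b \<otimes> f (a \<otimes>\<^bsub>?Q\<^esub> b) c = al a (f b c) \<otimes> f a (b \<otimes>\<^bsub>?Q\<^esub> c)"
    if abc: "a \<in> ?C" "b \<in> ?C" "c \<in> ?C" for a b c
  proof -
    have 1: "inv (s x) \<otimes> (s x \<otimes> z) = z" if "x \<in> ?C" "z \<in> carrier G" for x z
      using that by (simp add: m_assoc[symmetric])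
    have "f a b \<otimes> f (a \<otimes>\<^bsub>?Q\<^esub> b) c = s a \<otimes> s b \<otimes> s c \<otimes> inv (s (a \<otimes>\<^bsub>?Q\<^esub> b \<otimes>\<^bsub>?Q\<^esub> c))"
      using abc by (simp add: f_def m_assoc 1 Q.m_closed)
    moreover have "al a (f b c) \<otimes> f a (b \<otimes>\<^bsub>?Q\<^esub> c) = s a \<otimes> s b \<otimes> s c \<otimes> inv (s (a \<otimes>\<^bsub>?Q\<^esub> (b \<otimes>\<^bsub>?Q\<^esub> c)))"
      using abc by (simp add: f_def al_def m_assoc 1 Q.m_closed)
    ultimately show ?thesis using Q.m_assoc[OF abc] by simp
  qed
  define e where "e a = finprod ?N (f a) ?C" for a
  have e_in[simp]: "e a \<in> N" if "a \<in> ?C" for a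
    using CN.finprod_closed[of "f a" ?C] that unfolding e_def by auto
  have al_one: "al a \<one> = \<one>" if "a \<in> ?C" for a using that by (simp add: al_def)
  have al_prod: "al a (finprod ?N g A) = finprod ?N (\<lambda>c. al a (g c)) A"
    if "a \<in> ?C" "finite A" "g \<in> A \<rightarrow> N" for a g A
    using that(2,3)
  proof (induction A)
    case empty then show ?case using al_one[OF that(1)] by simp
  next
    case (insert x F)
    then have "g \<in> F \<rightarrow> N" "g x \<in> N" "(\<lambda>c. al a (g c)) \<in> F \<rightarrow> N" "al a (g x) \<in> N"
      using al_in[OF that(1)] by (auto simp: Pi_iff)
    then show ?case using insert al_mult[OF that(1), of "g x" "finprod ?N g F"] CN.finprod_closed[of g F]
      by (simp add: CN.finprod_insert)
  qed
  \<comment> \<open>The cocycle identity is multiplied over all \<open>c\<close>. The constant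
    factor \<open>f a b\<close> becomes a power with exponent the index, and left translation by
    \<open>b\<close> permutes the quotient, so the last product is again \<open>e a\<close>.\<close>
  have key: "f a b [^] m \<otimes> e (a \<otimes>\<^bsub>?Q\<^esub> b) = al a (e b) \<otimes> e a" if ab: "a \<in> ?C" "b \<in> ?C" for a b
  proof -
    have ab': "a \<otimes>\<^bsub>?Q\<^esub> b \<in> ?C" using ab Q.m_closed by blast
    have "finprod ?N (\<lambda>c. f a b \<otimes>\<^bsub>?N\<^esub> f (a \<otimes>\<^bsub>?Q\<^esub> b) c) ?C
        = finprod ?N (\<lambda>c. f a b) ?C \<otimes>\<^bsub>?N\<^esub> finprod ?N (\<lambda>c. f (a \<otimes>\<^bsub>?Q\<^esub> b) c) ?C"
      using ab ab' by (intro CN.finprod_multf) auto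
    also have "finprod ?N (\<lambda>c. f a b) ?C = f a b [^]\<^bsub>?N\<^esub> card ?C"
      using ab by (intro CN.finprod_const) auto
    finally have 1: "finprod ?N (\<lambda>c. f a b \<otimes> f (a \<otimes>\<^bsub>?Q\<^esub> b) c) ?C = f a b [^] m \<otimes> e (a \<otimes>\<^bsub>?Q\<^esub> b)"
      using nat_pow_consistent by (simp add: m_def order_def e_def)
    have "finprod ?N (\<lambda>c. al a (f b c) \<otimes>\<^bsub>?N\<^esub> f a (b \<otimes>\<^bsub>?Q\<^esub> c)) ?C
        = finprod ?N (\<lambda>c. al a (f b c)) ?C \<otimes>\<^bsub>?N\<^esub> finprod ?N (\<lambda>c. f a (b \<otimes>\<^bsub>?Q\<^esub> c)) ?C"
      using ab Q.m_closed by (intro CN.finprod_multf) auto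
    also have "finprod ?N (\<lambda>c. al a (f b c)) ?C = al a (e b)"
      unfolding e_def using ab finQ by (intro al_prod[symmetric]) auto
    also have "finprod ?N (\<lambda>c. f a (b \<otimes>\<^bsub>?Q\<^esub> c)) ?C = e a"
    proof -
      have im: "(\<lambda>c. b \<otimes>\<^bsub>?Q\<^esub> c) ` ?C = ?C" using Q.surj_const_mult ab by blast
      have "finprod ?N (f a) ((\<lambda>c. b \<otimes>\<^bsub>?Q\<^esub> c) ` ?C) = finprod ?N (\<lambda>c. f a (b \<otimes>\<^bsub>?Q\<^esub> c)) ?C"
        using ab Q.m_closed Q.inj_on_cmult by (intro CN.finprod_reindex) auto
      then show ?thesis unfolding im e_def by simp
    qed
    finally have 2: "finprod ?N (\<lambda>c. al a (f b c) \<otimes> f a (b \<otimes>\<^bsub>?Q\<^esub> c)) ?C = al a (e b) \<otimes> e a" by simp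
    have "finprod ?N (\<lambda>c. f a b \<otimes> f (a \<otimes>\<^bsub>?Q\<^esub> b) c) ?C
        = finprod ?N (\<lambda>c. al a (f b c) \<otimes> f a (b \<otimes>\<^bsub>?Q\<^esub> c)) ?C"
      using ab Q.m_closed cocycle subgroup.m_closed[OF sN]
      by (intro CN.finprod_cong') auto
    then show ?thesis using 1 2 by simp
  qed
  obtain k where k: "card N dvd m * k + 1"
    using ex_mult_cong_minus_one[of m "card N"] cop card_sub_pos[OF sN] by (auto simp: m_def coprime_commute)
  define h where "h a = e a [^] k" for a
  have pow_in[simp]: "x [^] (j::nat) \<in> N" if "x \<in> N" for x j
    using that subgroup.m_closed[OF sN] subgroup.one_closed[OF sN] by (induction j) auto
  have h_in[simp]: "h a \<in> N" if "a \<in> ?C" for a using that by (simp add: h_def)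
  have al_pow: "al a (x [^] (j::nat)) = al a x [^] j" if "a \<in> ?C" "x \<in> N" for a x j
    using that by (induction j) (auto simp: al_mult al_one)
  have hkey: "h (a \<otimes>\<^bsub>?Q\<^esub> b) = h a \<otimes> al a (h b) \<otimes> f a b" if ab: "a \<in> ?C" "b \<in> ?C" for a b
  proof -
    have ab': "a \<otimes>\<^bsub>?Q\<^esub> b \<in> ?C" using ab Q.m_closed by blast
    have dist: "(x \<otimes> y) [^] j = x [^] j \<otimes> y [^] j" if "x \<in> N" "y \<in> N" for x y and j :: nat
      using that pow_mult_distrib[OF comm] by simp
    have "(f a b [^] m) [^] k \<otimes> h (a \<otimes>\<^bsub>?Q\<^esub> b) = al a (h b) \<otimes> h a"
      using arg_cong[OF key[OF ab], of "\<lambda>x. x [^] k"] ab ab' dist by (simp add: h_def al_pow)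
    moreover have "f a b \<otimes> (f a b [^] m) [^] k = \<one>"
    proof -
      obtain j where j: "m * k + 1 = card N * j" using k by blast
      have "f a b [^] (m * k + 1) = \<one>"
        using pow_card_sub[OF sN f_in[OF ab]] ab nat_pow_pow[of "f a b" "card N" j] by (simp only: j) simp
      then show ?thesis using ab nat_pow_Suc2[of "f a b" "m * k"] by (simp add: nat_pow_pow)
    qed
    ultimately have "h (a \<otimes>\<^bsub>?Q\<^esub> b) = f a b \<otimes> (al a (h b) \<otimes> h a)"
      using ab ab' by (metis (no_types, lifting) NG f_in h_in l_one m_assoc pow_in)
    also have "\<dots> = h a \<otimes> al a (h b) \<otimes> f a b"
      using ab comm[of "al a (h b)" "h a"] comm[of "f a b" "h a \<otimes> al a (h b)"] subgroup.m_closed[OF sN]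
        by simp
    finally show ?thesis .
  qed
  define t where "t a = h a \<otimes> s a" for a
  have t_hom: "t (a \<otimes>\<^bsub>?Q\<^esub> b) = t a \<otimes> t b" if ab: "a \<in> ?C" "b \<in> ?C" for a b
  proof -
    have ab': "a \<otimes>\<^bsub>?Q\<^esub> b \<in> ?C" using ab Q.m_closed by blast
    have "t (a \<otimes>\<^bsub>?Q\<^esub> b) = h a \<otimes> al a (h b) \<otimes> f a b \<otimes> s (a \<otimes>\<^bsub>?Q\<^esub> b)"
      by (simp add: t_def hkey[OF ab])
    also have "\<dots> = h a \<otimes> (al a (h b) \<otimes> (s a \<otimes> s b))"
      using ab ab' by (simp add: f_def m_assoc)
    also have "\<dots> = t a \<otimes> t b"
    proof -
      have "al a (h b) \<otimes> (s a \<otimes> s b) = s a \<otimes> (h b \<otimes> (inv (s a) \<otimes> (s a \<otimes> s b)))"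
        using ab by (simp add: al_def m_assoc)
      also have "inv (s a) \<otimes> (s a \<otimes> s b) = s b" using ab by (simp add: m_assoc[symmetric])
      finally show ?thesis using ab by (simp add: t_def m_assoc)
    qed
    finally show ?thesis .
  qed
  have t_cl: "t a \<in> carrier G" if "a \<in> ?C" for a using that by (simp add: t_def)
  interpret t: group_hom ?Q G t
    by unfold_locales (use t_hom t_cl in \<open>auto simp: hom_def\<close>)
  have t_in: "t a \<in> a" if "a \<in> ?C" for a
    using that s_eq[OF that] h_in[OF that] unfolding t_def r_coset_def by auto
  have "inj_on t ?C"
  proof (rule inj_onI)
    fix a b assume "a \<in> ?C" "b \<in> ?C" "t a = t b"
    then have "a \<inter> b \<noteq> {}" "a \<in> rcosets N" "b \<in> rcosets N" using t_in[of a] t_in[of b]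
      by (auto simp: FactGroup_def)
    then show "a = b" using rcos_disjoint[OF sN] by (auto simp: pairwise_def disjnt_def)
  qed
  then have "card (t ` ?C) = order ?Q" by (simp add: card_image order_def)
  then show ?thesis using t.img_is_subgroup t_in by (intro exI[of _ "t ` ?C"]) blast
qed

end

section \<open>Quotients and solvability\<close>

text \<open>Quotients change the type of the elements, so inductions on the order run over groups on \<open>nat\<close>.\<close>
lemma ex_nat_iso:
  assumes "fin_group G"
  shows "\<exists>(H :: nat monoid) h. fin_group H \<and> h \<in> iso G H"
proof -
  interpret fin_group G by fact
  obtain f :: "'a \<Rightarrow> nat" where f: "inj_on f (carrier G)"
    using finite_imp_inj_to_nat_seg[OF fin] by metis
  define g where "g = inv_into (carrier G) f"
  have g: "g (f x) = x" if "x \<in> carrier G" for x using that f by (simp add: g_def)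
  define H :: "nat monoid" where
    "H = \<lparr>carrier = f ` carrier G, monoid.mult = (\<lambda>a b. f (g a \<otimes>\<^bsub>G\<^esub> g b)), one = f \<one>\<^bsub>G\<^esub>\<rparr>"
  have iso: "f \<in> iso G H"
    using f g by (auto simp: iso_def hom_def bij_betw_def H_def)
  moreover have "group H"
    using iso_imp_img_group[OF iso] by (simp add: H_def)
  moreover have "finite (carrier H)" using fin by (simp add: H_def)
  ultimately show ?thesis by (auto simp: fin_group_def fin_group_axioms_def)
qed

lemma iso_bij_subgroups:
  assumes "group G" "group H" "h \<in> iso G H"
  shows "bij_betw ((`) h) {K. subgroup K G} {K. subgroup K H}"
proof -
  interpret G: group G by fact
  interpret H: group H by fact
  interpret h: group_hom G H h by unfold_locales (use assms(3) in \<open>simp add: iso_def\<close>)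
  define k where "k = inv_into (carrier G) h"
  have bij: "bij_betw h (carrier G) (carrier H)" using assms(3) by (simp add: iso_def)
  have k: "k \<in> iso H G" unfolding k_def using G.iso_set_sym assms(3) by blast
  interpret k: group_hom H G k by unfold_locales (use k in \<open>simp add: iso_def\<close>)
  have hk: "h (k y) = y" if "y \<in> carrier H" for y using bij that by (simp add: k_def bij_betw_inv_into_right)
  have kh: "k (h x) = x" if "x \<in> carrier G" for x using bij that by (simp add: k_def bij_betw_inv_into_left)
  show ?thesis
  proof (rule bij_betwI[where g = "(`) k"])
    show "(`) h \<in> {K. subgroup K G} \<rightarrow> {K. subgroup K H}" using h.subgroup_img_is_subgroup by auto
    show "(`) k \<in> {K. subgroup K H} \<rightarrow> {K. subgroup K G}" using k.subgroup_img_is_subgroup by auto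
    show "k ` h ` K = K" if "K \<in> {K. subgroup K G}" for K
    proof -
      have "(\<lambda>x. k (h x)) ` K = (\<lambda>x. x) ` K"
        using that kh subgroup.subset[of K G] by (intro image_cong) auto
      then show ?thesis by (simp add: image_image)
    qed
    show "h ` k ` K = K" if "K \<in> {K. subgroup K H}" for K
    proof -
      have "(\<lambda>x. h (k x)) ` K = (\<lambda>x. x) ` K"
        using that hk subgroup.subset[of K H] by (intro image_cong) auto
      then show ?thesis by (simp add: image_image)
    qed
  qed
qed

lemma ex_iso_subgroup:
  assumes "group G" "group H" "h \<in> iso G H" "subgroup L H"
  shows "\<exists>A. subgroup A G \<and> card A = card L"
proof -
  have "L \<in> (`) h ` {K. subgroup K G}"
    using assms(4) bij_betw_imp_surj_on[OF iso_bij_subgroups[OF assms(1-3)]] by simp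
  then obtain A where A: "subgroup A G" "L = h ` A" by auto
  have "inj_on h A"
    using assms(3) subgroup.subset[OF A(1)] inj_on_subset by (auto simp: iso_def bij_betw_def)
  then have "card A = card L" using A(2) by (simp add: card_image)
  then show ?thesis using A(1) by blast
qed

lemma iso_num_subgroups:
  "group G \<Longrightarrow> group H \<Longrightarrow> h \<in> iso G H \<Longrightarrow> num_subgroups G = num_subgroups H"
  unfolding num_subgroups_def using iso_bij_subgroups bij_betw_same_card by blast

lemma iso_order: "h \<in> iso G H \<Longrightarrow> order G = order H"
  unfolding order_def iso_def using bij_betw_same_card by blast

lemma iso_solvable:
  assumes "group G" "group H" "h \<in> iso G H" "solvable H"
  shows "solvable G"
proof -
  interpret G: group G by fact
  interpret H: group H by fact
  interpret h: group_hom G H h by unfold_locales (use assms(3) in \<open>simp add: iso_def\<close>)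
  show ?thesis using h.inj_hom_imp_solvable assms(3,4) by (auto simp: iso_def bij_betw_def)
qed

lemma iso_solvable':
  assumes "group G" "group H" "h \<in> iso G H" "solvable G"
  shows "solvable H"
  using iso_solvable[OF assms(2,1) group.iso_set_sym[OF assms(1,3)] assms(4)] .

section \<open>Subgroups of quotients and their lifts\<close>

context fin_group
begin

lemma fin_group_Mod: "N \<lhd> G \<Longrightarrow> fin_group (G Mod N)"
  unfolding fin_group_def fin_group_axioms_def
  using normal.factorgroup_is_group fin by (auto simp: carrier_FactGroup)

lemma card_subgroup_gt_one: assumes "subgroup N G" "N \<noteq> {\<one>}" shows "1 < card N"
proof -
  have "card N \<noteq> 1" using assms subgroup.one_closed[OF assms(1)] by (auto simp: card_1_singleton_iff)
  then show ?thesis using card_sub_pos[OF assms(1)] by linarith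
qed

lemma order_Mod_less: assumes "N \<lhd> G" "N \<noteq> {\<one>}" shows "order (G Mod N) < order G"
proof -
  have "order (G Mod N) * 1 < order (G Mod N) * card N"
    using card_subgroup_gt_one[OF normal_imp_subgroup] assms order_Mod[OF assms(1)] order_pos
    by (intro mult_less_mono2) (auto intro: Nat.gr0I)
  then show ?thesis using order_Mod[OF assms(1)] by simp
qed

lemma hom_Mod: "N \<lhd> G \<Longrightarrow> group_hom G (G Mod N) (\<lambda>x. N #> x)"
  unfolding group_hom_def group_hom_axioms_def
  using normal.r_coset_hom_Mod normal.factorgroup_is_group by blast

definition lift where "lift N A = {x \<in> carrier G. N #> x \<in> A}"

lemma lift_subgroup: assumes "N \<lhd> G" "subgroup A (G Mod N)" shows "subgroup (lift N A) G"
proof -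
  interpret h: group_hom G "G Mod N" "\<lambda>x. N #> x" using hom_Mod assms(1) .
  interpret A: subgroup A "G Mod N" by fact
  show ?thesis
  proof (rule subgroupI)
    show "lift N A \<noteq> {}" using A.one_closed h.hom_one unfolding lift_def by force
    show "inv a \<in> lift N A" if "a \<in> lift N A" for a using that A.m_inv_closed h.hom_inv
      by (auto simp: lift_def)
    show "a \<otimes> b \<in> lift N A" if "a \<in> lift N A" "b \<in> lift N A" for a b
      using that A.m_closed h.hom_mult by (auto simp: lift_def simp del: mult_FactGroup)
  qed (auto simp: lift_def)
qed

lemma image_lift: "subgroup A (G Mod N) \<Longrightarrow> (\<lambda>x. N #> x) ` lift N A = A"
  using subgroup.subset[of A "G Mod N"] by (force simp: lift_def carrier_FactGroup)

lemma lift_inj: "subgroup A (G Mod N) \<Longrightarrow> subgroup B (G Mod N) \<Longrightarrow> lift N A = lift N B \<Longrightarrow> A = B"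
  by (metis image_lift)

lemma subset_lift: assumes "N \<lhd> G" "subgroup A (G Mod N)" shows "N \<subseteq> lift N A"
proof
  fix x assume x: "x \<in> N"
  have "x \<in> carrier G" using x assms normal_imp_subgroup subgroup.mem_carrier by metis
  moreover have "N #> x = N" using coset_join2[of x N] calculation assms(1) x normal_imp_subgroup by blast
  moreover have "N \<in> A" using subgroup.one_closed[OF assms(2)] by simp
  ultimately show "x \<in> lift N A" by (simp add: lift_def)
qed

lemma card_lift: assumes "N \<lhd> G" "subgroup A (G Mod N)" shows "card (lift N A) = card A * card N"
proof -
  have sN: "subgroup N G" using assms normal_imp_subgroup by blast
  have "card {a \<in> lift N A. N #> a = b} = card N" if b: "b \<in> (\<lambda>x. N #> x) ` lift N A" for b
  proof -
    obtain y where y: "y \<in> carrier G" "N #> y \<in> A" "b = N #> y" using b by (auto simp: lift_def)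
    have "{a \<in> lift N A. N #> a = b} = N #> y"
    proof (intro equalityI subsetI)
      fix a assume "a \<in> {a \<in> lift N A. N #> a = b}"
      then show "a \<in> N #> y" using rcos_self[OF _ sN, of a] y by (auto simp: lift_def)
    next
      fix a assume a: "a \<in> N #> y"
      then have "a \<in> carrier G" using r_coset_subset_G subgroup.subset[OF sN] y(1) by blast
      moreover have "N #> a = N #> y" using repr_independence[OF a y(1) sN] by simp
      ultimately show "a \<in> {a \<in> lift N A. N #> a = b}" using y by (simp add: lift_def)
    qed
    then show ?thesis using card_rcosets_equal[of "N #> y" N] y subgroup.subset[OF sN] rcosetsI by simp
  qed
  moreover have "finite (lift N A)" using fin by (simp add: lift_def)
  ultimately show ?thesis using card_eq_mult_fibres[of "lift N A" "\<lambda>x. N #> x" "card N"] image_lift[OF assms(2)] by simp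
qed

lemma num_subgroups_Mod_le: assumes "N \<lhd> G" shows "num_subgroups (G Mod N) \<le> num_subgroups G"
proof -
  have "inj_on (lift N) {A. subgroup A (G Mod N)}" by (rule inj_onI) (use lift_inj in blast)
  moreover have "lift N ` {A. subgroup A (G Mod N)} \<subseteq> {H. subgroup H G}" using lift_subgroup assms by blast
  ultimately show ?thesis unfolding num_subgroups_def using card_inj_on_le finite_subs by blast
qed

lemma normal_sub: assumes "N \<lhd> G" "subgroup H G" "N \<subseteq> H" shows "N \<lhd> G\<lparr>carrier := H\<rparr>"
proof -
  interpret H: group "G\<lparr>carrier := H\<rparr>" using assms subgroup_imp_group by blast
  have "subgroup N (G\<lparr>carrier := H\<rparr>)" using assms subgroup_incl normal_imp_subgroup by blast
  moreover have "cnj G g N \<subseteq> N" if "g \<in> H" for g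
    using that assms normal_iff_cnj subgroup.mem_carrier by metis
  ultimately show ?thesis using H.normal_iff_cnj cnj_consistent[OF assms(2)] by auto
qed

text \<open>The quotient of \<open>lift N A\<close> by \<open>N\<close> is \<open>A\<close>, so a
  complement is taken there. That its image is all of \<open>A\<close> makes \<open>A\<close>
  recoverable from \<open>K\<close>.\<close>

lemma abelian_complement_lift:
  assumes N: "N \<lhd> G" and comm: "\<And>x y. x \<in> N \<Longrightarrow> y \<in> N \<Longrightarrow> x \<otimes> y = y \<otimes> x"
    and A: "subgroup A (G Mod N)" and cop: "coprime (card N) (card A)"
  shows "\<exists>K. subgroup K G \<and> K \<subseteq> lift N A \<and> card K = card A \<and> (\<lambda>x. N #> x) ` K = A"
proof -
  let ?L = "G\<lparr>carrier := lift N A\<rparr>"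
  have sL: "subgroup (lift N A) G" using lift_subgroup[OF N A] .
  interpret L: fin_group ?L using fin_subgroup sL by blast
  have NL: "N \<lhd> ?L" using normal_sub[OF N sL subset_lift[OF N A]] .
  have car: "carrier (?L Mod N) = A" using image_lift[OF A] by (simp add: carrier_FactGroup)
  then have "order (?L Mod N) = card A" by (simp add: order_def)
  then obtain K where K: "subgroup K ?L" "card K = card A" "\<forall>c\<in>A. c \<inter> K \<noteq> {}"
    using L.abelian_complement[OF NL] comm cop car by auto
  have KL: "K \<subseteq> lift N A" using subgroup.subset[OF K(1)] by simp
  have "(\<lambda>x. N #> x) ` K = A"
  proof
    show "(\<lambda>x. N #> x) ` K \<subseteq> A" using KL by (auto simp: lift_def)
    show "A \<subseteq> (\<lambda>x. N #> x) ` K"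
    proof
      fix c assume c: "c \<in> A"
      then obtain x where x: "x \<in> c" "x \<in> K" using K(3) by blast
      obtain y where "y \<in> carrier G" "c = N #> y" using c subgroup.subset[OF A]
        by (auto simp: carrier_FactGroup)
      then have "c = N #> x" using repr_independence[of x N y] x normal_imp_subgroup[OF N] by auto
      then show "c \<in> (\<lambda>x. N #> x) ` K" using x by blast
    qed
  qed
  moreover have "subgroup K G" using incl_subgroup[OF sL K(1)] .
  ultimately show ?thesis using KL K(2) by blast
qed

text \<open>Preimages and complements cannot coincide: a preimage contains \<open>N\<close>, while a
  complement containing \<open>N\<close> would have order divisible by \<open>card N\<close>, to
  which it is coprime. Within each kind, the image in the quotient recovers
  \<open>A\<close>.\<close>

lemma num_subgroups_complement:
  assumes N: "N \<lhd> G" "\<And>x y. x \<in> N \<Longrightarrow> y \<in> N \<Longrightarrow> x \<otimes> y = y \<otimes> x"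
    "coprime (card N) (order (G Mod N))" "N \<noteq> {\<one>}"
  shows "2 * num_subgroups (G Mod N) \<le> num_subgroups G"
proof -
  interpret Q: fin_group "G Mod N" using fin_group_Mod N by blast
  let ?S = "{A. subgroup A (G Mod N)}"
  have cop: "coprime (card N) (card A)" if "A \<in> ?S" for A
    using coprime_divisors[OF dvd_refl _ N(3)] Q.card_sub_dvd that by blast
  have "\<exists>K. subgroup K G \<and> K \<subseteq> lift N A \<and> card K = card A \<and> (\<lambda>x. N #> x) ` K = A" if A: "A \<in> ?S" for A
    by (rule abelian_complement_lift[OF N(1,2)]) (use A cop in auto)
  then obtain K where K: "\<And>A. A \<in> ?S \<Longrightarrow> subgroup (K A) G \<and> card (K A) = card A \<and> (\<lambda>x. N #> x) ` (K A) = A"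
    by metis
  have sN: "subgroup N G" using N normal_imp_subgroup by blast
  have "card N \<noteq> 1" using card_subgroup_gt_one[OF sN N(4)] by simp
  have nK: "\<not> N \<subseteq> K A" if "A \<in> ?S" for A
  proof
    assume "N \<subseteq> K A"
    then have "card N dvd card (K A)"
      using fin_group.card_sub_dvd[OF fin_subgroup, of "K A" N] subgroup_incl[OF sN, of "K A"] K[OF that]
      by (simp add: order_def)
    then show False using cop[OF that] K[OF that] \<open>card N \<noteq> 1\<close> by (metis coprime_common_divisor_nat dvd_refl)
  qed
  have "K ` ?S \<inter> lift N ` ?S = {}" using nK subset_lift[OF N(1)] by blast
  moreover have "inj_on K ?S" by (rule inj_onI) (metis K)
  moreover have "inj_on (lift N) ?S" by (rule inj_onI) (use lift_inj in blast)
  ultimately have "card (K ` ?S \<union> lift N ` ?S) = 2 * card ?S"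
    using card_Un_disjoint[of "K ` ?S" "lift N ` ?S"] Q.finite_subs by (simp add: card_image)
  moreover have "K ` ?S \<union> lift N ` ?S \<subseteq> {H. subgroup H G}" using K lift_subgroup[OF N(1)] by blast
  ultimately show ?thesis unfolding num_subgroups_def using card_mono finite_subs by metis
qed

lemma solvable_sub: assumes "solvable G" "subgroup H G" shows "solvable (G\<lparr>carrier := H\<rparr>)"
proof -
  interpret H: group_hom "G\<lparr>carrier := H\<rparr>" G id
    unfolding group_hom_def group_hom_axioms_def
    using assms(2) subgroup_imp_group subgroup.mem_carrier by (fastforce simp: hom_def)
  show ?thesis using H.inj_hom_imp_solvable assms by simp
qed

lemma solvable_Mod: assumes "solvable G" "N \<lhd> G" shows "solvable (G Mod N)"
proof -
  interpret h: group_hom G "G Mod N" "\<lambda>x. N #> x" using hom_Mod assms(2) .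
  show ?thesis using h.surj_hom_imp_solvable assms by (simp add: carrier_FactGroup)
qed

lemma solvable_ext:
  assumes "N \<lhd> G" "solvable (G\<lparr>carrier := N\<rparr>)" "solvable (G Mod N)" shows "solvable G"
proof (rule solvable_condition[of "G\<lparr>carrier := N\<rparr>" G id "G Mod N" "\<lambda>x. N #> x"])
  have sN: "subgroup N G" using assms normal_imp_subgroup by blast
  show "group_hom (G\<lparr>carrier := N\<rparr>) G id"
    unfolding group_hom_def group_hom_axioms_def
    using sN subgroup_imp_group subgroup.mem_carrier by (fastforce simp: hom_def)
  show "group_hom G (G Mod N) (\<lambda>x. N #> x)" using hom_Mod assms(1) .
  show "kernel G (G Mod N) (\<lambda>x. N #> x) \<subseteq> id ` carrier (G\<lparr>carrier := N\<rparr>)"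
    using coset_join1 sN by (auto simp: kernel_def)
qed (use assms in \<open>auto simp: carrier_FactGroup\<close>)

lemma solvable_comm: assumes "subgroup H G" "\<And>x y. x \<in> H \<Longrightarrow> y \<in> H \<Longrightarrow> x \<otimes> y = y \<otimes> x"
  shows "solvable (G\<lparr>carrier := H\<rparr>)"
proof -
  interpret H: comm_group "G\<lparr>carrier := H\<rparr>"
    using group.group_comm_groupI[OF subgroup_imp_group[OF assms(1)]] assms(2) by simp
  have "derived (G\<lparr>carrier := H\<rparr>) (carrier (G\<lparr>carrier := H\<rparr>)) = {\<one>\<^bsub>G\<lparr>carrier := H\<rparr>\<^esub>}"
    by (rule H.derived_eq_singleton) simp
  then show ?thesis using H.solvable_iff_trivial_derived_seq
    by (metis funpow_0 funpow_simps_right(2) comp_apply)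
qed

section \<open>Centralizers and the solvability of groups of prime power order\<close>

definition centralizer where "centralizer K = {g \<in> carrier G. \<forall>k\<in>K. g \<otimes> k = k \<otimes> g}"

lemma centralizer_subgroup:
  assumes KG: "\<And>k. k \<in> K \<Longrightarrow> k \<in> carrier G"
  shows "subgroup (centralizer K) G"
proof (rule subgroupI)
  show "centralizer K \<subseteq> carrier G" by (auto simp: centralizer_def)
  show "centralizer K \<noteq> {}" using KG by (auto simp: centralizer_def intro!: exI[of _ \<one>])
  fix a assume a: "a \<in> centralizer K"
  have aG: "a \<in> carrier G" using a by (simp add: centralizer_def)
  have "inv a \<otimes> k = k \<otimes> inv a" if k: "k \<in> K" for k
  proof -
    have "a \<otimes> (k \<otimes> inv a) = a \<otimes> k \<otimes> inv a" using aG KG[OF k] by (simp add: m_assoc)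
    also have "a \<otimes> k = k \<otimes> a" using a k by (simp add: centralizer_def)
    also have "k \<otimes> a \<otimes> inv a = k" using aG KG[OF k] by (simp add: m_assoc)
    finally show ?thesis using aG KG[OF k] inv_solve_left[of "k \<otimes> inv a" a k] by simp
  qed
  then show "inv a \<in> centralizer K" using aG by (simp add: centralizer_def)
  fix b assume b: "b \<in> centralizer K"
  have bG: "b \<in> carrier G" using b by (simp add: centralizer_def)
  have "a \<otimes> b \<otimes> k = k \<otimes> (a \<otimes> b)" if k: "k \<in> K" for k
  proof -
    have "a \<otimes> b \<otimes> k = a \<otimes> (b \<otimes> k)" using aG bG KG[OF k] by (simp add: m_assoc)
    also have "b \<otimes> k = k \<otimes> b" using b k by (simp add: centralizer_def)
    also have "a \<otimes> (k \<otimes> b) = (a \<otimes> k) \<otimes> b" using aG bG KG[OF k] by (simp add: m_assoc)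
    also have "a \<otimes> k = k \<otimes> a" using a k by (simp add: centralizer_def)
    finally show ?thesis using aG bG KG[OF k] by (simp add: m_assoc)
  qed
  then show "a \<otimes> b \<in> centralizer K" using aG bG by (simp add: centralizer_def)
qed

lemma centralizer_normal: assumes "K \<lhd> G" shows "centralizer K \<lhd> G"
proof -
  have KG: "k \<in> carrier G" if "k \<in> K" for k
    using that normal_imp_subgroup[OF assms] subgroup.mem_carrier by metis
  note sub = centralizer_subgroup[OF KG]
  have "g \<otimes> a \<otimes> inv g \<in> centralizer K" if g: "g \<in> carrier G" and a: "a \<in> centralizer K" for g a
  proof -
    have aG: "a \<in> carrier G" using a by (simp add: centralizer_def)
    have "g \<otimes> a \<otimes> inv g \<otimes> k = k \<otimes> (g \<otimes> a \<otimes> inv g)" if k: "k \<in> K" for k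
    proof -
      define l where "l = inv g \<otimes> k \<otimes> g"
      have lK: "l \<in> K" using normal.inv_op_closed1[OF assms g k] by (simp add: l_def)
      have gl: "k = g \<otimes> l \<otimes> inv g"
        using g KG[OF k] by (simp add: l_def m_assoc) (simp add: m_assoc[symmetric])
      interpret c: group_hom G G "\<lambda>x. g \<otimes> x \<otimes> inv g" using conj_hom[OF g] .
      show ?thesis unfolding gl
        using c.hom_mult[OF aG KG[OF lK]] c.hom_mult[OF KG[OF lK] aG] a lK by (simp add: centralizer_def)
    qed
    then show ?thesis using aG g by (simp add: centralizer_def)
  qed
  then show ?thesis using sub normal_iff_cnj by (auto simp: cnj_def)
qed

abbreviation centre where "centre \<equiv> centralizer (carrier G)"

text \<open>The centre is the set of fixed points of conjugation, so its order is divisible by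
  \<open>p\<close>.\<close>

lemma p_group_centre:
  assumes "prime p" "order G = p ^ k" "k > 0" shows "centre \<noteq> {\<one>}"
proof
  assume c: "centre = {\<one>}"
  interpret A: grp_act G "carrier G" "\<lambda>g x. g \<otimes> x \<otimes> inv g"
    by unfold_locales (auto simp: conj_mult)
  have "A.fixpts = centre" unfolding A.fixpts_def centralizer_def by (auto simp: inv_solve_right')
  moreover have "card (carrier G) mod p = 0" using assms by (simp add: order_def)
  ultimately have "1 mod p = 0" using A.fixpts_cong[OF fin assms(1,2)] c by simp
  then show False using prime_gt_1_nat[OF assms(1)] by simp
qed

end

lemma p_group_solvable_nat:
  fixes G :: "nat monoid"
  assumes "fin_group G" "prime p" "order G = p ^ k"
  shows "solvable G"
  using assms
proof (induction "order G" arbitrary: G k rule: less_induct)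
  case less
  interpret fin_group G by fact
  show ?case
  proof (cases "k = 0")
    case True
    then have "carrier G = {\<one>\<^bsub>G\<^esub>}" using less.prems(3) order_one_triv_iff by simp
    then have "solvable (G\<lparr>carrier := {\<one>\<^bsub>G\<^esub>}\<rparr>)" using solvable_comm[OF triv_subgroup] by simp
    then show ?thesis using \<open>carrier G = {\<one>\<^bsub>G\<^esub>}\<close>
      by (metis partial_object.update_convs(1) partial_object.surjective)
  next
    case False
    have Z: "centre \<lhd> G" "subgroup centre G" using centralizer_normal[OF normal_self] normal_imp_subgroup
      by blast+
    interpret Q: fin_group "G Mod centre" using fin_group_Mod Z by blast
    have o: "order (G Mod centre) * card centre = order G" using order_Mod Z by blast
    then obtain j where j: "order (G Mod centre) = p ^ j"
      using less.prems divides_primepow_nat by (metis dvd_triv_left)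
    have lt: "order (G Mod centre) < order G"
      using order_Mod_less[OF Z(1) p_group_centre[OF less.prems(2,3)]] False by simp
    obtain H :: "nat monoid" and h where H: "fin_group H" "h \<in> iso (G Mod centre) H"
      using ex_nat_iso[of "G Mod centre"] Q.fin_group_axioms by blast
    then have "solvable H" using less.hyps[of H j] lt less.prems(2) j iso_order[OF H(2)] by metis
    then have "solvable (G Mod centre)"
      using iso_solvable[of "G Mod centre" H h] H Q.is_group by (simp add: fin_group_def)
    moreover have "x \<otimes>\<^bsub>G\<^esub> y = y \<otimes>\<^bsub>G\<^esub> x" if "x \<in> centre" "y \<in> centre" for x y
      using that unfolding centralizer_def by blast
    then have "solvable (G\<lparr>carrier := centre\<rparr>)" using solvable_comm[OF Z(2)] by blast
    ultimately show ?thesis using solvable_ext Z by blast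
  qed
qed

lemma p_group_solvable:
  assumes "fin_group G" "prime p" "order G = p ^ k"
  shows "solvable G"
proof -
  obtain H :: "nat monoid" and h where H: "fin_group H" "h \<in> iso G H"
    using ex_nat_iso assms(1) by blast
  then show ?thesis
    using iso_solvable[of G H h] p_group_solvable_nat[OF H(1) assms(2)] assms iso_order[OF H(2)]
    by (simp add: fin_group_def)
qed

context fin_group
begin

text \<open>A normal Sylow subgroup is the only one for its prime, and conjugation by elements of
  \<open>G\<close> maps Sylow subgroups of \<open>D\<close> to Sylow subgroups of
  \<open>D\<close>.\<close>

lemma normal_trans_char:
  assumes "D \<lhd> G" "P \<in> Syl p (G\<lparr>carrier := D\<rparr>)" "prime p" "P \<lhd> G\<lparr>carrier := D\<rparr>"
  shows "P \<lhd> G"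
proof -
  have sD: "subgroup D G" using assms normal_imp_subgroup by blast
  interpret D: fin_group "G\<lparr>carrier := D\<rparr>" using fin_subgroup sD by blast
  have sP: "subgroup P G" using incl_subgroup[OF sD] D.SylD assms by blast
  have PD: "P \<subseteq> D" using D.Syl_carrier[OF assms(2)] by simp
  have one: "card (Syl p (G\<lparr>carrier := D\<rparr>)) = 1"
  proof -
    have "nrm (G\<lparr>carrier := D\<rparr>) P = D" using D.normal_iff_nrm D.SylD assms by auto
    then have "order (G\<lparr>carrier := D\<rparr>) = card (Syl p (G\<lparr>carrier := D\<rparr>)) * order (G\<lparr>carrier := D\<rparr>)"
      using D.card_Syl_index[OF assms(3,2)] by (simp add: order_def)
    then show ?thesis using D.order_pos by simp
  qed
  have "cnj G g P \<subseteq> P" if g: "g \<in> carrier G" for g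
  proof -
    have "cnj G g P \<subseteq> D" using cnj_mono[OF PD] normal_cnj_eq[OF assms(1) g] by blast
    then have "subgroup (cnj G g P) (G\<lparr>carrier := D\<rparr>)" using subgroup_incl cnj_subgroup g sP sD by blast
    moreover have "card (cnj G g P) = card P" using card_cnj g sP subgroup.subset by blast
    ultimately have "cnj G g P \<in> Syl p (G\<lparr>carrier := D\<rparr>)" using assms(2) by (simp add: Syl_def)
    then show ?thesis using one assms(2) by (metis card_1_singletonE singletonD order_refl)
  qed
  then show ?thesis using normal_iff_cnj sP by blast
qed

text \<open>The last nontrivial term of the derived series of \<open>K\<close> is abelian and normal
  in \<open>G\<close>; any of its nontrivial Sylow subgroups is normal in it, hence in
  \<open>G\<close>.\<close>

lemma solvable_normal_abelian_p:
  assumes "K \<lhd> G" "K \<noteq> {\<one>}" "solvable (G\<lparr>carrier := K\<rparr>)"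
  obtains p k N where "prime p" "N \<lhd> G" "N \<noteq> {\<one>}" "card N = p ^ k"
    "\<And>x y. x \<in> N \<Longrightarrow> y \<in> N \<Longrightarrow> x \<otimes> y = y \<otimes> x"
proof -
  have sK: "subgroup K G" using assms normal_imp_subgroup by blast
  interpret K: group "G\<lparr>carrier := K\<rparr>" using sK subgroup_imp_group by blast
  interpret i: group_hom "G\<lparr>carrier := K\<rparr>" G id
    unfolding group_hom_def group_hom_axioms_def
    using sK K.is_group subgroup.mem_carrier by (fastforce simp: hom_def)
  have "solvable_seq G K" using i.solvable_imp_solvable_img[of K] assms(3) by (simp add: solvable_def)
  then have ex: "\<exists>n. (derived G ^^ n) K = {\<one>}" using solvable_imp_trivial_derived_seq by blast
  define n where "n = (LEAST n. (derived G ^^ n) K = {\<one>})"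
  have n: "(derived G ^^ n) K = {\<one>}" unfolding n_def using ex by (rule LeastI_ex)
  have "n \<noteq> 0" using n assms(2) by (metis funpow_0)
  then obtain m where m: "n = Suc m" using not0_implies_Suc by blast
  define D where "D = (derived G ^^ m) K"
  have D1: "D \<noteq> {\<one>}" using not_less_Least[of m "\<lambda>n. (derived G ^^ n) K = {\<one>}"] m by (auto simp: D_def n_def)
  have "(derived G ^^ j) K \<lhd> G" for j
    by (induction j) (auto simp: assms(1) derived_is_normal)
  then have DG: "D \<lhd> G" by (simp add: D_def)
  then have sD: "subgroup D G" using normal_imp_subgroup by blast
  have dD: "derived G D = {\<one>}" using n m by (simp add: D_def)
  have comm: "x \<otimes> y = y \<otimes> x" if xy: "x \<in> D" "y \<in> D" for x y
  proof -
    have G: "x \<in> carrier G" "y \<in> carrier G" using xy sD subgroup.mem_carrier by metis+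
    have "x \<otimes> y \<otimes> inv x \<otimes> inv y \<in> derived G D"
      unfolding derived_def by (rule generate.incl) (use xy in blast)
    then have "x \<otimes> y \<otimes> inv x \<otimes> inv y = \<one>" using dD by simp
    then show ?thesis using G by (simp add: inv_solve_right')
  qed
  interpret D: fin_group "G\<lparr>carrier := D\<rparr>" using fin_subgroup sD by blast
  have "card D \<noteq> 1" using card_subgroup_gt_one[OF sD D1] by simp
  then obtain p where p: "prime p" "p dvd card D" using prime_factor_nat by blast
  obtain P where P: "P \<in> Syl p (G\<lparr>carrier := D\<rparr>)" using D.Syl_ne p by blast
  interpret Dc: comm_group "G\<lparr>carrier := D\<rparr>" using D.group_comm_groupI comm by simp
  have PD: "P \<lhd> G\<lparr>carrier := D\<rparr>" using Dc.subgroup_imp_normal D.SylD P by blast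
  have cP: "card P = p ^ multiplicity p (card D)" using D.SylD(2)[OF P] by (simp add: order_def)
  have "multiplicity p (card D) > 0"
    using p card_sub_pos[OF sD] by (simp add: prime_multiplicity_gt_zero_iff)
  then have "card P \<noteq> 1" using cP prime_gt_1_nat[OF p(1)] by simp
  then have "P \<noteq> {\<one>}" by auto
  moreover have "P \<subseteq> D" using D.Syl_carrier P by simp
  ultimately show thesis using that[OF p(1) normal_trans_char[OF DG P p(1) PD] _ cP] comm by blast
qed

end

section \<open>Subgroups with a normal Sylow subgroup\<close>

lemma prime_factors_eq_empty_iff: "(n::nat) > 0 \<Longrightarrow> prime_factors n = {} \<longleftrightarrow> n = 1"
  using prime_factorization_empty_iff[of n] by auto

lemma prime_factors_mult_primepow:
  fixes m p :: nat
  assumes "prime p" "m > 0" "k > 0"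
  shows "prime_factors (m * p ^ k) = insert p (prime_factors m)"
  using assms by (auto simp: prime_factors_dvd prime_dvd_mult_iff prime_dvd_power_iff primes_dvd_imp_eq)

text \<open>A weak form of Hall's theorem. An abelian normal \<open>p\<close>-subgroup
  \<open>N\<close> is divided out: for \<open>p\<close> in \<open>\<tau>\<close> the preimage of a
  suitable subgroup of the quotient serves, otherwise a complement of \<open>N\<close> in that
  preimage.\<close>

lemma solvable_subgroup_prime_factors_nat:
  fixes G :: "nat monoid"
  assumes "fin_group G" "solvable G" "\<tau> \<subseteq> prime_factors (order G)"
  shows "\<exists>L. subgroup L G \<and> prime_factors (card L) = \<tau>"
  using assms
proof (induction "order G" arbitrary: G \<tau> rule: less_induct)
  case less
  interpret fin_group G by fact
  show ?case
  proof (cases "carrier G = {\<one>\<^bsub>G\<^esub>}")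
    case True
    then have "order G = 1" using order_one_triv_iff by simp
    then show ?thesis using less.prems(3) triv_subgroup by (intro exI[of _ "{\<one>\<^bsub>G\<^esub>}"]) simp
  next
    case False
    have "solvable (G\<lparr>carrier := carrier G\<rparr>)" using less.prems(2) by simp
    then obtain p k N where N: "prime p" "N \<lhd> G" "N \<noteq> {\<one>\<^bsub>G\<^esub>}" "card N = p ^ k"
      "\<And>x y. x \<in> N \<Longrightarrow> y \<in> N \<Longrightarrow> x \<otimes>\<^bsub>G\<^esub> y = y \<otimes>\<^bsub>G\<^esub> x"
      using solvable_normal_abelian_p[OF normal_self False] by metis
    interpret Q: fin_group "G Mod N" using fin_group_Mod N by blast
    have sN: "subgroup N G" using N normal_imp_subgroup by blast
    have k: "k > 0" using card_subgroup_gt_one[OF sN N(3)] N(4) by (cases k) auto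
    have o: "order (G Mod N) * p ^ k = order G" using order_Mod[OF N(2)] N(4) by simp
    then have pf: "prime_factors (order G) = insert p (prime_factors (order (G Mod N)))"
      using prime_factors_mult_primepow[OF N(1) Q.order_pos k] by simp
    have lt: "order (G Mod N) < order G" using order_Mod_less[OF N(2,3)] .
    \<comment> \<open>For \<open>p\<close> in \<open>\<tau>\<close> the prime \<open>p\<close> may
      or may not still divide the order of the quotient; either way the preimage has
      \<open>p\<close> among its primes.\<close>
    define \<sigma> where "\<sigma> = (if p \<in> \<tau> then \<tau> \<inter> prime_factors (order (G Mod N)) else \<tau>)"
    have \<sigma>: "\<sigma> \<subseteq> prime_factors (order (G Mod N))" using less.prems(3) pf by (auto simp: \<sigma>_def)
    obtain H :: "nat monoid" and h where H: "fin_group H" "h \<in> iso (G Mod N) H"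
      using ex_nat_iso[of "G Mod N"] Q.fin_group_axioms by blast
    have gH: "group H" using H(1) by (simp add: fin_group_def)
    have "solvable H" using iso_solvable'[OF Q.is_group gH H(2)] solvable_Mod less.prems(2) N(2) by blast
    then obtain L where L: "subgroup L H" "prime_factors (card L) = \<sigma>"
      using less.hyps[of H \<sigma>] lt iso_order[OF H(2)] H(1) \<sigma> by metis
    obtain A where A: "subgroup A (G Mod N)" "card A = card L"
      using ex_iso_subgroup[OF Q.is_group gH H(2) L(1)] by blast
    then have cA: "prime_factors (card A) = \<sigma>" using L(2) by simp
    show ?thesis
    proof (cases "p \<in> \<tau>")
      case True
      have "prime_factors (card (lift N A)) = insert p \<sigma>"
        using card_lift[OF N(2) A(1)] N(4) prime_factors_mult_primepow[OF N(1) Q.card_sub_pos[OF A(1)] k] cA by simp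
      also have "\<dots> = \<tau>" using True less.prems(3) pf by (auto simp: \<sigma>_def)
      finally show ?thesis using lift_subgroup[OF N(2) A(1)] by blast
    next
      case False
      then have "p \<notin> prime_factors (card A)" using cA by (simp add: \<sigma>_def)
      then have "\<not> p dvd card A" using N(1) Q.card_sub_pos[OF A(1)] by (simp add: prime_factors_dvd)
      then have "coprime (card N) (card A)" using N(1,4) by (simp add: prime_imp_coprime)
      then obtain K where "subgroup K G" "card K = card A"
        using abelian_complement_lift[OF N(2,5) A(1)] by blast
      then show ?thesis using cA False by (auto simp: \<sigma>_def)
    qed
  qed
qed

lemma solvable_subgroup_prime_factors:
  assumes "fin_group G" "solvable G" "\<tau> \<subseteq> prime_factors (order G)"
  shows "\<exists>L. subgroup L G \<and> prime_factors (card L) = \<tau>"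
proof -
  interpret fin_group G by fact
  obtain H :: "nat monoid" and h where H: "fin_group H" "h \<in> iso G H"
    using ex_nat_iso assms(1) by blast
  have gH: "group H" using H(1) by (simp add: fin_group_def)
  obtain L where L: "subgroup L H" "prime_factors (card L) = \<tau>"
    using solvable_subgroup_prime_factors_nat[OF H(1) iso_solvable'[OF is_group gH H(2) assms(2)]]
      assms(3) iso_order[OF H(2)] by metis
  then show ?thesis using ex_iso_subgroup[OF is_group gH H(2), of L] by auto
qed

lemma (in grp_act) p_group_small_fixed:
  assumes "prime p" "order G = p ^ k" "finite E" "card E < p" "e \<in> E" "g \<in> carrier G"
  shows "act g e = e"
proof -
  have fin: "finite (carrier G)"
    using assms by (metis order_gt_0_iff_finite zero_less_power prime_gt_0_nat)
  have "card (orb e) dvd p ^ k" using card_orb_dvd[OF assms(5) fin] assms(2) by simp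
  then obtain j where j: "card (orb e) = p ^ j" using assms(1) divides_primepow_nat by blast
  have "card (orb e) \<le> card E" using card_mono[OF assms(3) orb_subset[OF assms(5)]] .
  then have "j = 0" using j assms(4) self_le_power[of p j] prime_gt_1_nat[OF assms(1)] by (cases "j = 0") auto
  then obtain x where x: "orb e = {x}" using j card_1_singletonE by auto
  then have "e = x" "act g e = x" using mem_orb[OF assms(5)] assms(6) unfolding orb_def by auto
  then show ?thesis by simp
qed

lemma (in grp_act) faithful_order_dvd_fact:
  assumes "finite E" "\<And>g. g \<in> carrier G \<Longrightarrow> (\<forall>e\<in>E. act g e = e) \<Longrightarrow> g = \<one>"
  shows "order G dvd fact (card E)"
proof -
  define P :: "('e \<Rightarrow> 'e) monoid" where "P = \<lparr>carrier = {f. f permutes E}, monoid.mult = (\<circ>), one = id\<rparr>"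
  interpret P: group P
  proof (rule groupI)
    show "\<exists>y\<in>carrier P. y \<otimes>\<^bsub>P\<^esub> x = \<one>\<^bsub>P\<^esub>" if "x \<in> carrier P" for x
      using that permutes_inv[of x E] permutes_inv_o(2)[of x E] by (auto simp: P_def)
  qed (auto simp: P_def permutes_compose permutes_id comp_assoc)
  \<comment> \<open>Extended by the identity outside \<open>E\<close>, as a permutation of
    \<open>E\<close> is a total function.\<close>
  define h where "h g = (\<lambda>e. if e \<in> E then act g e else e)" for g
  have hp: "h g permutes E" if g: "g \<in> carrier G" for g
  proof (rule bij_imp_permutes)
    have "bij_betw (act g) E E"
      by (rule bij_betwI[where g = "act (inv g)"])
        (use g act_closed act_inv[of g] act_inv[of "inv g"] in auto)
    then show "bij_betw (h g) E E" by (rule bij_betw_cong[THEN iffD1, rotated]) (simp add: h_def)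
  qed (simp add: h_def)
  interpret h: group_hom G P h
    by unfold_locales (use hp act_mult act_closed in \<open>auto simp: hom_def P_def h_def fun_eq_iff\<close>)
  have "inj_on h (carrier G)"
  proof (subst h.inj_on_one_iff, intro allI impI)
    fix x assume "x \<in> carrier G" "h x = \<one>\<^bsub>P\<^esub>"
    then show "x = \<one>" using assms(2)[of x] by (auto simp: P_def h_def fun_eq_iff split: if_splits)
  qed
  then have "card (h ` carrier G) = order G" by (simp add: card_image order_def)
  moreover have "card (h ` carrier G) dvd order P"
    using P.lagrange[OF h.img_is_subgroup] dvd_triv_right by metis
  moreover have "order P = fact (card E)"
    using card_permutations[OF refl assms(1)] by (simp add: order_def P_def)
  ultimately show ?thesis by simp
qed

text \<open>
  \<open>n q * 2 ^ card (R q - E)\<close> bounds the number of subgroups that have a normal Sylow \<open>q\<close>-subgroup of \<open>G\<close> and order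
  prime to \<open>E\<close>; collecting the primes already treated in \<open>E\<close> makes the families disjoint.
\<close>
fun weight :: "(nat \<Rightarrow> nat) \<Rightarrow> (nat \<Rightarrow> nat set) \<Rightarrow> nat list \<Rightarrow> nat set \<Rightarrow> nat" where
  "weight n R [] E = 0"
| "weight n R (q # qs) E = n q * 2 ^ card (R q - E) + weight n R qs (insert q E)"

section \<open>Counting pairs of a Sylow subgroup and a set of primes\<close>

context fin_group
begin

abbreviation \<pi> where "\<pi> \<equiv> prime_factors (order G)"

definition nSyl where "nSyl q = card (Syl q G)"

text \<open>\<open>order G div nSyl q\<close> is the order of the normalizer of any Sylow
  \<open>q\<close>-subgroup; this form avoids choosing one.\<close>

definition nrmprimes where "nrmprimes q = prime_factors (order G div nSyl q) - {q}"

lemma nSyl_pos: "prime q \<Longrightarrow> nSyl q > 0"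
  using card_Syl_mod[of q] unfolding nSyl_def by (cases "card (Syl q G) = 0") auto

lemma card_nrm_Syl: "prime q \<Longrightarrow> Q \<in> Syl q G \<Longrightarrow> card (nrm G Q) = order G div nSyl q"
  using card_Syl_index[of q Q] nSyl_pos[of q] unfolding nSyl_def
  by (metis nonzero_mult_div_cancel_left less_numeral_extra(3))

lemma nSyl_mult: "prime q \<Longrightarrow> nSyl q * (order G div nSyl q) = order G"
  using card_Syl_index Syl_ne card_nrm_Syl unfolding nSyl_def by (metis all_not_in_conv)

lemma nSyl_dvd: "prime q \<Longrightarrow> nSyl q dvd order G"
  using nSyl_mult by (metis dvd_triv_left)

lemma finite_nrmprimes: "finite (nrmprimes q)" by (simp add: nrmprimes_def)

lemma Syl_eq_if_nrm:
  assumes "prime q" "Q \<in> Syl q G" "R \<in> Syl q G" "R \<subseteq> nrm G Q" shows "R = Q"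
proof -
  have "R \<subseteq> Q" using p_subgroup_in_normal_Syl[OF assms(1,2)] SylD assms by blast
  then show ?thesis using card_subset_eq finite_sub SylD assms by metis
qed

definition normal_Syl_subs where
  "normal_Syl_subs q E = {H. subgroup H G \<and> q dvd card H \<and> prime_factors (card H) \<inter> E = {} \<and>
     (\<exists>Q\<in>Syl q G. Q \<subseteq> H \<and> H \<subseteq> nrm G Q)}"

text \<open>The set \<open>\<tau>\<close> is realized in the solvable quotient of the normalizer by
  \<open>Q\<close>, and the preimage adds \<open>q\<close>.\<close>

lemma ex_normal_Syl_sub:
  assumes q: "q \<in> \<pi>" and Q: "Q \<in> Syl q G"
    and solv: "solvable (G\<lparr>carrier := nrm G Q\<rparr>)" and \<tau>: "\<tau> \<subseteq> nrmprimes q"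
  shows "\<exists>H. subgroup H G \<and> Q \<subseteq> H \<and> H \<subseteq> nrm G Q \<and> prime_factors (card H) = insert q \<tau>"
proof -
  have pq: "prime q" "q dvd order G" using q by auto
  let ?N = "G\<lparr>carrier := nrm G Q\<rparr>"
  have sN: "subgroup (nrm G Q) G" using nrm_subgroup Syl_carrier Q by blast
  have sQ: "subgroup Q G" using SylD Q by blast
  interpret N: fin_group ?N using fin_subgroup sN by blast
  have n: "Q \<lhd> ?N" using nrm_normal sQ .
  interpret M: fin_group "?N Mod Q" using N.fin_group_Mod n by blast
  have m: "multiplicity q (order G) > 0" using pq order_pos by (simp add: prime_multiplicity_gt_zero_iff)
  have cQ: "card Q = q ^ multiplicity q (order G)" using SylD Q by blast
  have o: "order (?N Mod Q) * q ^ multiplicity q (order G) = card (nrm G Q)"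
    using N.order_Mod[OF n] cQ by (simp add: order_def)
  have "prime_factors (card (nrm G Q)) = insert q (prime_factors (order (?N Mod Q)))"
    using prime_factors_mult_primepow[OF pq(1) M.order_pos m] o by simp
  then have "\<tau> \<subseteq> prime_factors (order (?N Mod Q))"
    using \<tau> card_nrm_Syl[OF pq(1) Q] by (auto simp: nrmprimes_def)
  then obtain A where A: "subgroup A (?N Mod Q)" "prime_factors (card A) = \<tau>"
    using solvable_subgroup_prime_factors[OF M.fin_group_axioms N.solvable_Mod[OF solv n]] by blast
  let ?H = "N.lift Q A"
  have sH: "subgroup ?H ?N" using N.lift_subgroup[OF n A(1)] .
  have "prime_factors (card ?H) = insert q \<tau>"
    using N.card_lift[OF n A(1)] cQ prime_factors_mult_primepow[OF pq(1) M.card_sub_pos[OF A(1)] m] A(2)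
      by simp
  moreover have "subgroup ?H G" using incl_subgroup[OF sN sH] .
  moreover have "?H \<subseteq> nrm G Q" using subgroup.subset[OF sH] by simp
  moreover have "Q \<subseteq> ?H" using N.subset_lift[OF n A(1)] .
  ultimately show ?thesis by blast
qed

text \<open>A subgroup chosen for \<open>Q\<close> and \<open>\<tau>\<close> determines both:
  \<open>Q\<close> is the only Sylow \<open>q\<close>-subgroup of \<open>G\<close> inside its own
  normalizer, and \<open>\<tau>\<close> consists of the primes of the order other than
  \<open>q\<close>.\<close>

lemma card_normal_Syl_subs:
  assumes q: "q \<in> \<pi>" "q \<notin> E"
    and solv: "\<And>Q. Q \<in> Syl q G \<Longrightarrow> solvable (G\<lparr>carrier := nrm G Q\<rparr>)"
  shows "nSyl q * 2 ^ card (nrmprimes q - E) \<le> card (normal_Syl_subs q E)"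
proof -
  have pq: "prime q" "q dvd order G" using q by auto
  define P where "P Q \<tau> H \<longleftrightarrow> subgroup H G \<and> Q \<subseteq> H \<and> H \<subseteq> nrm G Q \<and> prime_factors (card H) = insert q \<tau>" for Q \<tau> H
  define f where "f = (\<lambda>(Q, \<tau>). SOME H. P Q \<tau> H)"
  have f: "P Q \<tau> (f (Q, \<tau>))" if "Q \<in> Syl q G" "\<tau> \<subseteq> nrmprimes q" for Q \<tau>
    unfolding f_def split
    by (rule someI_ex) (use ex_normal_Syl_sub[OF q(1) that(1) solv that(2)] that in \<open>auto simp: P_def\<close>)
  let ?D = "Syl q G \<times> Pow (nrmprimes q - E)"
  have "inj_on f ?D"
  proof (rule inj_onI, clarify)
    fix Q \<tau> Q' \<tau>' assume a: "Q \<in> Syl q G" "Q' \<in> Syl q G" "\<tau> \<subseteq> nrmprimes q - E" "\<tau>' \<subseteq> nrmprimes q - E"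
      "f (Q, \<tau>) = f (Q', \<tau>')"
    have 1: "P Q \<tau> (f (Q, \<tau>))" "P Q' \<tau>' (f (Q, \<tau>))" using f[of Q \<tau>] f[of Q' \<tau>'] a by auto
    then have "Q' \<subseteq> nrm G Q" by (auto simp: P_def)
    then have "Q' = Q" using Syl_eq_if_nrm pq a by blast
    moreover have "q \<notin> \<tau>" "q \<notin> \<tau>'" using a by (auto simp: nrmprimes_def)
    then have "\<tau> = \<tau>'" using 1 by (auto simp: P_def)
    ultimately show "Q = Q' \<and> \<tau> = \<tau>'" by simp
  qed
  moreover have "f ` ?D \<subseteq> normal_Syl_subs q E"
  proof clarify
    fix Q \<tau> assume a: "Q \<in> Syl q G" "\<tau> \<subseteq> nrmprimes q - E"
    then have "P Q \<tau> (f (Q, \<tau>))" using f by blast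
    moreover have "insert q \<tau> \<inter> E = {}" using a q(2) by auto
    moreover have "q dvd card (f (Q, \<tau>))" using calculation(1) unfolding P_def
      by (metis in_prime_factors_imp_dvd insertI1)
    ultimately show "f (Q, \<tau>) \<in> normal_Syl_subs q E"
      using a unfolding normal_Syl_subs_def P_def by auto
  qed
  moreover have "finite (normal_Syl_subs q E)"
    by (rule finite_subset[OF _ finite_subs]) (auto simp: normal_Syl_subs_def)
  ultimately have "card ?D \<le> card (normal_Syl_subs q E)" using card_inj_on_le by blast
  moreover have "card ?D = nSyl q * 2 ^ card (nrmprimes q - E)"
    by (simp add: card_cartesian_product card_Pow finite_nrmprimes nSyl_def)
  ultimately show ?thesis by simp
qed

text \<open>Orders in the family of the head \<open>q\<close> are divisible by \<open>q\<close>,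
  orders in the later families are not. The whole group is in no family, since then a Sylow subgroup
  would be normal, against \<open>nSyl q \<noteq> 1\<close>.\<close>

lemma weight_le:
  assumes "distinct qs" "set qs \<subseteq> \<pi>" "set qs \<inter> E = {}"
    and ne1: "\<And>q. q \<in> set qs \<Longrightarrow> nSyl q \<noteq> 1"
    and solv: "\<And>q Q. q \<in> set qs \<Longrightarrow> Q \<in> Syl q G \<Longrightarrow> solvable (G\<lparr>carrier := nrm G Q\<rparr>)"
  shows "weight nSyl nrmprimes qs E \<le>
    card {H. subgroup H G \<and> H \<noteq> {\<one>} \<and> H \<noteq> carrier G \<and> prime_factors (card H) \<inter> E = {} \<and>
      (\<exists>q\<in>set qs. H \<in> normal_Syl_subs q {})}"
    (is "_ \<le> card (?S qs E)")
  using assms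
proof (induction qs arbitrary: E)
  case Nil
  then show ?case by simp
next
  case (Cons q qs)
  have q: "q \<in> \<pi>" "q \<notin> E" using Cons.prems by auto
  have pq: "prime q" "q dvd order G" using q by auto
  have fin: "finite (?S qs E)" for qs E by (rule finite_subset[OF _ finite_subs]) auto
  have 1: "nSyl q * 2 ^ card (nrmprimes q - E) \<le> card (normal_Syl_subs q E)"
    by (rule card_normal_Syl_subs[OF q]) (use Cons.prems(5)[of q] in simp)
  have 2: "weight nSyl nrmprimes qs (insert q E) \<le> card (?S qs (insert q E))"
    by (rule Cons.IH) (use Cons.prems in auto)
  have ne: "H \<noteq> {\<one>}" "H \<noteq> carrier G" if H: "H \<in> normal_Syl_subs q E" for H
  proof -
    show "H \<noteq> {\<one>}" using H pq(1) by (auto simp: normal_Syl_subs_def)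
    show "H \<noteq> carrier G"
    proof
      assume "H = carrier G"
      then obtain Q where Q: "Q \<in> Syl q G" "carrier G \<subseteq> nrm G Q" using H by (auto simp: normal_Syl_subs_def)
      then have "Syl q G = {Q}" using Syl_eq_if_nrm[OF pq(1) Q(1)] Syl_carrier by blast
      then show False using Cons.prems(4)[of q] by (simp add: nSyl_def)
    qed
  qed
  have "normal_Syl_subs q E \<inter> ?S qs (insert q E) = {}"
  proof -
    have "q \<in> prime_factors (card H)" if "H \<in> normal_Syl_subs q E" for H
      using that pq card_sub_pos[of H] by (auto simp: normal_Syl_subs_def prime_factors_dvd)
    then show ?thesis by blast
  qed
  then have disj: "normal_Syl_subs q E \<inter> ?S qs (insert q E) = {}" .
  have sub: "normal_Syl_subs q E \<union> ?S qs (insert q E) \<subseteq> ?S (q # qs) E"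
    using ne by (auto simp: normal_Syl_subs_def)
  have "finite (normal_Syl_subs q E)"
    by (rule finite_subset[OF _ finite_subs]) (auto simp: normal_Syl_subs_def)
  then have "card (normal_Syl_subs q E \<union> ?S qs (insert q E)) = card (normal_Syl_subs q E) + card (?S qs (insert q E))"
    using card_Un_disjoint[OF _ fin disj] by simp
  then have "card (normal_Syl_subs q E) + card (?S qs (insert q E)) \<le> card (?S (q # qs) E)"
    using card_mono[OF fin sub] by simp
  then show ?case using 1 2 by simp
qed

text \<open>With index prime to \<open>r\<close>, the orders of \<open>K\<close> and
  \<open>G\<close> have the same \<open>r\<close>-part.\<close>

lemma Syl_consistent:
  assumes "prime r" "subgroup K G" "\<not> r dvd order G div card K"
  shows "Syl r (G\<lparr>carrier := K\<rparr>) \<subseteq> Syl r G"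
proof
  fix R assume R: "R \<in> Syl r (G\<lparr>carrier := K\<rparr>)"
  interpret K: fin_group "G\<lparr>carrier := K\<rparr>" using fin_subgroup assms(2) .
  obtain m where m: "order G = card K * m" using card_sub_dvd[OF assms(2)] by blast
  have pos: "card K > 0" "m > 0" using m order_pos by (auto intro!: Nat.gr0I)
  then have "\<not> r dvd m" using assms(3) m by simp
  then have "multiplicity r (order G) = multiplicity r (card K)"
    using m pos assms(1) by (simp add: prime_elem_multiplicity_mult_distrib not_dvd_imp_multiplicity_0)
  then have "card R = r ^ multiplicity r (order G)" using K.SylD(2)[OF R] by (simp add: order_def)
  moreover have "subgroup R G" using incl_subgroup[OF assms(2)] K.SylD(1)[OF R] .
  ultimately show "R \<in> Syl r G" by (simp add: Syl_def)
qed

text \<open>A Sylow \<open>r\<close>-subgroup normalizing a group of prime order \<open>q < r\<close> centralizes it.\<close>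
lemma prime_Syl_nrmprimes:
  assumes "prime q" "prime r" "q < r" "multiplicity q (order G) = 1" "\<not> r dvd nSyl q"
  shows "q \<in> nrmprimes r"
proof -
  obtain Q where Q: "Q \<in> Syl q G" using Syl_ne assms(1) by blast
  have sQ: "subgroup Q G" "card Q = q" using SylD[OF Q] assms(4) by auto
  have sN: "subgroup (nrm G Q) G" using nrm_subgroup Syl_carrier Q by blast
  interpret N: fin_group "G\<lparr>carrier := nrm G Q\<rparr>" using fin_subgroup sN .
  obtain R where R: "R \<in> Syl r (G\<lparr>carrier := nrm G Q\<rparr>)" using N.Syl_ne assms(2) by blast
  have "order G div card (nrm G Q) = nSyl q"
    using card_nrm_Syl[OF assms(1) Q] nSyl_mult[OF assms(1)] order_pos
    by (metis div_mult_self_is_m gr_zeroI mult_zero_right)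
  \<comment> \<open>The index of the normalizer of \<open>Q\<close> is \<open>nSyl q\<close>, which
    is prime to \<open>r\<close>; a full Sylow \<open>r\<close>-subgroup of \<open>G\<close>
    therefore normalizes \<open>Q\<close>.\<close>
  then have RG: "R \<in> Syl r G" using Syl_consistent[OF assms(2) sN] assms(5) R by auto
  have sR: "subgroup R G" "card R = r ^ multiplicity r (order G)" using SylD RG by auto
  have RN: "R \<subseteq> nrm G Q" using N.Syl_carrier[OF R] by simp
  interpret RG: group "G\<lparr>carrier := R\<rparr>" using sR subgroup_imp_group by blast
  interpret A: grp_act "G\<lparr>carrier := R\<rparr>" Q "\<lambda>g x. g \<otimes> x \<otimes> inv g"
  proof unfold_locales
    fix g e assume ge: "g \<in> carrier (G\<lparr>carrier := R\<rparr>)" "e \<in> Q"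
    then have "g \<otimes> e \<otimes> inv g \<in> cnj G g Q" by (auto simp: cnj_def)
    moreover have "cnj G g Q = Q" using ge RN by (auto simp: nrm_def)
    ultimately show "g \<otimes> e \<otimes> inv g \<in> Q" by simp
  qed (use subgroup.subset[OF sQ(1)] subgroup.subset[OF sR(1)] in \<open>auto simp: conj_mult subset_iff\<close>)
  have fixed: "g \<otimes> x \<otimes> inv g = x" if "g \<in> R" "x \<in> Q" for g x
    using A.p_group_small_fixed[OF assms(2), of "multiplicity r (order G)" x g] that sR(2) sQ(2) assms(3)
      finite_sub[OF sQ(1)] by (simp add: order_def)
  have "Q \<subseteq> nrm G R"
  proof
    fix x assume x: "x \<in> Q"
    have xG: "x \<in> carrier G" using x sQ subgroup.mem_carrier by metis
    have "x \<otimes> g \<otimes> inv x = g" if g: "g \<in> R" for g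
    proof -
      have gG: "g \<in> carrier G" using g sR subgroup.mem_carrier by metis
      have "g \<otimes> x = x \<otimes> g" using fixed[OF g x] gG xG by (simp add: inv_solve_right')
      then have "x \<otimes> g \<otimes> inv x = g \<otimes> x \<otimes> inv x" by simp
      then show ?thesis using gG xG by (simp add: m_assoc)
    qed
    then have "cnj G x R = R" by (simp add: cnj_def)
    then show "x \<in> nrm G R" using xG by (simp add: nrm_def)
  qed
  then have "subgroup Q (G\<lparr>carrier := nrm G R\<rparr>)"
    using subgroup_incl[OF sQ(1)] nrm_subgroup Syl_carrier[OF RG] by blast
  then have "q dvd card (nrm G R)"
    using fin_group.card_sub_dvd[OF fin_subgroup[OF nrm_subgroup[OF Syl_carrier[OF RG]]], of Q] sQ(2)
    by (simp add: order_def)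
  moreover have "card (nrm G R) > 0" using card_sub_pos nrm_subgroup Syl_carrier RG by blast
  ultimately show ?thesis
    using card_nrm_Syl[OF assms(2) RG] assms(1,3) by (auto simp: nrmprimes_def prime_factors_dvd)
qed

end

section \<open>Groups with p + 1 Sylow p-subgroups\<close>

context fin_group
begin

lemma mem_nrm_iff: "g \<in> nrm G H \<longleftrightarrow> g \<in> carrier G \<and> cnj G g H = H"
  by (simp add: nrm_def)

lemma prime_order_sub_eq:
  assumes "subgroup P G" "prime (card P)" "subgroup D G" "D \<subseteq> P" "D \<noteq> {\<one>}"
  shows "D = P"
proof -
  have "subgroup D (G\<lparr>carrier := P\<rparr>)" using subgroup_incl assms by blast
  then have "card D dvd card P"
    using fin_group.card_sub_dvd[OF fin_subgroup[OF assms(1)]] by (simp add: order_def)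
  moreover have "card D \<noteq> 1" using assms(5) subgroup.one_closed[OF assms(3)]
    by (auto simp: card_1_singleton_iff)
  ultimately have "card D = card P" using assms(2) prime_nat_iff by blast
  then show ?thesis using card_subset_eq[OF finite_sub[OF assms(1)] assms(4)] by simp
qed

end

text \<open>Double transitivity is a consequence: a Sylow \<open>p\<close>-subgroup fixes only
  itself and permutes the other \<open>p\<close> transitively.\<close>

locale doubly_transitive_Syl = fin_group G for G (structure) +
  fixes p :: nat
  assumes prime_p: "prime p"
    and nSyl_p: "card (Syl p G) = p + 1"
    and faithful: "\<And>g. g \<in> carrier G \<Longrightarrow> (\<And>R. R \<in> Syl p G \<Longrightarrow> cnj G g R = R) \<Longrightarrow> g = \<one>"
begin

lemma conj_act_Syl:
  assumes "subgroup K G" "\<And>g R. g \<in> K \<Longrightarrow> R \<in> S \<Longrightarrow> cnj G g R = R"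
  shows "grp_act (G\<lparr>carrier := K\<rparr>) (Syl p G - S) (cnj G)"
proof (rule conj_act[OF assms(1)])
  show "Syl p G - S \<subseteq> Pow (carrier G)" using Syl_carrier by blast
  fix g H assume g: "g \<in> K" and H: "H \<in> Syl p G - S"
  have gG: "g \<in> carrier G" using g assms(1) subgroup.mem_carrier by metis
  have "cnj G g H \<notin> S"
  proof
    assume a: "cnj G g H \<in> S"
    have "inv g \<in> K" using subgroup.m_inv_closed[OF assms(1) g] .
    then have "cnj G (inv g) (cnj G g H) = cnj G g H" using assms(2) a by blast
    then have "H = cnj G g H" using cnj_inv_cnj[OF gG] H Syl_carrier by auto
    then show False using a H by auto
  qed
  then show "cnj G g H \<in> Syl p G - S" using H cnj_Syl gG by blast
qed

text \<open>The orbit of \<open>R\<close> under \<open>P\<close> has length a power of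
  \<open>p\<close>, more than 1 because \<open>P\<close> does not normalize \<open>R\<close>, and at
  most \<open>p\<close>.\<close>

lemma Syl_transitive:
  assumes "P \<in> Syl p G" "R \<in> Syl p G" "R \<noteq> P" "S \<in> Syl p G" "S \<noteq> P"
  shows "\<exists>u\<in>P. S = cnj G u R"
    and "card P = p * card (P \<inter> nrm G R)"
proof -
  have sP: "subgroup P G" using SylD assms by blast
  interpret A: grp_act "G\<lparr>carrier := P\<rparr>" "Syl p G - {P}" "cnj G"
    using conj_act_Syl[OF sP, of "{P}"] cnj_self[OF sP] by blast
  have cS: "card (Syl p G - {P}) = p" using assms(1) nSyl_p finite_Syl by simp
  have RS: "R \<in> Syl p G - {P}" using assms by blast
  have finP: "finite (carrier (G\<lparr>carrier := P\<rparr>))" using finite_sub sP by simp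
  obtain k where k: "card P = p ^ k" using SylD assms by blast
  have st: "A.stab R = P \<inter> nrm G R" using subgroup.subset[OF sP] by (auto simp: A.stab_def nrm_def)
  have o: "card P = card (A.orb R) * card (P \<inter> nrm G R)"
    using A.orbit_stabilizer[OF RS finP] st by (simp add: order_def)
  then obtain j where j: "card (A.orb R) = p ^ j" using k prime_p divides_primepow_nat
    by (metis dvd_triv_left)
  have "j \<noteq> 0"
  proof
    assume "j = 0"
    then have "card P = card (P \<inter> nrm G R)" using o j by simp
    then have "P \<inter> nrm G R = P" using card_subset_eq[of P "P \<inter> nrm G R"] finP by simp
    then have "P \<subseteq> nrm G R" by blast
    then show False using Syl_eq_if_nrm[OF prime_p assms(2,1)] assms(3) by blast
  qed
  moreover have "card (A.orb R) \<le> p"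
    using card_mono[OF _ A.orb_subset[OF RS]] cS finite_Syl by simp
  ultimately have "card (A.orb R) = p"
    using j prime_gt_1_nat[OF prime_p] self_le_power[of p j] by (simp add: order_antisym)
  then show "card P = p * card (P \<inter> nrm G R)" using o by simp
  have "A.orb R = Syl p G - {P}"
    using card_subset_eq[OF _ A.orb_subset[OF RS]] cS finite_Syl \<open>card (A.orb R) = p\<close> by simp
  then have "S \<in> A.orb R" using assms by simp
  then show "\<exists>u\<in>P. S = cnj G u R" unfolding A.orb_def by auto
qed

lemma ex_other: "P \<in> Syl p G \<Longrightarrow> \<exists>R\<in>Syl p G. R \<noteq> P"
proof (rule ccontr)
  assume "P \<in> Syl p G" "\<not> (\<exists>R\<in>Syl p G. R \<noteq> P)"
  then have "Syl p G = {P}" by blast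
  then show False using nSyl_p prime_gt_1_nat[OF prime_p] by simp
qed

text \<open>This \<open>p\<close>-group fixes \<open>P\<close> and \<open>R\<close>, leaving only
  \<open>p - 1\<close> points, too few for a nontrivial orbit; by faithfulness it is
  trivial.\<close>

lemma Syl_Int_nrm: assumes "P \<in> Syl p G" "R \<in> Syl p G" "R \<noteq> P" shows "P \<inter> nrm G R = {\<one>}"
proof -
  have sP: "subgroup P G" using SylD assms by blast
  have sN: "subgroup (nrm G R) G" using nrm_subgroup Syl_carrier assms by blast
  have sD: "subgroup (P \<inter> nrm G R) G" using sP sN by (rule subgroups_Inter_pair)
  have fx: "cnj G g H = H" if "g \<in> P \<inter> nrm G R" "H \<in> {P, R}" for g H
    using that cnj_self[OF sP] by (auto simp: nrm_def)
  interpret A: grp_act "G\<lparr>carrier := P \<inter> nrm G R\<rparr>" "Syl p G - {P, R}" "cnj G"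
    using conj_act_Syl[OF sD fx] by blast
  obtain k where "card (P \<inter> nrm G R) = p ^ k"
    using SylD(2)[OF assms(1)] Syl_transitive(2)[OF assms assms(2,3)] prime_p divides_primepow_nat
    by (metis dvd_triv_right)
  moreover have "card (Syl p G - {P, R}) < p"
    using assms nSyl_p finite_Syl prime_gt_1_nat[OF prime_p] by simp
  ultimately have "cnj G g H = H" if "g \<in> P \<inter> nrm G R" "H \<in> Syl p G - {P, R}" for g H
    using A.p_group_small_fixed[OF prime_p, of k H g] that finite_Syl by (simp add: order_def)
  then have all: "cnj G g H = H" if "g \<in> P \<inter> nrm G R" "H \<in> Syl p G" for g H
    using that fx[of g H] by (cases "H \<in> {P, R}") auto
  have "g = \<one>" if g: "g \<in> P \<inter> nrm G R" for g
  proof (rule faithful)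
    show "g \<in> carrier G" using g by (simp add: nrm_def)
    show "cnj G g H = H" if "H \<in> Syl p G" for H using all[OF g that] .
  qed
  then show ?thesis using subgroup.one_closed[OF sD] by blast
qed

lemma card_Syl_eq: assumes "P \<in> Syl p G" shows "card P = p"
proof -
  obtain R where "R \<in> Syl p G" "R \<noteq> P" using ex_other assms by blast
  then show ?thesis using Syl_transitive(2)[OF assms, of R R] Syl_Int_nrm[OF assms, of R] by simp
qed

definition two_stab where "two_stab P R = nrm G P \<inter> nrm G R"

lemma two_stab_subgroup: "P \<in> Syl p G \<Longrightarrow> R \<in> Syl p G \<Longrightarrow> subgroup (two_stab P R) G"
  unfolding two_stab_def by (intro subgroups_Inter_pair nrm_subgroup Syl_carrier)

lemma card_two_stab:
  assumes "P \<in> Syl p G" "R \<in> Syl p G" "R \<noteq> P"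
  shows "card (nrm G P) = p * card (two_stab P R)" "order G = p * (p + 1) * card (two_stab P R)"
proof -
  have sP: "subgroup P G" using SylD assms by blast
  have sN: "subgroup (nrm G P) G" using nrm_subgroup Syl_carrier assms by blast
  interpret A: grp_act "G\<lparr>carrier := nrm G P\<rparr>" "Syl p G - {P}" "cnj G"
    using conj_act_Syl[OF sN, of "{P}"] by (auto simp: nrm_def)
  have RS: "R \<in> Syl p G - {P}" using assms by blast
  have "A.orb R = Syl p G - {P}"
  proof
    show "A.orb R \<subseteq> Syl p G - {P}" using A.orb_subset[OF RS] .
    show "Syl p G - {P} \<subseteq> A.orb R"
    proof
      fix S assume "S \<in> Syl p G - {P}"
      then obtain u where "u \<in> P" "S = cnj G u R" using Syl_transitive(1)[OF assms, of S] by blast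
      then show "S \<in> A.orb R" using subset_nrm[OF sP] by (auto simp: A.orb_def)
    qed
  qed
  then have "card (A.orb R) = p" using assms(1) nSyl_p finite_Syl by simp
  moreover have "A.stab R = two_stab P R" unfolding A.stab_def two_stab_def by (auto simp: mem_nrm_iff)
  ultimately show 1: "card (nrm G P) = p * card (two_stab P R)"
    using A.orbit_stabilizer[OF RS] finite_sub[OF sN] by (simp add: order_def)
  show "order G = p * (p + 1) * card (two_stab P R)"
    using card_Syl_index[OF prime_p assms(1)] 1 nSyl_p
      by (simp only: mult.assoc mult.commute mult.left_commute)
qed

text \<open>\<open>P\<close> acts regularly on the Sylow subgroups other than itself. If
  \<open>x\<close> fixes \<open>R\<close> and its image under \<open>u\<close>, then
  \<open>x\<close> commutes with \<open>u\<close>, hence with all of \<open>P\<close>, which has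
  prime order, and so \<open>x\<close> fixes every point.\<close>

lemma two_stab_fixes:
  assumes P: "P \<in> Syl p G" and R: "R \<in> Syl p G" "R \<noteq> P" and x: "x \<in> two_stab P R" "x \<noteq> \<one>"
    and S: "S \<in> Syl p G" "cnj G x S = S"
  shows "S = P \<or> S = R"
proof (rule ccontr)
  assume ne: "\<not> (S = P \<or> S = R)"
  have sP: "subgroup P G" using SylD P by blast
  have RG: "R \<subseteq> carrier G" using Syl_carrier R by blast
  have xG: "x \<in> carrier G" and xP: "cnj G x P = P" and xR: "cnj G x R = R"
    using x by (auto simp: two_stab_def nrm_def)
  obtain u where u: "u \<in> P" "S = cnj G u R" using Syl_transitive(1)[OF P R S(1)] ne by blast
  have uG: "u \<in> carrier G" using u sP subgroup.mem_carrier by metis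
  have "u \<noteq> \<one>" using u ne cnj_one[OF RG] by auto
  \<comment> \<open>Both \<open>u\<close> and its conjugate \<open>v\<close> carry \<open>R\<close>
    to \<open>S\<close>, so regularity of \<open>P\<close> gives \<open>v = u\<close>.\<close>
  define v where "v = x \<otimes> u \<otimes> inv x"
  have vP: "v \<in> P" using xP u(1) by (auto simp: cnj_def v_def)
  have vG: "v \<in> carrier G" using vP sP subgroup.mem_carrier by metis
  have vx: "v \<otimes> x = x \<otimes> u" using xG uG by (simp add: v_def m_assoc)
  have "cnj G v R = cnj G v (cnj G x R)" using xR by simp
  also have "\<dots> = cnj G (x \<otimes> u) R" using vx cnj_mult[OF vG xG RG] by simp
  also have "\<dots> = cnj G u R" using cnj_mult[OF xG uG RG] u(2) S(2) by simp
  finally have "cnj G (inv u \<otimes> v) R = R"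
    using cnj_mult[OF _ vG RG, of "inv u"] cnj_inv_cnj[OF uG RG] uG by simp
  moreover have "inv u \<otimes> v \<in> P" using u vP sP by (simp add: subgroup.m_closed subgroup.m_inv_closed)
  ultimately have "inv u \<otimes> v = \<one>"
    using Syl_Int_nrm[OF P R] uG vG by (auto simp: nrm_def)
  then have "v = u" using uG vG by (metis inv_closed inv_inv inv_equality r_inv)
  then have xu: "u \<otimes> x = x \<otimes> u" using vx by simp
  define D where "D = P \<inter> centralizer {x}"
  have sD: "subgroup D G" unfolding D_def
    by (intro subgroups_Inter_pair sP centralizer_subgroup) (use xG in simp)
  have "u \<in> D" using u xu uG by (simp add: D_def centralizer_def)
  then have "D = P" using prime_order_sub_eq[OF sP _ sD] card_Syl_eq[OF P] prime_p \<open>u \<noteq> \<one>\<close>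
    by (auto simp: D_def)
  have "cnj G x T = T" if T: "T \<in> Syl p G" for T
  proof (cases "T = P")
    case False
    then obtain w where w: "w \<in> P" "T = cnj G w R" using Syl_transitive(1)[OF P R T] by blast
    have wG: "w \<in> carrier G" using w sP subgroup.mem_carrier by metis
    have "w \<otimes> x = x \<otimes> w" using w \<open>D = P\<close> by (auto simp: D_def centralizer_def)
    then have "cnj G x (cnj G w R) = cnj G w (cnj G x R)"
      using cnj_mult[OF xG wG RG] cnj_mult[OF wG xG RG] by simp
    then show ?thesis using w xR by simp
  qed (simp add: xP)
  then show False using faithful xG x(2) by blast
qed

text \<open>Nonidentity elements of the two-point stabilizer fix no further point, so its orbits on
  the other \<open>p - 1\<close> points all have length \<open>card (two_stab P R)\<close>.\<close>

lemma card_two_stab_dvd: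
  assumes "P \<in> Syl p G" "R \<in> Syl p G" "R \<noteq> P"
  shows "card (two_stab P R) dvd p - 1"
proof -
  let ?C = "two_stab P R"
  have sC: "subgroup ?C G" using two_stab_subgroup assms by blast
  interpret A: grp_act "G\<lparr>carrier := ?C\<rparr>" "Syl p G - {P, R}" "cnj G"
    by (rule conj_act_Syl[OF sC]) (auto simp: two_stab_def mem_nrm_iff)
  have "card (A.orb S) = card ?C" if S: "S \<in> Syl p G - {P, R}" for S
  proof -
    have "x = \<one>" if "x \<in> A.stab S" for x
    proof -
      have "x \<in> two_stab P R" "cnj G x S = S" using that by (auto simp: A.stab_def)
      then show ?thesis using two_stab_fixes[OF assms, of x S] S by blast
    qed
    moreover have "\<one> \<in> A.stab S" using subgroup.one_closed[OF A.stab_subgroup[OF S]] by simp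
    ultimately have "A.stab S = {\<one>}" by blast
    then show ?thesis using A.orbit_stabilizer[OF S] finite_sub[OF sC] by (simp add: order_def)
  qed
  then have "card ?C dvd card Y" if "Y \<in> A.orb ` (Syl p G - {P, R})" for Y
    using that by (metis (no_types, lifting) dvd_refl imageE)
  then have "card ?C dvd sum card (A.orb ` (Syl p G - {P, R}))" by (rule dvd_sum)
  then have "card ?C dvd card (Syl p G - {P, R})"
    using A.card_eq_sum_orbits finite_Syl by simp
  moreover have "card (Syl p G - {P, R}) = p - 1" using assms nSyl_p finite_Syl by simp
  ultimately show ?thesis by simp
qed

lemma Syl_Int: assumes "P \<in> Syl p G" "R \<in> Syl p G" "R \<noteq> P" shows "P \<inter> R = {\<one>}"
  using Syl_Int_nrm[OF assms] subset_nrm[of R] SylD(1) assms subgroup.one_closed by blast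

text \<open>
  A Sylow \<open>p\<close>-subgroup permutes the nonidentity elements outside all Sylow \<open>p\<close>-subgroups transitively, so
  these all have the same prime order.
\<close>
lemma normal_Syl_if_trivial_two_stab:
  assumes "order G = p * (p + 1)"
  shows "\<exists>q\<in>\<pi>. nSyl q = 1"
proof -
  obtain P where P: "P \<in> Syl p G" using Syl_ne prime_p by blast
  obtain R where R: "R \<in> Syl p G" "R \<noteq> P" using ex_other P by blast
  have sP: "subgroup P G" using SylD P by blast
  have p1: "p > 1" using prime_gt_1_nat prime_p .
  have "card (two_stab P R) = 1" using card_two_stab(2)[OF P R] assms p1 by simp
  then have "card (nrm G P) = card P" using card_two_stab(1)[OF P R] card_Syl_eq[OF P] by simp
  then have nP: "nrm G P = P"
    using card_subset_eq[of "nrm G P" P] subset_nrm[OF sP] finite_sub nrm_subgroup Syl_carrier[OF P] by metis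
  \<comment> \<open>The \<open>p + 1\<close> Sylow subgroups of order \<open>p\<close> meet
    trivially and cover \<open>p ^ 2\<close> elements, which leaves exactly
    \<open>p\<close>.\<close>
  define T where "T = carrier G - \<Union>(Syl p G)"
  have cT: "card T = p"
  proof -
    define U where "U = (\<Union>S\<in>Syl p G. S - {\<one>})"
    have 1: "\<Union>(Syl p G) = insert \<one> U"
      using P subgroup.one_closed[OF sP] unfolding U_def by blast
    have finU: "finite U" using finite_Syl finite_sub SylD unfolding U_def by blast
    have cS: "card (S - {\<one>}) = p - 1" if S: "S \<in> Syl p G" for S
      using card_Syl_eq[OF S] subgroup.one_closed[OF SylD(1)[OF S]] by (simp add: card_Diff_singleton)
    have "card U = (\<Sum>S\<in>Syl p G. card (S - {\<one>}))" unfolding U_def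
    proof (rule card_UN_disjoint[OF finite_Syl])
      show "\<forall>S\<in>Syl p G. finite (S - {\<one>})" using finite_sub SylD by blast
      show "\<forall>S\<in>Syl p G. \<forall>S'\<in>Syl p G. S \<noteq> S' \<longrightarrow> (S - {\<one>}) \<inter> (S' - {\<one>}) = {}" using Syl_Int by blast
    qed
    then have "card U = (p + 1) * (p - 1)" using cS nSyl_p by simp
    moreover have "\<one> \<notin> U" by (simp add: U_def)
    ultimately have 2: "card (insert \<one> U) = 1 + (p + 1) * (p - 1)" using finU by simp
    have "insert \<one> U \<subseteq> carrier G" unfolding 1[symmetric] using Syl_carrier by blast
    then have "card T = card (carrier G) - card (insert \<one> U)"
      unfolding T_def 1 using finU by (intro card_Diff_subset) auto
    then have "card T = p * (p + 1) - (1 + (p + 1) * (p - 1))"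
      unfolding 2 using assms by (simp only: order_def)
    moreover have "p * (p + 1) = 1 + (p + 1) * (p - 1) + p" using p1 by (cases p) (auto simp: algebra_simps)
    ultimately show ?thesis by simp
  qed
  have conjT: "g \<otimes> x \<otimes> inv g \<in> T" if g: "g \<in> carrier G" and x: "x \<in> T" for g x
  proof -
    have xG: "x \<in> carrier G" using x by (auto simp: T_def)
    have "g \<otimes> x \<otimes> inv g \<notin> S" if S: "S \<in> Syl p G" for S
    proof
      assume "g \<otimes> x \<otimes> inv g \<in> S"
      then have "inv g \<otimes> (g \<otimes> x \<otimes> inv g) \<otimes> inv (inv g) \<in> cnj G (inv g) S" by (auto simp only: cnj_def)
      moreover have "inv g \<otimes> (g \<otimes> x \<otimes> inv g) \<otimes> inv (inv g) = x" using conj_mult[of "inv g" g x] g xG by simp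
      ultimately show False using x cnj_Syl[of "inv g" S p] g S by (auto simp: T_def)
    qed
    then show ?thesis using g xG by (auto simp: T_def)
  qed
  interpret GP: group "G\<lparr>carrier := P\<rparr>" using sP subgroup_imp_group by blast
  interpret A: grp_act "G\<lparr>carrier := P\<rparr>" T "\<lambda>g x. g \<otimes> x \<otimes> inv g"
    by unfold_locales
      (use conjT subgroup.subset[OF sP] in \<open>auto simp: conj_mult subset_iff T_def\<close>)
  \<comment> \<open>If a nonidentity \<open>u\<close> in \<open>P\<close> commuted with
    \<open>x\<close>, then \<open>x\<close> would normalize \<open>P\<close>, which is its own
    normalizer; but \<open>x\<close> lies outside \<open>P\<close>. So the orbit has length
    \<open>p\<close> and fills \<open>T\<close>.\<close>
  have orb: "A.orb x = T" if x: "x \<in> T" for x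
  proof -
    have xG: "x \<in> carrier G" "x \<notin> P" using x P by (auto simp: T_def)
    have "u = \<one>" if u: "u \<in> A.stab x" for u
    proof (rule ccontr)
      assume "u \<noteq> \<one>"
      have u': "u \<in> P" "u \<otimes> x \<otimes> inv u = x" using u by (auto simp: A.stab_def)
      have uG: "u \<in> carrier G" using u' sP subgroup.mem_carrier by metis
      have "u \<otimes> x = x \<otimes> u" using u'(2) uG xG by (simp add: inv_solve_right')
      then have "x \<otimes> u \<otimes> inv x = u" using uG xG by (metis inv_solve_right' m_closed)
      then have "u \<in> cnj G x P" using u'(1) by (auto simp: cnj_def intro!: image_eqI[of _ _ u])
      then have "cnj G x P = P" using Syl_Int[OF P cnj_Syl[OF xG(1) P]] u'(1) \<open>u \<noteq> \<one>\<close> by blast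
      then show False using nP xG by (auto simp: nrm_def)
    qed
    moreover have "\<one> \<in> A.stab x" using subgroup.one_closed[OF A.stab_subgroup[OF x]] by simp
    ultimately have "A.stab x = {\<one>}" by blast
    then have "card (A.orb x) = p"
      using A.orbit_stabilizer[OF x] finite_sub[OF sP] card_Syl_eq[OF P] by (simp add: order_def)
    then show ?thesis using card_subset_eq[OF _ A.orb_subset[OF x]] cT fin by (simp add: T_def)
  qed
  have notSyl: "y \<in> T" if y: "y \<in> carrier G" "y [^] (m::nat) = \<one>" "y \<noteq> \<one>" "coprime m p" for y m
  proof -
    have "y \<notin> S" if S: "S \<in> Syl p G" for S
      using pow_card_sub[OF SylD(1)[OF S], of y] card_Syl_eq[OF S] order_dvd_if_pow[of y m p] y by auto
    then show ?thesis using y by (auto simp: T_def)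
  qed
  have ex: "\<exists>y\<in>T. y [^] q = \<one>" if q: "prime q" "q dvd p + 1" for q
  proof -
    obtain m where "order G = q ^ 1 * m" using q assms by (metis dvdE dvd_mult power_one_right)
    then obtain Q where Q: "subgroup Q G" "card Q = q" using sylow_thm[OF q(1) is_group _ fin, of 1] by auto
    then have "Q \<noteq> {\<one>}" using q(1) by auto
    then obtain y where y: "y \<in> Q" "y \<noteq> \<one>" using subgroup.one_closed[OF Q(1)] by blast
    have "coprime q p"
    proof -
      have "\<not> q dvd p" using q by (metis dvd_add_right_iff nat_dvd_1_iff_1 not_prime_1)
      then show ?thesis using q(1) prime_imp_coprime by blast
    qed
    then show ?thesis using notSyl[of y q] y pow_card_sub[OF Q(1) y(1)] Q subgroup.mem_carrier[OF Q(1)]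
      by auto
  qed
  have "p + 1 \<noteq> 1" using p1 by simp
  then obtain q where q: "prime q" "q dvd p + 1" using prime_factor_nat by blast
  have powT: "z [^] q = \<one>" if z: "z \<in> T" for z
  proof -
    obtain y where y: "y \<in> T" "y [^] q = \<one>" using ex q by blast
    obtain g where g: "g \<in> P" "z = g \<otimes> y \<otimes> inv g" using orb[OF y(1)] z by (auto simp: A.orb_def)
    have gG: "g \<in> carrier G" using g sP subgroup.mem_carrier by metis
    interpret c: group_hom G G "\<lambda>x. g \<otimes> x \<otimes> inv g" using conj_hom[OF gG] .
    have "y \<in> carrier G" using y by (auto simp: T_def)
    then show ?thesis using c.hom_nat_pow[of y q] y(2) g(2) gG by simp
  qed
  \<comment> \<open>Every prime divisor of \<open>p + 1\<close> is the order of some element of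
    \<open>T\<close>, yet all elements of \<open>T\<close> have \<open>q\<close>-th power
    \<open>\<one>\<close>; thus \<open>p + 1\<close> is a power of \<open>q\<close>.\<close>
  have only: "q' = q" if q': "prime q'" "q' dvd p + 1" for q'
  proof (rule ccontr)
    assume "q' \<noteq> q"
    obtain y where y: "y \<in> T" "y [^] q' = \<one>" using ex q' by blast
    have "y \<in> carrier G" "y \<noteq> \<one>" using y P subgroup.one_closed[OF sP] by (auto simp: T_def)
    then show False using order_dvd_if_pow[of y q q'] powT[OF y(1)] y(2) primes_coprime[OF q(1) q'(1)] \<open>q' \<noteq> q\<close> by simp
  qed
  have qp: "q \<noteq> p" using q by (metis dvd_add_right_iff dvd_refl nat_dvd_1_iff_1 not_prime_1)
  have "p + 1 = q ^ multiplicity q (p + 1)"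
  proof -
    have "prime_factors (p + 1) = {r. prime r \<and> r dvd p + 1}" by (rule prime_factors_dvd) simp
    also have "\<dots> = {q}" using only q by blast
    finally have "prime_factors (p + 1) = {q}" .
    moreover have "(\<Prod>r\<in>prime_factors (p + 1). r ^ multiplicity r (p + 1)) = p + 1"
      by (rule prime_factorization_nat[symmetric]) simp
    ultimately show ?thesis by simp
  qed
  moreover have "multiplicity q (order G) = multiplicity q (p + 1)"
    unfolding assms using q(1) prime_p qp p1
    by (subst prime_elem_multiplicity_mult_distrib) (auto simp: prime_multiplicity_other)
  ultimately have cQ: "card Q = p + 1" if "Q \<in> Syl q G" for Q using SylD(2)[OF that] by simp
  \<comment> \<open>A Sylow \<open>q\<close>-subgroup has order \<open>p + 1\<close>, and its
    nonidentity elements all lie in \<open>T\<close>, which has \<open>p\<close> elements; hence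
    there is only one.\<close>
  have "Q = insert \<one> T" if Q: "Q \<in> Syl q G" for Q
  proof (rule card_subset_eq)
    show "finite (insert \<one> T)" using fin by (simp add: T_def)
    have "\<one> \<notin> T" using P subgroup.one_closed[OF sP] by (auto simp: T_def)
    then show "card Q = card (insert \<one> T)" using cQ[OF Q] cT fin by (simp add: T_def)
    have "y \<in> T" if "y \<in> Q" "y \<noteq> \<one>" for y
      using notSyl[of y "p + 1"] that pow_card_sub[OF SylD(1)[OF Q], of y] cQ[OF Q] subgroup.mem_carrier[OF SylD(1)[OF Q]]
      by simp
    then show "Q \<subseteq> insert \<one> T" by blast
  qed
  then have "Syl q G = {insert \<one> T}" using Syl_ne[OF q(1)] by blast
  then have "nSyl q = 1" by (simp add: nSyl_def)
  moreover have "q \<in> \<pi>"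
    unfolding assms using q p1 by (auto simp: prime_factors_dvd simp del: mult_Suc_right add_Suc_right)
  ultimately show ?thesis by blast
qed

end

section \<open>A counterexample of least order\<close>

text \<open>Primes other than 2 and 3 are at least 5. Measured against a factor 2 per prime, only
  these are charged, with 5/2 each, which limits their number once a product of primes is small
  compared with a power of 2.\<close>

lemma prod_primes_ge:
  fixes L :: "nat set"
  assumes "finite L" "\<And>r. r \<in> L \<Longrightarrow> prime r"
  shows "(5 / 2) ^ card (L - {2, 3}) * 2 ^ card L \<le> real (\<Prod>L)"
proof -
  have "(\<Prod>r\<in>L. if r \<in> {2, 3} then 2 else 5) \<le> (\<Prod>r\<in>L. real r)"
  proof (rule prod_mono)
    fix r assume r: "r \<in> L"
    then have p: "prime r" using assms by blast
    have "r \<noteq> 4" using p by (auto simp: prime_nat_iff dest: spec[of _ 2])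
    then have "r = 2 \<or> r = 3 \<or> r \<ge> 5" using prime_ge_2_nat[OF p] by linarith
    then show "0 \<le> (if r \<in> {2, 3} then 2 else 5 :: real) \<and> (if r \<in> {2, 3} then 2 else 5) \<le> real r" by auto
  qed
  moreover have "(\<Prod>r\<in>L. if r \<in> {2, 3} then 2 else 5 :: real) = 5 ^ card (L - {2, 3}) * 2 ^ card (L \<inter> {2, 3})"
    using assms(1) by (simp add: prod.If_cases Int_def Diff_eq Compl_eq mult.commute)
  moreover have "card L = card (L - {2, 3}) + card (L \<inter> {2, 3})"
    using card_Int_Diff[OF assms(1), of "{2, 3}"] by simp
  then have "(5 / 2) ^ card (L - {2, 3}) * 2 ^ card L = (5 :: real) ^ card (L - {2, 3}) * 2 ^ card (L \<inter> {2, 3})"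
    by (simp add: power_add power_divide)
  ultimately show ?thesis by simp
qed

lemma prod_primes_dvd:
  fixes n :: nat
  assumes "finite L" "\<And>r. r \<in> L \<Longrightarrow> prime r \<and> r dvd n"
  shows "\<Prod>L dvd n"
  using assms
proof (induction L)
  case (insert x F)
  have "coprime x (\<Prod>F)"
  proof (rule prod_coprime_right)
    fix r assume "r \<in> F"
    then show "coprime x r" using insert(2,4) primes_coprime[of x r] by auto
  qed
  then show ?case using insert by (simp add: divides_mult)
qed simp

text \<open>The bound on the ratio is cleared of denominators. Minimality is stated for groups on
  \<open>nat\<close> and carried to quotients along isomorphisms.\<close>

locale minimal_counterexample = fin_group G for G :: "nat monoid" (structure) +
  assumes not_solvable: "\<not> solvable G"
    and few_subgroups: "8 * num_subgroups G < 59 * 2 ^ card (prime_factors (order G))"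
    and smaller: "\<And>H :: nat monoid. fin_group H \<Longrightarrow> order H < order G \<Longrightarrow> \<not> solvable H \<Longrightarrow>
      59 * 2 ^ card (prime_factors (order H)) \<le> 8 * num_subgroups H"
begin

lemma smaller_any:
  assumes "fin_group Y" "order Y < order G" "\<not> solvable Y"
  shows "59 * 2 ^ card (prime_factors (order Y)) \<le> 8 * num_subgroups Y"
proof -
  obtain H :: "nat monoid" and h where H: "fin_group H" "h \<in> iso Y H" using ex_nat_iso assms(1) by blast
  have g: "group Y" "group H" using H(1) assms(1) by (auto simp: fin_group_def)
  have "\<not> solvable H" using iso_solvable[OF g H(2)] assms(3) by blast
  then show ?thesis using smaller[OF H(1)] iso_order[OF H(2)] iso_num_subgroups[OF g H(2)] assms(2) by simp
qed

text \<open>If \<open>p\<close> still divides the order of the quotient, the number of primes is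
  unchanged; otherwise it drops by one, and complements double the number of subgroups.\<close>

lemma no_solvable_normal:
  assumes "K \<lhd> G" "solvable (G\<lparr>carrier := K\<rparr>)" shows "K = {\<one>}"
proof (rule ccontr)
  assume "K \<noteq> {\<one>}"
  then obtain p k N where N: "prime p" "N \<lhd> G" "N \<noteq> {\<one>}" "card N = p ^ k"
    and comm: "\<And>x y. x \<in> N \<Longrightarrow> y \<in> N \<Longrightarrow> x \<otimes> y = y \<otimes> x"
    using solvable_normal_abelian_p[OF assms(1) _ assms(2)] by metis
  interpret Q: fin_group "G Mod N" using fin_group_Mod N by blast
  have sN: "subgroup N G" using N normal_imp_subgroup by blast
  have k: "k > 0" using card_subgroup_gt_one[OF sN N(3)] N(4) by (cases k) auto
  have o: "order (G Mod N) * p ^ k = order G" using order_Mod[OF N(2)] N(4) by simp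
  then have pf: "\<pi> = insert p (prime_factors (order (G Mod N)))"
    using prime_factors_mult_primepow[OF N(1) Q.order_pos k] by simp
  have lt: "order (G Mod N) < order G" using order_Mod_less[OF N(2,3)] .
  have "\<not> solvable (G Mod N)"
    using solvable_ext[OF N(2) solvable_comm[OF sN comm]] not_solvable by blast
  then have 1: "59 * 2 ^ card (prime_factors (order (G Mod N))) \<le> 8 * num_subgroups (G Mod N)"
    using smaller_any[OF Q.fin_group_axioms lt] by blast
  show False
  proof (cases "p \<in> prime_factors (order (G Mod N))")
    case True
    then have "\<pi> = prime_factors (order (G Mod N))" using pf by auto
    then show False using 1 num_subgroups_Mod_le[OF N(2)] few_subgroups by simp
  next
    case False
    then have "\<not> p dvd order (G Mod N)" using N(1) Q.order_pos by (simp add: prime_factors_dvd)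
    then have "coprime (card N) (order (G Mod N))" using N(1,4) by (simp add: prime_imp_coprime)
    then have "2 * num_subgroups (G Mod N) \<le> num_subgroups G"
      using num_subgroups_complement[OF N(2) comm _ N(3)] by blast
    moreover have "card (\<pi>) = Suc (card (prime_factors (order (G Mod N))))"
      using pf False by simp
    ultimately show False using 1 few_subgroups by simp
  qed
qed

lemma p_sub_solvable: "prime p \<Longrightarrow> subgroup P G \<Longrightarrow> card P = p ^ k \<Longrightarrow> solvable (G\<lparr>carrier := P\<rparr>)"
  using p_group_solvable[OF fin_subgroup, of P p k] by (simp add: order_def)

lemma Syl_not_normal:
  assumes "q \<in> \<pi>" "Q \<in> Syl q G" shows "\<not> Q \<lhd> G"
proof
  assume n: "Q \<lhd> G"
  have q: "prime q" using assms by auto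
  have "Q = {\<one>}" using no_solvable_normal[OF n p_sub_solvable[OF q]] SylD[OF assms(2)] by blast
  then have "q ^ multiplicity q (order G) = 1" using SylD(2)[OF assms(2)] by simp
  then show False using assms(1) q prime_multiplicity_gt_zero_iff[of q "order G"] order_pos
    by (auto simp: prime_factors_dvd)
qed

lemma nSyl_ne_one: assumes "q \<in> \<pi>" shows "nSyl q \<noteq> 1"
proof
  assume 1: "nSyl q = 1"
  have q: "prime q" using assms by auto
  obtain Q where Q: "Q \<in> Syl q G" using Syl_ne q by blast
  have "card (nrm G Q) = card (carrier G)" using card_nrm_Syl[OF q Q] 1 by (simp add: order_def)
  then have "nrm G Q = carrier G" using card_subset_eq[OF fin] by (simp add: nrm_def)
  then show False using Syl_not_normal[OF assms Q] normal_iff_nrm SylD Q by blast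
qed

lemma nSyl_gt: assumes "q \<in> \<pi>" shows "nSyl q \<ge> q + 1" "nSyl q mod q = 1"
proof -
  have q: "prime q" using assms by auto
  show m: "nSyl q mod q = 1" using card_Syl_mod[OF q] by (simp add: nSyl_def)
  then have "nSyl q = q * (nSyl q div q) + 1" by (metis mult_div_mod_eq)
  moreover have "nSyl q div q \<noteq> 0" using calculation nSyl_ne_one[OF assms] by (metis add_0 mult_0_right)
  then have "q * 1 \<le> q * (nSyl q div q)" by (intro mult_le_mono) auto
  ultimately show "nSyl q \<ge> q + 1" by linarith
qed

text \<open>Each lost prime is a doubling missing from the count for \<open>q\<close>; in exchange
  it divides \<open>nSyl q\<close>, in fact with its full power in the order of
  \<open>G\<close>.\<close>

definition lost where "lost q = \<pi> - {q} - nrmprimes q"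

lemma lost_dvd: assumes "q \<in> \<pi>" "r \<in> lost q" shows "prime r" "r dvd nSyl q" "\<not> r dvd order G div nSyl q"
proof -
  have q: "prime q" using assms by auto
  show r: "prime r" using assms(2) by (auto simp: lost_def)
  have pos: "order G div nSyl q > 0" using nSyl_mult[OF q] order_pos by (metis gr0I mult_0_right less_irrefl)
  show n: "\<not> r dvd order G div nSyl q"
    using assms(2) r pos by (auto simp: lost_def nrmprimes_def prime_factors_dvd)
  have "r dvd nSyl q * (order G div nSyl q)" using assms(2) nSyl_mult[OF q] by (auto simp: lost_def)
  then show "r dvd nSyl q" using n prime_dvd_mult_iff[OF r] by blast
qed

lemma nrmprimes_subset: assumes "q \<in> \<pi>" shows "nrmprimes q \<subseteq> \<pi> - {q}"
proof -
  have q: "prime q" using assms by auto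
  have "order G div nSyl q dvd order G" using nSyl_mult[OF q] by (metis dvd_triv_right)
  then show ?thesis using dvd_prime_factors[of "order G" "order G div nSyl q"] order_pos
    by (auto simp: nrmprimes_def)
qed

lemma card_nrmprimes: assumes "q \<in> \<pi>"
  shows "card (\<pi>) = 1 + card (nrmprimes q) + card (lost q)"
proof -
  have "\<pi> = insert q (nrmprimes q \<union> lost q)"
    using nrmprimes_subset[OF assms] assms by (auto simp: lost_def)
  moreover have "q \<notin> nrmprimes q \<union> lost q" by (auto simp: nrmprimes_def lost_def)
  moreover have "nrmprimes q \<inter> lost q = {}" by (auto simp: lost_def)
  moreover have "finite (lost q)" by (simp add: lost_def)
  ultimately show ?thesis using finite_nrmprimes by (simp add: card_Un_disjoint)
qed

text \<open>The quotient of the normalizer by the Sylow subgroup is smaller and not solvable, so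
  minimality bounds its number of subgroups from below. Conjugation extends this to every
  \<open>R\<close>, and the lifted families are disjoint because each lifted subgroup contains only
  one Sylow \<open>q\<close>-subgroup of \<open>G\<close>.\<close>

lemma nonsolvable_nrm_weight:
  assumes q: "q \<in> \<pi>" and Q: "Q \<in> Syl q G"
    and ns: "\<not> solvable (G\<lparr>carrier := nrm G Q\<rparr>)"
  shows "59 * (nSyl q * 2 ^ card (nrmprimes q)) \<le> 8 * num_subgroups G"
proof -
  have pq: "prime q" using q by auto
  have c: "59 * 2 ^ card (nrmprimes q) \<le> 8 * num_subgroups (G\<lparr>carrier := nrm G R\<rparr> Mod R)"
    and lsub: "\<And>A. subgroup A (G\<lparr>carrier := nrm G R\<rparr> Mod R) \<Longrightarrow>
      subgroup (fin_group.lift (G\<lparr>carrier := nrm G R\<rparr>) R A) G \<and> R \<subseteq> fin_group.lift (G\<lparr>carrier := nrm G R\<rparr>) R A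
      \<and> fin_group.lift (G\<lparr>carrier := nrm G R\<rparr>) R A \<subseteq> nrm G R"
    and linj: "inj_on (fin_group.lift (G\<lparr>carrier := nrm G R\<rparr>) R) {A. subgroup A (G\<lparr>carrier := nrm G R\<rparr> Mod R)}"
    if R: "R \<in> Syl q G" for R
  proof -
    let ?N = "G\<lparr>carrier := nrm G R\<rparr>"
    have sR: "subgroup R G" "card R = q ^ multiplicity q (order G)" using SylD R by auto
    have sN: "subgroup (nrm G R) G" using nrm_subgroup Syl_carrier R by blast
    interpret N: fin_group ?N using fin_subgroup sN by blast
    have n: "R \<lhd> ?N" using nrm_normal sR(1) .
    interpret M: fin_group "?N Mod R" using N.fin_group_Mod n by blast
    show "subgroup (N.lift R A) G \<and> R \<subseteq> N.lift R A \<and> N.lift R A \<subseteq> nrm G R" if A: "subgroup A (?N Mod R)" for A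
      using incl_subgroup[OF sN N.lift_subgroup[OF n A]] N.subset_lift[OF n A]
        subgroup.subset[OF N.lift_subgroup[OF n A]] by simp
    show "inj_on (N.lift R) {A. subgroup A (?N Mod R)}" by (rule inj_onI) (use N.lift_inj in blast)
    obtain g where g: "g \<in> carrier G" "R = cnj G g Q" using Syl_conj[OF pq Q R] by blast
    have "\<not> solvable ?N"
    proof
      assume "solvable ?N"
      have sNQ: "subgroup (nrm G Q) G" using nrm_subgroup Syl_carrier Q by blast
      have cc: "cnj G g (nrm G Q) \<subseteq> nrm G R"
      proof
        fix y assume "y \<in> cnj G g (nrm G Q)"
        then obtain x where x: "x \<in> nrm G Q" "y = g \<otimes> x \<otimes> inv g" by (auto simp: cnj_def)
        have xG: "x \<in> carrier G" "cnj G x Q = Q" using x by (auto simp: nrm_def)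
        have "cnj G y R = cnj G g (cnj G x (cnj G (inv g) (cnj G g Q)))"
          using x g xG Syl_carrier[OF Q] cnj_carrier by (simp add: cnj_mult)
        also have "\<dots> = R" using cnj_inv_cnj[OF g(1) Syl_carrier[OF Q]] xG g by simp
        finally show "y \<in> nrm G R" using x xG g by (simp add: nrm_def)
      qed
      interpret i: group_hom "G\<lparr>carrier := nrm G Q\<rparr>" ?N "\<lambda>x. g \<otimes> x \<otimes> inv g"
        unfolding group_hom_def group_hom_axioms_def
        using subgroup_imp_group[OF sNQ] subgroup_imp_group[OF sN] cc g(1) subgroup.subset[OF sNQ]
        by (auto simp: hom_def cnj_def conj_mult m_assoc inv_solve_left subset_iff)
      have "inj_on (\<lambda>x. g \<otimes> x \<otimes> inv g) (nrm G Q)"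
        using conj_inj[OF g(1)] subgroup.subset[OF sNQ] inj_on_subset by blast
      then have "solvable (G\<lparr>carrier := nrm G Q\<rparr>)" using i.inj_hom_imp_solvable \<open>solvable ?N\<close> by simp
      then show False using ns by simp
    qed
    moreover have "solvable (?N\<lparr>carrier := R\<rparr>)" using p_sub_solvable[OF pq sR] by simp
    ultimately have nsM: "\<not> solvable (?N Mod R)" using N.solvable_ext[OF n] by blast
    have o: "order (?N Mod R) * card R = card (nrm G R)"
      using N.order_Mod[OF n] by (simp add: order_def)
    have m: "multiplicity q (order G) > 0" using q order_pos
      by (simp add: prime_multiplicity_gt_zero_iff prime_factors_dvd)
    have "1 < card R" unfolding sR(2) using one_less_power[OF prime_gt_1_nat[OF pq] m] .
    then have "order (?N Mod R) * 1 < order (?N Mod R) * card R" using M.order_pos by (rule mult_less_mono2)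
    then have "order (?N Mod R) < card (nrm G R)" using o by simp
    also have "\<dots> \<le> order G" using card_mono[OF fin, of "nrm G R"] by (simp add: order_def nrm_def)
    finally have lt: "order (?N Mod R) < order G" .
    have "\<not> q dvd card (nrm G R) div card R" using not_dvd_index_Syl(2)[OF pq R subset_nrm[OF sR(1)] sN] .
    moreover have "card (nrm G R) div card R = order (?N Mod R)" using o \<open>1 < card R\<close>
      by (metis div_mult_self_is_m not_one_less_zero gr_zeroI)
    ultimately have "q \<notin> prime_factors (order (?N Mod R))" by auto
    moreover have "prime_factors (card (nrm G R)) = insert q (prime_factors (order (?N Mod R)))"
      using prime_factors_mult_primepow[OF pq M.order_pos m] o sR(2) by simp
    ultimately have "prime_factors (order (?N Mod R)) = nrmprimes q"
      using card_nrm_Syl[OF pq R] by (auto simp: nrmprimes_def)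
    then show "59 * 2 ^ card (nrmprimes q) \<le> 8 * num_subgroups (?N Mod R)"
      using smaller_any[OF M.fin_group_axioms lt nsM] by simp
  qed
  let ?l = "\<lambda>R. fin_group.lift (G\<lparr>carrier := nrm G R\<rparr>) R"
  let ?S = "\<lambda>R. {A. subgroup A (G\<lparr>carrier := nrm G R\<rparr> Mod R)}"
  have fS: "finite (?l R ` ?S R)" if "R \<in> Syl q G" for R
    by (rule finite_subset[OF _ finite_subs]) (use lsub[OF that] in blast)
  have "(\<Sum>R\<in>Syl q G. 8 * card (?l R ` ?S R)) = 8 * card (\<Union>R\<in>Syl q G. ?l R ` ?S R)"
  proof -
    have "card (\<Union>R\<in>Syl q G. ?l R ` ?S R) = (\<Sum>R\<in>Syl q G. card (?l R ` ?S R))"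
    proof (rule card_UN_disjoint[OF finite_Syl])
      show "\<forall>R\<in>Syl q G. finite (?l R ` ?S R)" using fS by blast
      show "\<forall>R\<in>Syl q G. \<forall>R'\<in>Syl q G. R \<noteq> R' \<longrightarrow> ?l R ` ?S R \<inter> ?l R' ` ?S R' = {}"
      proof (intro ballI impI)
        fix R R' assume R: "R \<in> Syl q G" "R' \<in> Syl q G" "R \<noteq> R'"
        show "?l R ` ?S R \<inter> ?l R' ` ?S R' = {}"
        proof (rule ccontr)
          assume "?l R ` ?S R \<inter> ?l R' ` ?S R' \<noteq> {}"
          then obtain A B where "A \<in> ?S R" "B \<in> ?S R'" "?l R A = ?l R' B" by blast
          then have "R' \<subseteq> nrm G R" using lsub[OF R(1), of A] lsub[OF R(2), of B] by auto
          then show False using Syl_eq_if_nrm[OF pq R(1,2)] R(3) by blast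
        qed
      qed
    qed
    then show ?thesis by (simp add: sum_distrib_left)
  qed
  also have "\<dots> \<le> 8 * num_subgroups G"
    unfolding num_subgroups_def using lsub by (intro mult_le_mono card_mono finite_subs) auto
  finally have 1: "(\<Sum>R\<in>Syl q G. 8 * card (?l R ` ?S R)) \<le> 8 * num_subgroups G" .
  have "(\<Sum>R\<in>Syl q G. 59 * 2 ^ card (nrmprimes q)) \<le> (\<Sum>R\<in>Syl q G. 8 * card (?l R ` ?S R))"
  proof (rule sum_mono)
    fix R assume R: "R \<in> Syl q G"
    show "59 * 2 ^ card (nrmprimes q) \<le> 8 * card (?l R ` ?S R)"
      using c[OF R] card_image[OF linj[OF R]] by (simp add: num_subgroups_def)
  qed
  then show ?thesis using 1 by (simp add: nSyl_def mult.commute mult.left_commute)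
qed

section \<open>The kernel of the action on Sylow subgroups and solvability of their
  normalizers\<close>

definition kernel_Syl where "kernel_Syl q = {g \<in> carrier G. \<forall>R\<in>Syl q G. cnj G g R = R}"

lemma kernel_Syl_normal: assumes "prime q" shows "kernel_Syl q \<lhd> G"
proof -
  obtain Q where Q: "Q \<in> Syl q G" using Syl_ne assms by blast
  have eq: "kernel_Syl q = (\<Inter>R\<in>Syl q G. nrm G R)" using Q by (auto simp: kernel_Syl_def nrm_def)
  have s: "subgroup (kernel_Syl q) G" unfolding eq
    using Q nrm_subgroup Syl_carrier by (intro subgroups_Inter) auto
  have "cnj G g (kernel_Syl q) \<subseteq> kernel_Syl q" if g: "g \<in> carrier G" for g
  proof
    fix y assume "y \<in> cnj G g (kernel_Syl q)"
    then obtain x where x: "x \<in> kernel_Syl q" "y = g \<otimes> x \<otimes> inv g" by (auto simp: cnj_def)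
    have xG: "x \<in> carrier G" using x by (simp add: kernel_Syl_def)
    have "cnj G y R = R" if R: "R \<in> Syl q G" for R
    proof -
      have "cnj G (inv g) R \<in> Syl q G" using cnj_Syl R g by simp
      then have "cnj G x (cnj G (inv g) R) = cnj G (inv g) R" using x by (simp add: kernel_Syl_def)
      then have "cnj G g (cnj G x (cnj G (inv g) R)) = R" using cnj_cnj_inv[OF g Syl_carrier[OF R]] by simp
      then show ?thesis using x g xG Syl_carrier[OF R] cnj_carrier by (simp add: cnj_mult)
    qed
    then show "y \<in> kernel_Syl q" using x g xG by (simp add: kernel_Syl_def)
  qed
  then show ?thesis using s normal_iff_cnj by blast
qed

text \<open>
  The centralizer of the kernel of the action on the Sylow \<open>q\<close>-subgroups contains all of them and acts faithfully,
  so that the results on groups with \<open>q + 1\<close> Sylow subgroups apply to it.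
\<close>
lemma nSyl_succ_centralizer:
  assumes q: "q \<in> \<pi>" and n: "nSyl q = q + 1"
    and c1: "\<And>d. d dvd q - 1 \<Longrightarrow> d dvd order G div nSyl q \<Longrightarrow> d = 1"
  shows False
proof -
  have pq: "prime q" using q by auto
  define K where "K = kernel_Syl q"
  define M where "M = centralizer K"
  have KN: "K \<lhd> G" using kernel_Syl_normal[OF pq] by (simp add: K_def)
  have sK: "subgroup K G" using KN normal_imp_subgroup by blast
  have KG: "k \<in> carrier G" if "k \<in> K" for k using that sK subgroup.mem_carrier by metis
  have MN: "M \<lhd> G" using centralizer_normal KN by (simp add: M_def)
  have sM: "subgroup M G" using MN normal_imp_subgroup by blast
  have KnR: "K \<subseteq> nrm G R" if "R \<in> Syl q G" for R using that by (auto simp: K_def kernel_Syl_def nrm_def)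
  have KM: "K \<inter> M = {\<one>}"
  proof (rule no_solvable_normal)
    show "K \<inter> M \<lhd> G" using normal_subgroup_intersect KN MN by blast
    have "x \<otimes> y = y \<otimes> x" if "x \<in> K \<inter> M" "y \<in> K \<inter> M" for x y
      using that unfolding M_def centralizer_def by blast
    then show "solvable (G\<lparr>carrier := K \<inter> M\<rparr>)"
      using solvable_comm[OF subgroups_Inter_pair[OF sK sM]] by blast
  qed
  \<comment> \<open>\<open>K\<close> normalizes \<open>Q\<close>, so every conjugate of the
    \<open>q\<close>-group \<open>Q \<inter> K\<close>, being inside \<open>K\<close>, falls into
    \<open>Q\<close> again; the intersection is thus a solvable normal subgroup.\<close>
  have QK: "Q \<inter> K = {\<one>}" if Q: "Q \<in> Syl q G" for Q
  proof (rule no_solvable_normal)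
    have sQ: "subgroup Q G" using SylD Q by blast
    have sQK: "subgroup (Q \<inter> K) G" using sQ sK by (rule subgroups_Inter_pair)
    have "card (Q \<inter> K) dvd card Q"
      using fin_group.card_sub_dvd[OF fin_subgroup[OF sQ], of "Q \<inter> K"] subgroup_incl[OF sQK sQ]
        by (simp add: order_def)
    then obtain j where j: "card (Q \<inter> K) = q ^ j" using SylD(2)[OF Q] pq divides_primepow_nat by metis
    show "solvable (G\<lparr>carrier := Q \<inter> K\<rparr>)" using p_sub_solvable[OF pq sQK j] .
    have "cnj G g (Q \<inter> K) \<subseteq> Q \<inter> K" if g: "g \<in> carrier G" for g
    proof -
      have 1: "cnj G g (Q \<inter> K) \<subseteq> K" using cnj_mono[of "Q \<inter> K" K] normal_cnj_eq[OF KN g] by blast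
      have s: "subgroup (cnj G g (Q \<inter> K)) G" using cnj_subgroup g sQK by blast
      have c: "card (cnj G g (Q \<inter> K)) = q ^ j" using card_cnj[OF g] subgroup.subset[OF sQK] j by simp
      have "cnj G g (Q \<inter> K) \<subseteq> nrm G Q" using 1 KnR[OF Q] by blast
      then have "cnj G g (Q \<inter> K) \<subseteq> Q" using p_subgroup_in_normal_Syl[OF pq Q s c] by blast
      then show ?thesis using 1 by blast
    qed
    then show "Q \<inter> K \<lhd> G" using normal_iff_cnj sQK by blast
  qed
  \<comment> \<open>\<open>K\<close> is normal and normalizes \<open>Q\<close>, so commutators of
    \<open>Q\<close> with \<open>K\<close> lie in the trivial intersection.\<close>
  have QM: "Q \<subseteq> M" if Q: "Q \<in> Syl q G" for Q
  proof
    fix u assume u: "u \<in> Q"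
    have sQ: "subgroup Q G" using SylD Q by blast
    have uG: "u \<in> carrier G" using u sQ subgroup.mem_carrier by metis
    have "u \<otimes> k = k \<otimes> u" if k: "k \<in> K" for k
    proof -
      have kG: "k \<in> carrier G" using KG k .
      have "k \<otimes> inv u \<otimes> inv k \<in> cnj G k Q" using subgroup.m_inv_closed[OF sQ u] by (auto simp: cnj_def)
      then have "k \<otimes> inv u \<otimes> inv k \<in> Q" using KnR[OF Q] k by (auto simp: nrm_def)
      then have "u \<otimes> (k \<otimes> inv u \<otimes> inv k) \<in> Q" using subgroup.m_closed[OF sQ u] by blast
      moreover have "(u \<otimes> k \<otimes> inv u) \<otimes> inv k \<in> K"
        using normal.inv_op_closed2[OF KN uG k] subgroup.m_closed[OF sK] subgroup.m_inv_closed[OF sK k]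
          by blast
      moreover have "(u \<otimes> k \<otimes> inv u) \<otimes> inv k = u \<otimes> (k \<otimes> inv u \<otimes> inv k)" using uG kG by (simp add: m_assoc)
      ultimately have "u \<otimes> k \<otimes> inv u \<otimes> inv k = \<one>" using QK[OF Q] by auto
      then show ?thesis using uG kG by (simp add: inv_solve_right')
    qed
    then show "u \<in> M" using uG by (simp add: M_def centralizer_def)
  qed
  let ?M = "G\<lparr>carrier := M\<rparr>"
  interpret M: fin_group ?M using fin_subgroup sM .
  obtain Q where Q: "Q \<in> Syl q G" using Syl_ne pq by blast
  have sub1: "Syl q ?M \<subseteq> Syl q G"
    using Syl_consistent[OF pq sM] not_dvd_index_Syl(1)[OF pq Q QM[OF Q] sM] by blast
  obtain Q1 where Q1: "Q1 \<in> Syl q ?M" using M.Syl_ne pq by blast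
  have "multiplicity q (order ?M) = multiplicity q (order G)"
    using M.SylD(2)[OF Q1] SylD(2)[of Q1 q] sub1 Q1 prime_gt_1_nat[OF pq] by auto
  then have SylM: "Syl q ?M = Syl q G"
    using sub1 subgroup_incl[OF _ sM QM] by (auto simp: Syl_def)
  interpret D: doubly_transitive_Syl ?M q
  proof unfold_locales
    show "prime q" by fact
    show "card (Syl q ?M) = q + 1" using SylM n by (simp add: nSyl_def)
    fix g assume g: "g \<in> carrier ?M" "\<And>R. R \<in> Syl q ?M \<Longrightarrow> cnj ?M g R = R"
    have "g \<in> K" using g SylM sM subgroup.mem_carrier[OF sM]
      by (auto simp: K_def kernel_Syl_def cnj_consistent)
    then show "g = \<one>\<^bsub>?M\<^esub>" using KM g(1) by auto
  qed
  obtain R where R: "R \<in> Syl q ?M" "R \<noteq> Q1" using D.ex_other Q1 by blast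
  let ?c = "card (D.two_stab Q1 R)"
  have "?c dvd q - 1" using D.card_two_stab_dvd[OF Q1 R] .
  moreover have "?c dvd order G div nSyl q"
  proof -
    have Q1G: "Q1 \<in> Syl q G" using sub1 Q1 by blast
    have sN: "subgroup (nrm G Q1) G" using nrm_subgroup Syl_carrier Q1G by blast
    have "subgroup (nrm ?M Q1) ?M" using M.nrm_subgroup M.Syl_carrier Q1 by blast
    then have s: "subgroup (nrm ?M Q1) G" using incl_subgroup[OF sM] by blast
    have "nrm ?M Q1 \<subseteq> nrm G Q1" using nrm_consistent[OF sM] by blast
    then have "card (nrm ?M Q1) dvd card (nrm G Q1)"
      using fin_group.card_sub_dvd[OF fin_subgroup[OF sN]] subgroup_incl[OF s sN] by (simp add: order_def)
    moreover have "?c dvd card (nrm ?M Q1)" using D.card_two_stab(1)[OF Q1 R] by simp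
    ultimately show ?thesis using card_nrm_Syl[OF pq Q1G] dvd_trans by metis
  qed
  \<comment> \<open>Now \<open>M\<close> has order \<open>q * (q + 1)\<close> and therefore a normal
    Sylow subgroup, which is normal in \<open>G\<close> as well and contradicts the absence of
    solvable normal subgroups.\<close>
  ultimately have "?c = 1" using c1 by blast
  then have "order ?M = q * (q + 1)" using D.card_two_stab(2)[OF Q1 R] by simp
  then obtain r where r: "r \<in> prime_factors (order ?M)" "M.nSyl r = 1"
    using D.normal_Syl_if_trivial_two_stab by blast
  have pr: "prime r" using r by auto
  obtain S where S: "S \<in> Syl r ?M" using M.Syl_ne pr by blast
  have sSM: "subgroup S ?M" using M.SylD S by blast
  have "card (nrm ?M S) = card (carrier ?M)" using M.card_nrm_Syl[OF pr S] r(2) by (simp add: order_def)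
  then have "nrm ?M S = carrier ?M" using card_subset_eq[OF M.fin] by (simp add: nrm_def)
  then have "S \<lhd> ?M" using M.normal_iff_nrm[OF sSM] by blast
  then have SG: "S \<lhd> G" using normal_trans_char[OF MN S pr] by blast
  have "S = {\<one>}"
    using no_solvable_normal[OF SG p_sub_solvable[OF pr _ M.SylD(2)[OF S]]] normal_imp_subgroup[OF SG]
      by blast
  then have "r ^ multiplicity r (order ?M) = 1" using M.SylD(2)[OF S] by simp
  then show False using r(1) pr prime_multiplicity_gt_zero_iff[of r "order ?M"] M.order_pos
    by (auto simp: prime_factors_dvd)
qed

text \<open>Otherwise \<open>nSyl q < 2 * 2 ^ card (lost q)\<close>, although the product of the
  lost primes divides \<open>nSyl q\<close>. Only 2 and 3 can then be lost, and the survivors are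
  \<open>nSyl 2 = 3\<close> and \<open>nSyl 5 = 6\<close>, both of the form
  \<open>q + 1\<close>.\<close>

lemma nrm_solvable:
  assumes q: "q \<in> \<pi>" and Q: "Q \<in> Syl q G"
  shows "solvable (G\<lparr>carrier := nrm G Q\<rparr>)"
proof (rule ccontr)
  assume ns: "\<not> solvable (G\<lparr>carrier := nrm G Q\<rparr>)"
  have pq: "prime q" using q by auto
  have "59 * (nSyl q * 2 ^ card (nrmprimes q)) < 59 * 2 ^ (1 + card (nrmprimes q) + card (lost q))"
    using nonsolvable_nrm_weight[OF q Q ns] few_subgroups card_nrmprimes[OF q] by simp
  then have lt: "nSyl q < 2 * 2 ^ card (lost q)" by (simp add: power_add)
  have finL: "finite (lost q)" by (simp add: lost_def)
  have pL: "\<And>r. r \<in> lost q \<Longrightarrow> prime r \<and> r dvd nSyl q" using lost_dvd[OF q] by blast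
  have n_pos: "nSyl q > 0" using nSyl_gt[OF q] by simp
  have dv: "\<Prod>(lost q) dvd nSyl q" using prod_primes_dvd[OF finL pL] .
  then have "\<Prod>(lost q) \<le> nSyl q" using n_pos dvd_imp_le by blast
  then have "(5 / 2) ^ card (lost q - {2, 3}) * 2 ^ card (lost q) \<le> real (nSyl q)"
    using prod_primes_ge[OF finL] pL by (meson of_nat_mono order_trans)
  also have "real (nSyl q) < real (2 * 2 ^ card (lost q))" using lt by (simp only: of_nat_less_iff)
  \<comment> \<open>A single lost prime beyond 3 would already give 5/2 on the left.\<close>
  finally have "(5 / 2 :: real) ^ card (lost q - {2, 3}) < 2" by simp
  then have "card (lost q - {2, 3}) = 0"
    using self_le_power[of "5 / 2 :: real" "card (lost q - {2, 3})"]
      by (cases "card (lost q - {2, 3}) = 0") auto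
  then have sub: "lost q \<subseteq> {2, 3}" using finL by simp
  have ge: "nSyl q \<ge> q + 1" "q \<ge> 2" using nSyl_gt[OF q] prime_ge_2_nat[OF pq] by auto
  have modq: "q dvd nSyl q - 1" using nSyl_gt(2)[OF q] ge by (metis dvd_minus_mod)
  consider "lost q = {}" | "lost q = {2}" | "lost q = {3}" | "lost q = {2, 3}" using sub by auto
  then show False
  proof cases
    case 1
    then show False using lt ge by simp
  next
    case 2
    then have "nSyl q < 4" "even (nSyl q)" using lt dv by auto
    then have "nSyl q = 2 \<or> nSyl q = 0" by presburger
    then show False using ge by auto
  next
    case 3
    then have "nSyl q < 4" using lt by simp
    then have n3: "nSyl q = 3" using ge by linarith
    then have "q = 2" using ge by linarith
    then show False using nSyl_succ_centralizer[OF q] n3 by simp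
  next
    case 4
    then have "nSyl q < 8" "6 dvd nSyl q" using lt dv by auto
    then have n6: "nSyl q = 6" using ge by (auto elim!: dvdE)
    then have "q dvd 5" "q \<noteq> 1" using modq ge by auto
    moreover have "q \<le> 5" using \<open>q dvd 5\<close> by (rule dvd_imp_le) simp
    then have "q = 2 \<or> q = 3 \<or> q = 4 \<or> q = 5" using ge by linarith
    ultimately have q5: "q = 5" by auto
    \<comment> \<open>A common divisor of 4 and the order of the normalizer is odd because 2 is
      lost, hence equal to 1.\<close>
    have no2: "\<not> 2 dvd order G div nSyl q" using lost_dvd(3)[OF q, of 2] 4 by simp
    have "d = 1" if "d dvd q - 1" "d dvd order G div nSyl q" for d
    proof -
      have "\<not> 2 dvd d" using no2 that(2) dvd_trans by blast
      moreover have "d dvd 2 ^ 2" using that(1) q5 by simp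
      ultimately show ?thesis by (metis divides_primepow_nat two_is_prime_nat dvd_power neq0_conv power_0)
    qed
    then show False using nSyl_succ_centralizer[OF q] n6 q5 by simp
  qed
qed

text \<open>The kernel lies in a Sylow normalizer and is therefore a solvable normal
  subgroup.\<close>

lemma Syl_faithful:
  assumes q: "q \<in> \<pi>" and g: "g \<in> carrier G" "\<And>R. R \<in> Syl q G \<Longrightarrow> cnj G g R = R"
  shows "g = \<one>"
proof -
  have pq: "prime q" using q by auto
  obtain Q where Q: "Q \<in> Syl q G" using Syl_ne pq by blast
  have n: "kernel_Syl q \<lhd> G" using kernel_Syl_normal[OF pq] .
  have s: "subgroup (kernel_Syl q) G" using n normal_imp_subgroup by blast
  have sN: "subgroup (nrm G Q) G" using nrm_subgroup Syl_carrier Q by blast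
  have "kernel_Syl q \<subseteq> nrm G Q" using Q by (auto simp: kernel_Syl_def nrm_def)
  then have "subgroup (kernel_Syl q) (G\<lparr>carrier := nrm G Q\<rparr>)" using subgroup_incl[OF s sN] by blast
  then have "solvable (G\<lparr>carrier := kernel_Syl q\<rparr>)"
    using fin_group.solvable_sub[OF fin_subgroup[OF sN] nrm_solvable[OF q Q]] by simp
  then have "kernel_Syl q = {\<one>}" using no_solvable_normal[OF n] by blast
  moreover have "g \<in> kernel_Syl q" using g by (simp add: kernel_Syl_def)
  ultimately show ?thesis by blast
qed

lemma order_dvd_fact_nSyl:
  assumes q: "q \<in> \<pi>" shows "order G dvd fact (nSyl q)"
proof -
  interpret A: grp_act G "Syl q G" "cnj G"
    using conj_act[OF subgroup_self, of "Syl q G"] by (auto simp: cnj_Syl dest: Syl_carrier)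
  show ?thesis unfolding nSyl_def
    by (rule A.faithful_order_dvd_fact[OF finite_Syl]) (use Syl_faithful[OF q] in blast)
qed

lemma prime_le_nSyl:
  assumes q: "q \<in> \<pi>" and r: "r \<in> \<pi>" shows "r \<le> nSyl q"
  using order_dvd_fact_nSyl[OF q] r prime_dvd_fact_iff[of r "nSyl q"]
  by (auto intro: dvd_trans)

text \<open>The summand 2 stands for the trivial subgroup and the whole group, which are in none of
  the counted families.\<close>

lemma weight_bound:
  assumes "distinct qs" "set qs \<subseteq> \<pi>"
  shows "2 + weight nSyl nrmprimes qs {} \<le> num_subgroups G"
proof -
  let ?S = "{H. subgroup H G \<and> H \<noteq> {\<one>} \<and> H \<noteq> carrier G \<and> prime_factors (card H) \<inter> {} = {} \<and>
      (\<exists>q\<in>set qs. H \<in> normal_Syl_subs q {})}"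
  have "weight nSyl nrmprimes qs {} \<le> card ?S"
    by (rule weight_le[OF assms]) (use assms nSyl_ne_one nrm_solvable in auto)
  moreover have "card ?S + 2 \<le> num_subgroups G"
  proof -
    have fS: "finite ?S" by (rule finite_subset[OF _ finite_subs]) auto
    have ne: "{\<one>} \<noteq> carrier G"
    proof
      assume "{\<one>} = carrier G"
      then have "x \<otimes> y = y \<otimes> x" if "x \<in> carrier G" "y \<in> carrier G" for x y
        using that by (metis singletonD)
      then have "solvable G" using solvable_comm[OF subgroup_self] by simp
      then show False using not_solvable by blast
    qed
    have "card (?S \<union> {{\<one>}, carrier G}) = card ?S + 2"
      using fS ne by (subst card_Un_disjoint) auto
    moreover have "?S \<union> {{\<one>}, carrier G} \<subseteq> {H. subgroup H G}" using triv_subgroup subgroup_self by auto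
    then have "card (?S \<union> {{\<one>}, carrier G}) \<le> num_subgroups G"
      unfolding num_subgroups_def by (rule card_mono[OF finite_subs])
    ultimately show ?thesis by linarith
  qed
  ultimately show ?thesis by simp
qed

end

section \<open>Possible numbers of Sylow subgroups\<close>

text \<open>The primes stop at 13 because 17 * 17 = 289 is beyond the range \<open>n < 236\<close>
  of interest.\<close>

definition small_omega :: "nat \<Rightarrow> nat" where
  "small_omega n = (if 2 dvd n then 1 else 0) + (if 3 dvd n then 1 else 0) + (if 5 dvd n then 1 else 0) +
     (if 7 dvd n then 1 else 0) + (if 11 dvd n then 1 else 0) + (if 13 dvd n then 1 else 0)"

text \<open>
  An upper bound for the number of primes dividing \<open>n\<close> when \<open>n < 236\<close>: a prime divisor beyond 13 is then
  unique, and there is none if \<open>n\<close> divides the constant below.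
\<close>
definition omega_bound :: "nat \<Rightarrow> nat" where
  "omega_bound n = small_omega n +
     (if n dvd 2 ^ 7 * 3 ^ 4 * 5 ^ 3 * 7 ^ 2 * 11 ^ 2 * 13 ^ 2 then 0 else 1)"

lemma small_prime_cases:
  assumes "prime (r :: nat)" "r < 17"
  shows "r \<in> {2, 3, 5, 7, 11, 13}"
proof -
  have "r \<noteq> 4 \<and> r \<noteq> 6 \<and> r \<noteq> 8 \<and> r \<noteq> 9 \<and> r \<noteq> 10 \<and> r \<noteq> 12 \<and> r \<noteq> 14 \<and> r \<noteq> 15 \<and> r \<noteq> 16"
    using assms(1) by auto
  then have "r = 2 \<or> r = 3 \<or> r = 5 \<or> r = 7 \<or> r = 11 \<or> r = 13"
    using assms(2) prime_ge_2_nat[OF assms(1)] by presburger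
  then show ?thesis by blast
qed

lemma card_primes_le_omega_bound:
  assumes L: "\<And>r. r \<in> L \<Longrightarrow> prime r \<and> r dvd n" and n: "0 < n" "n < 236"
  shows "card L \<le> omega_bound n"
proof -
  let ?S = "{r \<in> {2, 3, 5, 7, 11, 13}. r dvd n}" and ?B = "{r \<in> L. 17 \<le> r}"
  have finB: "finite ?B" using L n by (intro finite_subset[of ?B "{..n}"]) (auto dest: dvd_imp_le)
  have "L \<subseteq> ?S \<union> ?B"
  proof
    fix r assume r: "r \<in> L"
    show "r \<in> ?S \<union> ?B"
    proof (cases "r < 17")
      case True
      then show ?thesis using small_prime_cases[of r] L[OF r] by auto
    qed (use r in auto)
  qed
  then have "card L \<le> card (?S \<union> ?B)" using finB by (intro card_mono) auto
  also have "\<dots> \<le> card ?S + card ?B" by (rule card_Un_le)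
  finally have 1: "card L \<le> card ?S + card ?B" .
  have "card ?S = (\<Sum>r\<in>{2, 3, 5, 7, 11, 13}. if r dvd n then 1 else 0)"
    by (simp only: card_eq_sum sum.inter_filter finite.intros)
  then have "card ?S = small_omega n" unfolding small_omega_def by (simp only:) simp
  moreover have "card ?B \<le> 1"
  proof (rule ccontr)
    assume "\<not> card ?B \<le> 1"
    then obtain r t where rt: "r \<in> ?B" "t \<in> ?B" "r \<noteq> t"
      by (metis (no_types, lifting) card_le_Suc0_iff_eq finB One_nat_def)
    then have "r * t dvd n" using L primes_coprime[of r t] by (auto intro: divides_mult)
    then have "r * t \<le> n" using n by (simp add: dvd_imp_le)
    moreover have "17 * 17 \<le> r * t" using rt by (intro mult_le_mono) auto
    ultimately show False using n by simp
  qed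
  \<comment> \<open>The exponents in the constant are the largest ones with prime power below 236,
    so in this range divisibility means that no prime from 17 on occurs.\<close>
  moreover have "card ?B = 0" if d: "n dvd 2 ^ 7 * 3 ^ 4 * 5 ^ 3 * 7 ^ 2 * 11 ^ 2 * 13 ^ 2"
  proof (rule ccontr)
    assume "card ?B \<noteq> 0"
    then have "?B \<noteq> {}" by (metis card.empty)
    then obtain r where r: "prime r" "r dvd n" "17 \<le> r" using L by blast
    then have "r dvd 2 ^ 7 * 3 ^ 4 * 5 ^ 3 * 7 ^ 2 * 11 ^ 2 * 13 ^ 2" using d dvd_trans by blast
    then have "r dvd 2 \<or> r dvd 3 \<or> r dvd 5 \<or> r dvd 7 \<or> r dvd 11 \<or> r dvd 13"
      unfolding prime_dvd_mult_iff[OF r(1)] using prime_dvd_power[OF r(1)] by blast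
    then show False using r(3) by (auto dest: dvd_imp_le)
  qed
  ultimately show ?thesis using 1 unfolding omega_bound_def
    by (cases "n dvd 2 ^ 7 * 3 ^ 4 * 5 ^ 3 * 7 ^ 2 * 11 ^ 2 * 13 ^ 2") simp_all
qed

text \<open>All \<open>(n, \<omega>)\<close> with \<open>3 \<le> n < 236\<close> and \<open>4 n < 59 * 2 ^ \<omega>\<close>, where \<open>\<omega>\<close> counts the primes dividing \<open>n\<close>.\<close>
definition small_index_list :: "(nat \<times> nat) list" where
  "small_index_list = [(3, 1), (4, 1), (5, 1), (6, 2), (7, 1), (8, 1), (9, 1), (10, 2), (11, 1), (12, 2), (13,
    1), (14, 2), (15, 2), (16, 1), (17, 1), (18, 2), (19, 1), (20, 2), (21, 2), (22, 2), (23, 1), (24, 2), (25,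
    1), (26, 2), (27, 1), (28, 2), (29, 1), (30, 3), (33, 2), (34, 2), (35, 2), (36, 2), (38, 2), (39, 2), (40,
    2), (42, 3), (44, 2), (45, 2), (46, 2), (48, 2), (50, 2), (51, 2), (52, 2), (54, 2), (55, 2), (56, 2), (57,
    2), (58, 2), (60, 3), (66, 3), (70, 3), (78, 3), (84, 3), (90, 3), (102, 3), (105, 3), (110, 3), (114, 3),
    (210, 4)]"

text \<open>\<open>omega_bound n\<close> is at most \<open>small_omega n + 1\<close>, so failure of
  the first test already refutes the second inequality and spares the divisibility test with the
  large constant.\<close>

definition small_index_ok :: "nat \<Rightarrow> bool" where
  "small_index_ok n \<longleftrightarrow> (if 2 * n < 59 * 2 ^ small_omega n
    then (if 4 * n < 59 * 2 ^ omega_bound n then (n, omega_bound n) \<in> set small_index_list else True) else True)"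

text \<open>Instances for numerals only, so that the simplifier does not unfold these constants at a bound variable.\<close>
lemmas small_index_numeral = small_index_ok_def[of "numeral k" for k]
  omega_bound_def[of "numeral k" for k] small_omega_def[of "numeral k" for k]

lemma small_index_table_1: "\<forall>n\<in>set [3..<60]. small_index_ok n"
  by (simp add: upt_rec_numeral small_index_numeral small_index_list_def)
lemma small_index_table_2: "\<forall>n\<in>set [60..<120]. small_index_ok n"
  by (simp add: upt_rec_numeral small_index_numeral small_index_list_def)
lemma small_index_table_3: "\<forall>n\<in>set [120..<180]. small_index_ok n"
  by (simp add: upt_rec_numeral small_index_numeral small_index_list_def)
lemma small_index_table_4: "\<forall>n\<in>set [180..<236]. small_index_ok n"
  by (simp add: upt_rec_numeral small_index_numeral small_index_list_def)

lemma small_index_table: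
  assumes "3 \<le> n" "n < 236" "4 * n < 59 * 2 ^ omega_bound n"
  shows "(n, omega_bound n) \<in> set small_index_list"
proof -
  have "n \<in> set [3..<60] \<union> set [60..<120] \<union> set [120..<180] \<union> set [180..<236]"
    using assms unfolding set_upt Un_iff atLeastLessThan_iff by linarith
  then have "small_index_ok n"
    using small_index_table_1 small_index_table_2 small_index_table_3 small_index_table_4 by blast
  moreover have "(2 :: nat) ^ omega_bound n \<le> 2 * 2 ^ small_omega n" by (simp add: omega_bound_def)
  ultimately show ?thesis using assms(3) unfolding small_index_ok_def by (simp split: if_splits)
qed

section \<open>Counting subgroups by their order\<close>

context fin_group
begin

definition subs_of where "subs_of d = {H. subgroup H G \<and> card H = d}"

lemma finite_subs_of: "finite (subs_of d)"
  by (rule finite_subset[OF _ finite_subs]) (auto simp: subs_of_def)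

lemma sum_subs_of_le: assumes "finite D" shows "(\<Sum>d\<in>D. card (subs_of d)) \<le> num_subgroups G"
proof -
  have "card (\<Union>d\<in>D. subs_of d) = (\<Sum>d\<in>D. card (subs_of d))"
    by (rule card_UN_disjoint[OF assms]) (simp_all add: finite_subs_of, auto simp: subs_of_def)
  moreover have "card (\<Union>d\<in>D. subs_of d) \<le> num_subgroups G"
    unfolding num_subgroups_def by (rule card_mono[OF finite_subs]) (auto simp: subs_of_def)
  ultimately show ?thesis by simp
qed

lemma subs_of_pos: "subgroup H G \<Longrightarrow> 1 \<le> card (subs_of (card H))"
  using finite_subs_of[of "card H"] card_gt_0_iff[of "subs_of (card H)"] by (auto simp: subs_of_def Suc_le_eq)

lemma subs_of_one: "1 \<le> card (subs_of 1)"
  using subs_of_pos[OF triv_subgroup] by simp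

lemma subs_of_order: "1 \<le> card (subs_of (order G))"
  using subs_of_pos[OF subgroup_self] by (simp add: order_def)

lemma subs_of_Syl: "card (subs_of (r ^ multiplicity r (order G))) = nSyl r"
  by (simp add: subs_of_def nSyl_def Syl_def)

text \<open>Different Sylow subgroups have different normalizers, since each is the only one for its
  prime inside its own.\<close>

lemma subs_of_nrm: assumes "prime r" shows "nSyl r \<le> card (subs_of (order G div nSyl r))"
proof -
  have "inj_on (nrm G) (Syl r G)"
    using Syl_eq_if_nrm[OF assms] subset_nrm SylD(1) by (intro inj_onI) metis
  moreover have "nrm G ` Syl r G \<subseteq> subs_of (order G div nSyl r)"
    using card_nrm_Syl[OF assms] nrm_subgroup Syl_carrier by (auto simp: subs_of_def)
  ultimately show ?thesis unfolding nSyl_def using card_inj_on_le finite_subs_of by blast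
qed

end

context doubly_transitive_Syl
begin

text \<open>A nonidentity element of a two-point stabilizer fixes exactly that pair, so subgroups
  chosen for different pairs differ. The predicate \<open>\<Phi>\<close> allows prescribing the
  order itself or its set of primes.\<close>

lemma card_two_stab_family:
  assumes D: "\<And>P R. P \<in> Syl p G \<Longrightarrow> R \<in> Syl p G \<Longrightarrow> R \<noteq> P \<Longrightarrow>
    \<exists>D. subgroup D G \<and> D \<subseteq> two_stab P R \<and> D \<noteq> {\<one>} \<and> \<Phi> (card D)"
  shows "(p + 1) choose 2 \<le> card {D. subgroup D G \<and> \<Phi> (card D)}"
proof -
  let ?B = "{B. B \<subseteq> Syl p G \<and> card B = 2}"
  have "\<exists>D. subgroup D G \<and> D \<noteq> {\<one>} \<and> \<Phi> (card D) \<and> (\<exists>P R. B = {P, R} \<and> P \<noteq> R \<and> D \<subseteq> two_stab P R)"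
    if B: "B \<in> ?B" for B
  proof -
    obtain P R where "B = {P, R}" "P \<noteq> R" using B by (auto simp: card_2_iff)
    then show ?thesis using D[of P R] B by auto
  qed
  then have "\<exists>f. \<forall>B\<in>?B. subgroup (f B) G \<and> f B \<noteq> {\<one>} \<and> \<Phi> (card (f B)) \<and>
      (\<exists>P R. B = {P, R} \<and> P \<noteq> R \<and> f B \<subseteq> two_stab P R)"
    by (intro bchoice ballI)
  then obtain f where f: "\<And>B. B \<in> ?B \<Longrightarrow> subgroup (f B) G \<and> f B \<noteq> {\<one>} \<and> \<Phi> (card (f B)) \<and>
      (\<exists>P R. B = {P, R} \<and> P \<noteq> R \<and> f B \<subseteq> two_stab P R)"
    by blast
  have sub: "B' \<subseteq> B" if B: "B \<in> ?B" "B' \<in> ?B" "f B = f B'" for B B'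
  proof
    fix S assume S: "S \<in> B'"
    obtain P R where PR: "B = {P, R}" "P \<noteq> R" "f B \<subseteq> two_stab P R" using f[OF B(1)] by blast
    obtain P' R' where PR': "B' = {P', R'}" "f B' \<subseteq> two_stab P' R'" using f[OF B(2)] by blast
    obtain x where x: "x \<in> f B" "x \<noteq> \<one>" using f[OF B(1)] subgroup.one_closed by blast
    have "cnj G x S = S" using x(1) B(3) PR' S by (auto simp: two_stab_def nrm_def)
    then show "S \<in> B" using two_stab_fixes[of P R x S] PR x S B by auto
  qed
  have "inj_on f ?B" by (rule inj_onI) (use sub in blast)
  moreover have "f ` ?B \<subseteq> {D. subgroup D G \<and> \<Phi> (card D)}" using f by blast
  moreover have "finite {D. subgroup D G \<and> \<Phi> (card D)}" by (rule finite_subset[OF _ finite_subs]) auto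
  ultimately have "card ?B \<le> card {D. subgroup D G \<and> \<Phi> (card D)}" using card_inj_on_le by blast
  then show ?thesis using n_subsets[OF finite_Syl, of p 2] nSyl_p by simp
qed

lemma subs_of_two_stab:
  assumes PR: "P0 \<in> Syl p G" "R0 \<in> Syl p G" "R0 \<noteq> P0"
    and d: "d = card (two_stab P0 R0) \<or> prime d \<and> d dvd card (two_stab P0 R0)" "d \<noteq> 1"
  shows "(p + 1) choose 2 \<le> card (subs_of d)"
  unfolding subs_of_def
proof (rule card_two_stab_family)
  fix P R assume a: "P \<in> Syl p G" "R \<in> Syl p G" "R \<noteq> P"
  have "card (two_stab P R) * (p * (p + 1)) = card (two_stab P0 R0) * (p * (p + 1))"
    using card_two_stab(2)[OF a] card_two_stab(2)[OF PR] by (simp only: mult.commute)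
  moreover have "p * (p + 1) \<noteq> 0" using prime_gt_0_nat[OF prime_p] by simp
  ultimately have c: "card (two_stab P R) = card (two_stab P0 R0)" by (metis mult_cancel2)
  have sC: "subgroup (two_stab P R) G" using two_stab_subgroup a by blast
  interpret C: fin_group "G\<lparr>carrier := two_stab P R\<rparr>" using fin_subgroup sC .
  have "\<exists>D. subgroup D G \<and> D \<subseteq> two_stab P R \<and> card D = d"
  proof (cases "d = card (two_stab P0 R0)")
    case True
    then show ?thesis using c sC by blast
  next
    case False
    then have d': "prime d" "d dvd card (two_stab P R)" using d c by auto
    then obtain m where "order (G\<lparr>carrier := two_stab P R\<rparr>) = d ^ 1 * m" by (auto simp: order_def)
    then obtain D where D: "subgroup D (G\<lparr>carrier := two_stab P R\<rparr>)" "card D = d"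
      using sylow_thm[OF d'(1) C.is_group _ C.fin, of 1] by auto
    then show ?thesis using incl_subgroup[OF sC D(1)] subgroup.subset[OF D(1)] by auto
  qed
  then show "\<exists>D. subgroup D G \<and> D \<subseteq> two_stab P R \<and> D \<noteq> {\<one>} \<and> card D = d"
    using d(2) by auto
qed

end

section \<open>Restriction to finitely many indices and exclusion of the index
  \<open>q + 1\<close>\<close>

context minimal_counterexample
begin

text \<open>The family of \<open>q\<close> alone gives the first bound. Comparing it with the
  product of the lost primes shows that at most four are lost, so
  \<open>4 * nSyl q < 59 * 16\<close>; this is the origin of 236.\<close>

lemma nSyl_lost_bound:
  assumes q: "q \<in> \<pi>"
  shows "4 * nSyl q < 59 * 2 ^ card (lost q)" "nSyl q < 236" "card (lost q) \<le> omega_bound (nSyl q)"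
    "(nSyl q, omega_bound (nSyl q)) \<in> set small_index_list"
proof -
  have pq: "prime q" using q by auto
  have "2 + nSyl q * 2 ^ card (nrmprimes q) \<le> num_subgroups G" using weight_bound[of "[q]"] q by simp
  then have "8 * (nSyl q * 2 ^ card (nrmprimes q)) < 59 * 2 ^ card (\<pi>)"
    using few_subgroups by linarith
  then have "2 ^ card (nrmprimes q) * (4 * nSyl q) < 2 ^ card (nrmprimes q) * (59 * 2 ^ card (lost q))"
    using card_nrmprimes[OF q] by (simp add: power_add)
  then show lt: "4 * nSyl q < 59 * 2 ^ card (lost q)" by simp
  have finL: "finite (lost q)" by (simp add: lost_def)
  have pL: "\<And>r. r \<in> lost q \<Longrightarrow> prime r \<and> r dvd nSyl q" using lost_dvd[OF q] by blast
  have n_pos: "nSyl q > 0" "nSyl q \<ge> 3" using nSyl_gt[OF q] prime_ge_2_nat[OF pq] by auto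
  have "\<Prod>(lost q) \<le> nSyl q" using n_pos prod_primes_dvd[OF finL pL] dvd_imp_le by blast
  then have "(5 / 2) ^ card (lost q - {2, 3}) * 2 ^ card (lost q) \<le> real (nSyl q)"
    using prod_primes_ge[OF finL] pL by (meson of_nat_mono order_trans)
  moreover have "real (4 * nSyl q) < real (59 * 2 ^ card (lost q))" using lt by (simp only: of_nat_less_iff)
  then have "4 * real (nSyl q) < 59 * 2 ^ card (lost q)" by simp
  ultimately have "4 * ((5 / 2) ^ card (lost q - {2, 3}) * 2 ^ card (lost q)) < 59 * (2::real) ^ card (lost q)" by linarith
  then have lt2: "4 * (5 / 2 :: real) ^ card (lost q - {2, 3}) < 59" by simp
  \<comment> \<open>Three lost primes beyond 3 would give 4 * (5/2)^3 = 62.5, which exceeds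
    59.\<close>
  have "card (lost q - {2, 3}) < 3"
  proof (rule ccontr)
    assume "\<not> card (lost q - {2, 3}) < 3"
    then have "(5 / 2 :: real) ^ 3 \<le> (5 / 2) ^ card (lost q - {2, 3})" by (intro power_increasing) auto
    then show False using lt2 by (simp add: power3_eq_cube)
  qed
  moreover have "card (lost q) = card (lost q \<inter> {2, 3}) + card (lost q - {2, 3})"
    using card_Int_Diff[OF finL] by simp
  moreover have "card (lost q \<inter> {2, 3}) \<le> card {2, 3 :: nat}" by (rule card_mono) auto
  ultimately have "card (lost q) \<le> 4" by simp
  then have "(2 :: nat) ^ card (lost q) \<le> 2 ^ 4" by (rule power_increasing) simp
  then show n: "nSyl q < 236" using lt by simp
  show om: "card (lost q) \<le> omega_bound (nSyl q)"
    using card_primes_le_omega_bound[of "lost q" "nSyl q"] pL n n_pos by blast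
  have "(2 :: nat) ^ card (lost q) \<le> 2 ^ omega_bound (nSyl q)" using om by (rule power_increasing) simp
  then have "4 * nSyl q < 59 * 2 ^ omega_bound (nSyl q)" using lt by linarith
  then show "(nSyl q, omega_bound (nSyl q)) \<in> set small_index_list"
    using small_index_table n n_pos by blast
qed

lemma doubly_transitive:
  assumes q: "q \<in> \<pi>" and n: "nSyl q = q + 1"
  shows "doubly_transitive_Syl G q"
proof (unfold_locales)
  show "prime q" using q by auto
  show "card (Syl q G) = q + 1" using n by (simp add: nSyl_def)
qed (use Syl_faithful[OF q] in blast)

text \<open>The two-point stabilizers have order \<open>c \<noteq> 1\<close> and are solvable, so
  each nonempty set of primes dividing \<open>c\<close> contributes one subgroup per pair of Sylow
  \<open>q\<close>-subgroups. Their orders are prime to \<open>q\<close>, which separates them from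
  the subgroups with a normal Sylow \<open>q\<close>-subgroup.\<close>

lemma nSyl_succ_lt_13:
  assumes q: "q \<in> \<pi>" and n: "nSyl q = q + 1"
  shows "q < 13"
proof -
  interpret D: doubly_transitive_Syl G q using doubly_transitive[OF assms] .
  have pq: "prime q" using q by auto
  obtain P where P: "P \<in> Syl q G" using Syl_ne pq by blast
  obtain R where R: "R \<in> Syl q G" "R \<noteq> P" using D.ex_other P by blast
  define c where "c = card (D.two_stab P R)"
  have oc: "order G = q * (q + 1) * c" using D.card_two_stab(2)[OF P R] by (simp add: c_def)
  have cdvd: "c dvd q - 1" using D.card_two_stab_dvd[OF P R] by (simp add: c_def)
  have q1: "q > 1" using prime_gt_1_nat pq .
  have c_pos: "c > 0" using oc order_pos by (auto intro: Nat.gr0I)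
  have nq: "\<not> q dvd c"
  proof
    assume "q dvd c"
    then have "q dvd q - 1" using cdvd dvd_trans by blast
    then show False using q1 by (auto dest: dvd_imp_le)
  qed
  have "c \<noteq> 1" using D.normal_Syl_if_trivial_two_stab nSyl_ne_one oc by auto
  define F where "F = prime_factors c"
  have F_ne: "F \<noteq> {}" using \<open>c \<noteq> 1\<close> c_pos prime_factors_eq_empty_iff by (simp add: F_def)
  have finF: "finite F" by (simp add: F_def)
  have NL: "nrmprimes q = F"
  proof -
    have "order G div nSyl q = q * c" using oc n
      by (metis mult.assoc mult.commute nonzero_mult_div_cancel_left add_is_0 one_neq_zero)
    then have "nrmprimes q = prime_factors (q * c) - {q}" by (simp add: nrmprimes_def)
    also have "prime_factors (q * c) = insert q F"
      using prime_factors_mult_primepow[OF pq c_pos, of 1] by (simp add: F_def mult.commute)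
    finally show ?thesis using nq by (auto simp: F_def)
  qed
  let ?T = "\<lambda>\<tau>. {D. subgroup D G \<and> prime_factors (card D) = \<tau>}"
  have fam: "(q + 1) choose 2 \<le> card (?T \<tau>)" if \<tau>: "\<tau> \<in> Pow F - {{}}" for \<tau>
  proof (rule D.card_two_stab_family)
    fix P' R' assume a: "P' \<in> Syl q G" "R' \<in> Syl q G" "R' \<noteq> P'"
    have "card (D.two_stab P' R') * (q * (q + 1)) = c * (q * (q + 1))"
      using D.card_two_stab(2)[OF a] oc by (simp only: mult.commute)
    then have c': "card (D.two_stab P' R') = c" using q1 by simp
    have sC: "subgroup (D.two_stab P' R') G" using D.two_stab_subgroup a by blast
    have sN: "subgroup (nrm G P') G" using nrm_subgroup Syl_carrier a by blast
    have "subgroup (D.two_stab P' R') (G\<lparr>carrier := nrm G P'\<rparr>)"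
      using subgroup_incl[OF sC sN] by (auto simp: D.two_stab_def)
    then have "solvable (G\<lparr>carrier := D.two_stab P' R'\<rparr>)"
      using fin_group.solvable_sub[OF fin_subgroup[OF sN] nrm_solvable[OF q a(1)]] by simp
    then obtain D where D: "subgroup D (G\<lparr>carrier := D.two_stab P' R'\<rparr>)" "prime_factors (card D) = \<tau>"
      using solvable_subgroup_prime_factors[OF fin_subgroup[OF sC], of \<tau>] \<tau> c' by (auto simp: order_def F_def)
    have "D \<noteq> {\<one>}" using D(2) \<tau> by auto
    then show "\<exists>D. subgroup D G \<and> D \<subseteq> D.two_stab P' R' \<and> D \<noteq> {\<one>} \<and> prime_factors (card D) = \<tau>"
      using incl_subgroup[OF sC D(1)] subgroup.subset[OF D(1)] D(2) by auto
  qed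
  have finT: "finite (?T \<tau>)" for \<tau> by (rule finite_subset[OF _ finite_subs]) auto
  have finN: "finite (normal_Syl_subs q {})"
    by (rule finite_subset[OF _ finite_subs]) (auto simp: normal_Syl_subs_def)
  have "(\<Sum>\<tau>\<in>Pow F - {{}}. (q + 1) choose 2) \<le> (\<Sum>\<tau>\<in>Pow F - {{}}. card (?T \<tau>))"
    by (rule sum_mono) (rule fam)
  also have "\<dots> = card (\<Union>\<tau>\<in>Pow F - {{}}. ?T \<tau>)"
    by (rule card_UN_disjoint[symmetric]) (use finF finT in auto)
  finally have 1: "(2 ^ card F - 1) * ((q + 1) choose 2) \<le> card (\<Union>\<tau>\<in>Pow F - {{}}. ?T \<tau>)"
    using finF by (simp add: card_Pow card_Diff_singleton)
  have 2: "(q + 1) * 2 ^ card F \<le> card (normal_Syl_subs q {})"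
    using card_normal_Syl_subs[OF q, of "{}"] nrm_solvable[OF q] NL n by simp
  have "(\<Union>\<tau>\<in>Pow F - {{}}. ?T \<tau>) \<inter> normal_Syl_subs q {} = {}"
  proof -
    have "q \<notin> prime_factors (card D)" if "D \<in> ?T \<tau>" "\<tau> \<in> Pow F - {{}}" for D \<tau>
      using that nq by (auto simp: F_def)
    moreover have "q \<in> prime_factors (card H)" if "H \<in> normal_Syl_subs q {}" for H
      using that pq card_sub_pos[of H] by (auto simp: normal_Syl_subs_def prime_factors_dvd)
    ultimately show ?thesis by blast
  qed
  then have "card (\<Union>\<tau>\<in>Pow F - {{}}. ?T \<tau>) + card (normal_Syl_subs q {}) =
      card ((\<Union>\<tau>\<in>Pow F - {{}}. ?T \<tau>) \<union> normal_Syl_subs q {})"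
    using finF finT finN by (intro card_Un_disjoint[symmetric]) auto
  also have "\<dots> \<le> num_subgroups G"
    unfolding num_subgroups_def by (rule card_mono[OF finite_subs]) (auto simp: normal_Syl_subs_def)
  finally have S: "(2 ^ card F - 1) * ((q + 1) choose 2) + (q + 1) * 2 ^ card F \<le> num_subgroups G"
    using 1 2 by linarith
  have ch: "2 * ((q + 1) choose 2) = q * (q + 1)" by (simp add: choose_two)
  define m where "m = card F"
  have m1: "m \<ge> 1" using F_ne finF by (simp add: m_def Suc_le_eq card_gt_0_iff)
  have "(2 :: nat) ^ m \<le> 2 * (2 ^ m - 1)" using m1 by (cases m) auto
  \<comment> \<open>As \<open>m\<close> is positive, \<open>2 ^ m - 1\<close> is at least half of
    \<open>2 ^ m\<close>; the two families together then have at least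
    \<open>2 ^ m * (q + 1) * (q + 4) / 4\<close> members.\<close>
  then have "2 ^ m * (q * (q + 1)) \<le> 2 * (2 ^ m - 1) * (2 * ((q + 1) choose 2))" using ch
    by (metis mult_le_mono1)
  then have "2 ^ m * (q * (q + 1)) + 4 * ((q + 1) * 2 ^ m) \<le> 4 * num_subgroups G"
    using S unfolding m_def by (simp add: algebra_simps)
  then have A: "2 * (2 ^ m * ((q + 1) * (q + 4))) \<le> 8 * num_subgroups G" by (simp add: algebra_simps)
  have "card (\<pi>) = 1 + m + card (lost q)" using card_nrmprimes[OF q] NL by (simp add: m_def)
  then have "2 * (2 ^ m * ((q + 1) * (q + 4))) < 2 * (2 ^ m * (59 * 2 ^ card (lost q)))"
    using A few_subgroups by (simp only: power_add power_one_right mult.assoc)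
  then have "(q + 1) * (q + 4) < 59 * 2 ^ card (lost q)" by simp
  moreover have "(2 :: nat) ^ card (lost q) \<le> 2 ^ omega_bound (nSyl q)"
    using nSyl_lost_bound(3)[OF q] by (rule power_increasing) simp
  moreover have "nSyl q * (nSyl q + 3) = (q + 1) * (q + 4)" unfolding n by simp
  ultimately have "nSyl q * (nSyl q + 3) < 59 * 2 ^ omega_bound (nSyl q)" by linarith
  moreover have "(nSyl q, omega_bound (nSyl q)) \<in> set small_index_list" using nSyl_lost_bound(4)[OF q] .
  moreover have "\<forall>(n, k)\<in>set small_index_list. n * (n + 3) < 59 * 2 ^ k \<longrightarrow> n < 14"
    by (simp add: small_index_list_def)
  ultimately show ?thesis using n by auto
qed

end

lemma dvd_60_cases: "n dvd (60 :: nat) \<Longrightarrow> n \<in> {1, 2, 3, 4, 5, 6, 10, 12, 15, 20, 30, 60}"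
proof -
  assume n: "n dvd 60"
  have "\<forall>m\<in>set [2..<61]. m dvd 60 \<longrightarrow> m \<in> {2, 3, 4, 5, 6, 10, 12, 15, 20, 30,
    60 :: nat}"
    by (simp add: upt_rec_numeral)
  moreover have "n \<le> 60" using n by (rule dvd_imp_le) simp
  moreover have "n \<noteq> 0" using n by (rule_tac notI) simp
  moreover have "n = 1 \<or> n \<in> set [2..<61]"
    unfolding set_upt atLeastLessThan_iff using calculation(2,3) by linarith
  ultimately show ?thesis using n by blast
qed

lemma prime_factors_prod_list:
  assumes "n = prod_list ps" "\<forall>x\<in>set ps. prime (x :: nat)"
  shows "prime_factors n \<subseteq> set ps"
proof
  fix t assume "t \<in> prime_factors n"
  then have t: "prime t" "t dvd prod_list ps" using assms(1) by auto
  then show "t \<in> set ps" using assms(2)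
    by (induction ps) (auto simp: prime_dvd_mult_iff primes_dvd_imp_eq)
qed

context minimal_counterexample
begin

lemma few_subgroups_card:
  assumes "\<pi> \<subseteq> A" "finite A"
  shows "8 * num_subgroups G < 59 * 2 ^ card A"
proof -
  have "(2 :: nat) ^ card (\<pi>) \<le> 2 ^ card A"
    by (rule power_increasing[OF card_mono[OF assms(2,1)]]) simp
  then show ?thesis using few_subgroups by linarith
qed

lemma nSyl_facts:
  assumes "r \<in> \<pi>"
  shows "nSyl r mod r = 1" "nSyl r dvd order G" "\<And>t. t \<in> \<pi> \<Longrightarrow> t \<le> nSyl r"
    "order G dvd fact (nSyl r)"
  using nSyl_gt[OF assms] nSyl_dvd[of r] prime_le_nSyl[OF assms] order_dvd_fact_nSyl[OF assms] assms by auto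

text \<open>For each remaining \<open>q\<close> the order is \<open>q * (q + 1) * c\<close> with
  \<open>c\<close> a divisor of \<open>q - 1\<close> other than 1. Sylow subgroups, their
  normalizers and subgroups of two-point stabilizers are counted by order; several cases leave no
  slack.\<close>

lemma nSyl_ne_succ:
  assumes q: "q \<in> \<pi>"
  shows "nSyl q \<noteq> q + 1"
proof
  assume n: "nSyl q = q + 1"
  interpret D: doubly_transitive_Syl G q using doubly_transitive[OF q n] .
  have pq: "prime q" using q by auto
  obtain P where P: "P \<in> Syl q G" using Syl_ne pq by blast
  obtain R where R: "R \<in> Syl q G" "R \<noteq> P" using D.ex_other P by blast
  define c where "c = card (D.two_stab P R)"
  have oc: "order G = q * (q + 1) * c" using D.card_two_stab(2)[OF P R] by (simp add: c_def)
  have cdvd: "c dvd q - 1" using D.card_two_stab_dvd[OF P R] by (simp add: c_def)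
  have c1: "c \<noteq> 1" using D.normal_Syl_if_trivial_two_stab nSyl_ne_one oc by auto
  have two: "(q + 1) choose 2 \<le> card (subs_of d)" if "d = c \<or> prime d \<and> d dvd c" "d \<noteq> 1" for d
    using D.subs_of_two_stab[OF P R, of d] that by (simp add: c_def)
  have sq: "card (subs_of q) = q + 1"
    using subs_of_Syl[of q] SylD(2)[OF P] D.card_Syl_eq[OF P] n by simp
  have odiv: "order G div nSyl q = q * c"
  proof -
    have "order G = (q + 1) * (q * c)" using oc by (simp only: mult.assoc mult.commute mult.left_commute)
    then show ?thesis using n by (metis nonzero_mult_div_cancel_left add_is_0 one_neq_zero)
  qed
  have sqc: "q + 1 \<le> card (subs_of (q * c))" using subs_of_nrm[OF pq] odiv n by simp
  have mult: "multiplicity r m = k" if "r ^ k dvd m" "\<not> r ^ Suc k dvd m" for r m k :: nat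
    using that by (rule multiplicity_eqI)
  have pfD: "r \<in> \<pi>" if "prime r" "r dvd order G" for r
    using that order_pos by (simp add: prime_factors_dvd)
  note sum_le = sum_subs_of_le
  have "q \<in> {2, 3, 5, 7, 11, 13}" using small_prime_cases[OF pq] nSyl_succ_lt_13[OF q n] by simp
  then consider "q = 2" | "q = 3" | "q = 5" | "q = 7" | "q = 11"
    using nSyl_succ_lt_13[OF q n] by auto
  then show False
  proof cases
    case 1
    then show False using cdvd c1 by simp
  next
    case 2
    then have "c dvd 2" "c \<le> 2" using cdvd by (auto dest: dvd_imp_le)
    then have "c = 2" using c1 by (cases "c = 0") auto
    then have o: "order G = 24" using oc 2 by simp
    have r: "2 \<in> \<pi>" by (rule pfD) (auto simp: o)
    have "nSyl 2 \<le> 24" using nSyl_facts(2)[OF r] o by (auto dest: dvd_imp_le)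
    moreover have "\<forall>m\<in>set [2..<25]. m dvd 24 \<longrightarrow> m mod 2 = 1 \<longrightarrow> m = (3 :: nat)"
      by (simp add: upt_rec_numeral)
    moreover have "nSyl 2 \<ge> 2" using nSyl_facts(3)[OF r r] .
    then have "nSyl 2 \<in> set [2..<25]"
      unfolding set_upt atLeastLessThan_iff using calculation(1) by linarith
    ultimately have "nSyl 2 = 1 \<or> nSyl 2 = 3" using nSyl_facts(1,2)[OF r] o by metis
    \<comment> \<open>\<open>nSyl 2 = 3\<close> would embed a group of order 24 into the symmetric
      group of degree 3.\<close>
    then show False using nSyl_ne_one[OF r] nSyl_facts(4)[OF r] o
      by (auto simp: fact_numeral dest: dvd_imp_le)
  next
    case 3
    then have "c dvd 4" "c \<le> 4" using cdvd by (auto dest: dvd_imp_le)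
    then have "c \<in> {0, 1, 2, 3, 4}" by auto
    then consider "c = 2" | "c = 4" using c1 \<open>c dvd 4\<close> by auto
    then show False
    proof cases
      case c: 1
      have o: "order G = 60" using oc 3 c by simp
      have r: "2 \<in> \<pi>" "3 \<in> \<pi>" "5 \<in> \<pi>"
        by (rule pfD; simp add: o)+
      have "\<pi> \<subseteq> {2, 3, 5}" using prime_factors_prod_list[of "order G" "[2, 2, 3, 5]"] o by simp
      then have few: "8 * num_subgroups G < 59 * 8" using few_subgroups_card[of "{2, 3, 5}"] by simp
      have "nSyl 3 \<in> {1, 2, 3, 4, 5, 6, 10, 12, 15, 20, 30, 60}" "nSyl 3 mod 3 = 1" "5 \<le> nSyl 3"
        using nSyl_facts(1-3)[OF r(2)] r(3) dvd_60_cases o by auto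
      then have n3: "nSyl 3 = 10" by auto
      have "nSyl 2 \<in> {1, 2, 3, 4, 5, 6, 10, 12, 15, 20, 30, 60}" "nSyl 2 mod 2 = 1" "5 \<le> nSyl 2"
        using nSyl_facts(1-3)[OF r(1)] r(3) dvd_60_cases o by auto
      then have n2: "nSyl 2 = 5 \<or> nSyl 2 = 15" by auto
      have a: "15 \<le> card (subs_of 2)" "card (subs_of 5) = 6" "6 \<le> card (subs_of 10)"
        using two[of 2] sq sqc c 3 by (auto simp: choose_two)
      have b: "card (subs_of 3) = 10"
        using subs_of_Syl[of 3] mult[of 3 1 60] n3 o by simp
      have d: "card (subs_of 4) = nSyl 2"
        using subs_of_Syl[of 2] mult[of 2 2 60] o by simp
      have e: "10 \<le> card (subs_of 6)" using subs_of_nrm[of 3] n3 o by simp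
      have f: "1 \<le> card (subs_of 1)" "1 \<le> card (subs_of 60)" using subs_of_one subs_of_order o by auto
      show False
      proof (cases "nSyl 2 = 5")
        case True
        then have "5 \<le> card (subs_of 12)" using subs_of_nrm[of 2] o by simp
        \<comment> \<open>The numbers of subgroups of the alternating group of degree 5: 1 + 15 + 10
          + 5 + 6 + 10 + 6 + 5 + 1 = 59.\<close>
        then show False using sum_le[of "{1, 2, 3, 4, 5, 6, 10, 12, 60}"] a b d e f few True by simp
      next
        case False
        then show False using sum_le[of "{1, 2, 3, 4, 5, 6, 10, 60}"] a b d e f few n2 by simp
      qed
    next
      case c: 2
      have o: "order G = 120" using oc 3 c by simp
      have r: "2 \<in> \<pi>" "3 \<in> \<pi>" "5 \<in> \<pi>"
        by (rule pfD; simp add: o)+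
      have "\<pi> \<subseteq> {2, 3, 5}" using prime_factors_prod_list[of "order G" "[2, 2, 2, 3, 5]"] o by simp
      then have few: "8 * num_subgroups G < 59 * 8" using few_subgroups_card[of "{2, 3, 5}"] by simp
      have "10 \<le> nSyl 3"
      proof (rule ccontr)
        assume "\<not> 10 \<le> nSyl 3"
        then have "nSyl 3 \<in> {5, 6, 7, 8, 9}" using nSyl_facts(3)[OF r(2,3)] by auto
        then show False using nSyl_facts(1,2)[OF r(2)] o by auto
      qed
      then have b: "10 \<le> card (subs_of 3)"
        using subs_of_Syl[of 3] mult[of 3 1 120] o by simp
      have d: "5 \<le> card (subs_of 8)"
        using subs_of_Syl[of 2] mult[of 2 3 120] nSyl_facts(3)[OF r(1,3)] o by simp
      have a: "15 \<le> card (subs_of 2)" "15 \<le> card (subs_of 4)" "card (subs_of 5) = 6" "6 \<le> card (subs_of 20)"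
        using two[of 2] two[of 4] sq sqc c 3 by (auto simp: choose_two)
      have f: "1 \<le> card (subs_of 1)" "1 \<le> card (subs_of 120)" using subs_of_one subs_of_order o by auto
      \<comment> \<open>Again the lower bound is exactly 59: 1 + 15 + 10 + 15 + 6 + 5 + 6 +
        1.\<close>
      show False using sum_le[of "{1, 2, 3, 4, 5, 8, 20, 120}"] a b d f few by simp
    qed
  next
    case 4
    then have "c dvd 6" "c \<le> 6" using cdvd by (auto dest: dvd_imp_le)
    then have "c \<in> {0, 1, 2, 3, 4, 5, 6}" by auto
    then consider "c = 2" | "c = 3" | "c = 6" using c1 \<open>c dvd 6\<close> by auto
    then show False
    proof cases
      case c: 1
      have o: "order G = 112" using oc 4 c by simp
      have "\<pi> \<subseteq> {2, 7}" using prime_factors_prod_list[of "order G" "[2, 2, 2, 2, 7]"] o by simp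
      then have few: "8 * num_subgroups G < 59 * 4" using few_subgroups_card[of "{2, 7}"] by simp
      have a: "28 \<le> card (subs_of 2)" "card (subs_of 7) = 8"
        using two[of 2] sq c 4 by (auto simp: choose_two)
      show False using sum_le[of "{2, 7}"] a few by simp
    next
      case c: 2
      have o: "order G = 168" using oc 4 c by simp
      have r: "2 \<in> \<pi>" "7 \<in> \<pi>"
        by (rule pfD; simp add: o)+
      have "\<pi> \<subseteq> {2, 3, 7}" using prime_factors_prod_list[of "order G" "[2, 2, 2, 3, 7]"] o by simp
      then have few: "8 * num_subgroups G < 59 * 8" using few_subgroups_card[of "{2, 3, 7}"] by simp
      have n2: "nSyl 2 = 7 \<or> 21 \<le> nSyl 2"
      proof (rule ccontr)
        assume "\<not> (nSyl 2 = 7 \<or> 21 \<le> nSyl 2)"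
        then have "nSyl 2 \<in> set [8..<21]"
          unfolding set_upt atLeastLessThan_iff using nSyl_facts(3)[OF r] by linarith
        then show False using nSyl_facts(1,2)[OF r(1)] o by (auto simp: upt_rec_numeral)
      qed
      have a: "28 \<le> card (subs_of 3)" "card (subs_of 7) = 8" "8 \<le> card (subs_of 21)"
        using two[of 3] sq sqc c 4 by (auto simp: choose_two)
      have d: "card (subs_of 8) = nSyl 2"
        using subs_of_Syl[of 2] mult[of 2 3 168] o by simp
      have f: "1 \<le> card (subs_of 1)" "1 \<le> card (subs_of 168)" using subs_of_one subs_of_order o by auto
      show False
      proof (cases "nSyl 2 = 7")
        case True
        then have "7 \<le> card (subs_of 24)" using subs_of_nrm[of 2] o by simp
        then show False using sum_le[of "{1, 3, 7, 8, 21, 24, 168}"] a d f few True by simp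
      next
        case False
        then show False using sum_le[of "{1, 3, 7, 8, 21, 168}"] a d f few n2 by simp
      qed
    next
      case c: 3
      have o: "order G = 336" using oc 4 c by simp
      have "\<pi> \<subseteq> {2, 3, 7}" using prime_factors_prod_list[of "order G" "[2, 2, 2, 2, 3, 7]"] o by simp
      then have few: "8 * num_subgroups G < 59 * 8" using few_subgroups_card[of "{2, 3, 7}"] by simp
      have a: "28 \<le> card (subs_of 2)" "28 \<le> card (subs_of 3)" "card (subs_of 7) = 8"
        using two[of 2] two[of 3] sq c 4 by (auto simp: choose_two)
      show False using sum_le[of "{2, 3, 7}"] a few by simp
    qed
  next
    case 5
    then have "c dvd 10" "c \<le> 10" using cdvd by (auto dest: dvd_imp_le)
    moreover have "c \<noteq> 0" using \<open>c dvd 10\<close> by (rule_tac notI) simp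
    ultimately have "c \<in> set [2..<11]" unfolding set_upt atLeastLessThan_iff using c1 by linarith
    then consider "c = 2" | "c = 5" | "c = 10" using \<open>c dvd 10\<close> by (auto simp: upt_rec_numeral)
    then show False
    proof cases
      case c: 1
      have o: "order G = 264" using oc 5 c by simp
      have "\<pi> \<subseteq> {2, 3, 11}" using prime_factors_prod_list[of "order G" "[2, 2, 2, 3, 11]"] o by simp
      then have few: "8 * num_subgroups G < 59 * 8" using few_subgroups_card[of "{2, 3, 11}"] by simp
      have a: "66 \<le> card (subs_of 2)" using two[of 2] c 5 by (simp add: choose_two)
      show False using sum_le[of "{2}"] a few by simp
    next
      case c: 2
      have o: "order G = 660" using oc 5 c by simp
      have r: "2 \<in> \<pi>" "3 \<in> \<pi>" "11 \<in> \<pi>"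
        by (rule pfD; simp add: o)+
      have "\<pi> \<subseteq> {2, 3, 5, 11}" using prime_factors_prod_list[of "order G" "[2, 2, 3, 5, 11]"] o by simp
      then have few: "8 * num_subgroups G < 59 * 16" using few_subgroups_card[of "{2, 3, 5, 11}"] by simp
      have "22 \<le> nSyl 3"
      proof (rule ccontr)
        assume "\<not> 22 \<le> nSyl 3"
        then have "nSyl 3 \<in> set [11..<22]"
          unfolding set_upt atLeastLessThan_iff using nSyl_facts(3)[OF r(2,3)] by linarith
        then show False using nSyl_facts(1,2)[OF r(2)] o by (auto simp: upt_rec_numeral)
      qed
      then have b: "22 \<le> card (subs_of 3)"
        using subs_of_Syl[of 3] mult[of 3 1 660] o by simp
      have d: "11 \<le> card (subs_of 4)"
        using subs_of_Syl[of 2] mult[of 2 2 660] nSyl_facts(3)[OF r(1,3)] o by simp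
      have a: "66 \<le> card (subs_of 5)" "card (subs_of 11) = 12" "12 \<le> card (subs_of 55)"
        using two[of 5] sq sqc c 5 by (auto simp: choose_two)
      show False using sum_le[of "{3, 4, 5, 11, 55}"] a b d few by simp
    next
      case c: 3
      have o: "order G = 1320" using oc 5 c by simp
      have "\<pi> \<subseteq> {2, 3, 5, 11}" using prime_factors_prod_list[of "order G" "[2, 2, 2, 3, 5, 11]"] o by simp
      then have few: "8 * num_subgroups G < 59 * 16" using few_subgroups_card[of "{2, 3, 5, 11}"] by simp
      have a: "66 \<le> card (subs_of 2)" "66 \<le> card (subs_of 5)"
        using two[of 2] two[of 5] c 5 by (auto simp: choose_two)
      show False using sum_le[of "{2, 5}"] a few by simp
    qed
  qed
qed

end

text \<open>
  Necessary conditions on the number \<open>n\<close> of Sylow \<open>q\<close>-subgroups when \<open>p\<close> is the largest prime in \<open>\<pi>\<close>. Nested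
  conditionals let the simplifier stop at the first failure.
\<close>
definition candidate :: "nat \<Rightarrow> nat \<Rightarrow> nat \<Rightarrow> bool" where
  "candidate q p n \<longleftrightarrow> (if n mod q = 1 then if 2 * q + 1 \<le> n then if p \<le> n
     then (\<forall>r\<in>{3, 5, 7, 11, 13, 17, 19, 23,
    29}. r dvd n \<longrightarrow> r \<le> p) else False else False else False)"

lemmas candidate_numeral = candidate_def[of "numeral i" "numeral j" "numeral k" for i j k]

text \<open>Trial division by 2, 3, 5 and 7 decides primality below 121.\<close>

lemma prime_less_105:
  assumes "prime (p :: nat)" "p < 105"
  shows "p \<in> {2, 3, 5, 7, 11, 13, 17, 19, 23, 29, 31, 37, 41, 43, 47, 53, 59, 61, 67, 71, 73, 79, 83, 89,
    97, 101, 103}"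
proof -
  have nd: "d dvd p \<longrightarrow> d = p \<or> d = 1" for d using assms(1) by (auto simp: prime_nat_iff)
  have "\<forall>m\<in>set [2..<105]. (2 dvd m \<longrightarrow> 2 = m) \<longrightarrow> (3 dvd m \<longrightarrow> 3 = m) \<longrightarrow> (5 dvd m \<longrightarrow> 5 = m) \<longrightarrow>
      (7 dvd m \<longrightarrow> 7 = m) \<longrightarrow> m \<in> {2, 3, 5, 7, 11, 13, 17, 19, 23, 29, 31, 37,
    41, 43, 47, 53, 59, 61, 67, 71, 73, 79, 83, 89, 97, 101, 103}"
    by (simp add: upt_rec_numeral)
  moreover have "p \<in> set [2..<105]"
    unfolding set_upt atLeastLessThan_iff using assms prime_ge_2_nat by simp
  ultimately show ?thesis using nd[of 2] nd[of 3] nd[of 5] nd[of 7] by fastforce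
qed

lemma max_prime_table:
  "\<forall>p\<in>{2, 3, 5, 7, 11, 13, 17, 19, 23, 29, 31, 37, 41, 43, 47, 53, 59, 61, 67, 71, 73, 79, 83, 89,
    97, 101, 103}. \<forall>x\<in>set small_index_list.
     candidate p p (fst x) \<longrightarrow> (p, fst x) \<in> {(3, 16), (5, 16), (5, 36), (7, 15), (7, 36), (7,
    50), (11, 45), (11, 56), (11, 210), (13, 27), (13, 40), (13, 66), (13, 105), (17, 35), (17, 52), (19, 39),
    (19, 210), (23, 70)}"
  by (simp add: small_index_list_def candidate_numeral)

lemma candidates_2_3: "\<forall>x\<in>set small_index_list. candidate 2 3 (fst x) \<longrightarrow> fst x \<in> {9, 27}"
  by (simp add: small_index_list_def candidate_numeral)

lemma candidates_2_5: "\<forall>x\<in>set small_index_list. candidate 2 5 (fst x) \<longrightarrow> fst x \<in> {5, 9, 15, 25, 27, 45}"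
  by (simp add: small_index_list_def candidate_numeral)

lemma candidates_3_5: "\<forall>x\<in>set small_index_list. candidate 3 5 (fst x) \<longrightarrow> fst x \<in> {10, 16, 25, 40}"
  by (simp add: small_index_list_def candidate_numeral)

lemma candidates_2_7: "\<forall>x\<in>set small_index_list. candidate 2 7 (fst x) \<longrightarrow> fst x \<in> {7, 9, 15, 21, 25, 27, 35, 45, 105}"
  by (simp add: small_index_list_def candidate_numeral)

lemma candidates_3_7: "\<forall>x\<in>set small_index_list. candidate 3 7 (fst x) \<longrightarrow> fst x \<in> {7, 10, 16, 25, 28, 40, 70}"
  by (simp add: small_index_list_def candidate_numeral)

lemma candidates_5_7: "\<forall>x\<in>set small_index_list. candidate 5 7 (fst x) \<longrightarrow> fst x \<in> {16, 21, 36, 56}"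
  by (simp add: small_index_list_def candidate_numeral)

lemma candidates_5_13: "\<forall>x\<in>set small_index_list. candidate 5 13 (fst x) \<longrightarrow> fst x \<in> {16, 21, 26, 36, 56, 66}"
  by (simp add: small_index_list_def candidate_numeral)

lemma candidates_7_17: "\<forall>x\<in>set small_index_list. candidate 7 17 (fst x) \<longrightarrow> \<not> 17 dvd fst x"
  by (simp add: small_index_list_def candidate_numeral)

text \<open>Here and in the following tables \<open>b * 2 ^ k \<le> 4 * n\<close> encodes that
  \<open>n / 2 ^ k\<close> is at least \<open>b / 4\<close>; quarters keep the computation within
  natural numbers.\<close>

lemma candidate_bound_2_11: "\<forall>x\<in>set small_index_list. candidate 2 11 (fst x) \<longrightarrow> 15 * 2 ^ snd x \<le> 4 * fst x"
  by (simp add: small_index_list_def candidate_numeral)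

lemma candidate_bound_3_11: "\<forall>x\<in>set small_index_list. candidate 3 11 (fst x) \<longrightarrow> 22 * 2 ^ snd x \<le> 4 * fst x"
  by (simp add: small_index_list_def candidate_numeral)

lemma candidate_bound_5_11: "\<forall>x\<in>set small_index_list. candidate 5 11 (fst x) \<longrightarrow> 21 * 2 ^ snd x \<le> 4 * fst x"
  by (simp add: small_index_list_def candidate_numeral)

lemma candidate_bound_3_13: "\<forall>x\<in>set small_index_list. candidate 3 13 (fst x) \<longrightarrow> 22 * 2 ^ snd x \<le> 4 * fst x"
  by (simp add: small_index_list_def candidate_numeral)

lemma candidate_bound_11_13: "\<forall>x\<in>set small_index_list. candidate 11 13 (fst x) \<longrightarrow> 39 * 2 ^ snd x \<le> 4 * fst x"
  by (simp add: small_index_list_def candidate_numeral)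

lemma candidate_bound_13_19: "\<forall>x\<in>set small_index_list. candidate 13 19 (fst x) \<longrightarrow> 33 * 2 ^ snd x \<le> 4 * fst x"
  by (simp add: small_index_list_def candidate_numeral)

lemma candidate_bound_3_19: "\<forall>x\<in>set small_index_list. candidate 3 19 (fst x) \<longrightarrow> 22 * 2 ^ snd x \<le> 4 * fst x"
  by (simp add: small_index_list_def candidate_numeral)

lemma candidate_bound_2_23: "\<forall>x\<in>set small_index_list. candidate 2 23 (fst x) \<longrightarrow> 33 * 2 ^ snd x \<le> 4 * fst x"
  by (simp add: small_index_list_def candidate_numeral)

lemma candidate_bound_7_23: "\<forall>x\<in>set small_index_list. candidate 7 23 (fst x) \<longrightarrow> 36 * 2 ^ snd x \<le> 4 * fst x"
  by (simp add: small_index_list_def candidate_numeral)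

lemma candidate_bound_5_7: "\<forall>x\<in>set small_index_list. candidate 5 7 (fst x) \<longrightarrow> 21 * 2 ^ snd x \<le> 4 * fst x"
  by (simp add: small_index_list_def candidate_numeral)

lemma index_bound_13: "\<forall>x\<in>set small_index_list. 13 \<le> fst x \<longrightarrow> 14 * 2 ^ snd x \<le> 4 * fst x"
  by (simp add: small_index_list_def)

lemma index_bound_17: "\<forall>x\<in>set small_index_list. 17 \<le> fst x \<longrightarrow> 15 * 2 ^ snd x \<le> 4 * fst x"
  by (simp add: small_index_list_def)

section \<open>The largest prime divisor\<close>

context minimal_counterexample
begin

text \<open>Multiplied by \<open>2 ^ (card \<pi> - 1)\<close> this is the number of subgroups
  \<open>nSyl q * 2 ^ card (nrmprimes q)\<close> that \<open>q\<close> contributes on its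
  own.\<close>

definition ratio where "ratio q = real (nSyl q) / 2 ^ card (lost q)"

text \<open>The sum r1/2 + r2/4 + r3/8 + ...: one halving for the prime itself and one for each
  earlier prime, which the later families have to avoid.\<close>

fun half_sum where
  "half_sum [] = 0"
| "half_sum (q # qs) = (ratio q + half_sum qs) / 2"

lemma ratio_bound:
  assumes q: "q \<in> \<pi>" and b: "b * 2 ^ omega_bound (nSyl q) \<le> 4 * nSyl q"
  shows "real b / 4 \<le> ratio q"
proof -
  have "(2 :: nat) ^ card (lost q) \<le> 2 ^ omega_bound (nSyl q)"
    by (rule power_increasing[OF nSyl_lost_bound(3)[OF q]]) simp
  then have "b * 2 ^ card (lost q) \<le> 4 * nSyl q" using b by (meson le_trans mult_le_mono2)
  then have "real (b * 2 ^ card (lost q)) \<le> real (4 * nSyl q)" by (simp only: of_nat_le_iff)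
  then show ?thesis by (simp add: ratio_def field_simps)
qed

text \<open>Avoiding \<open>E\<close> removes at most \<open>card E\<close> primes from
  \<open>nrmprimes q\<close> and so costs at most the factor \<open>2 ^ card E\<close>.\<close>

lemma weight_ge_half_sum:
  assumes "distinct qs" "set qs \<subseteq> \<pi>" "finite E"
  shows "2 ^ card (\<pi>) / 2 ^ card E * half_sum qs \<le> real (weight nSyl nrmprimes qs E)"
  using assms
proof (induction qs arbitrary: E)
  case (Cons q qs)
  let ?k = "card (\<pi>)"
  have q: "q \<in> \<pi>" using Cons.prems by simp
  have "card (nrmprimes q) \<le> card (nrmprimes q - E) + card E"
    using diff_card_le_card_Diff[OF Cons.prems(3), of "nrmprimes q"] by linarith
  then have "?k \<le> 1 + card (nrmprimes q - E) + card E + card (lost q)" using card_nrmprimes[OF q] by linarith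
  then have "(2 :: real) ^ ?k \<le> 2 ^ (1 + card (nrmprimes q - E) + card E + card (lost q))"
    by (rule power_increasing) simp
  then have "real (nSyl q) * 2 ^ ?k \<le> real (nSyl q) * 2 ^ (1 + card (nrmprimes q - E) + card E + card (lost q))"
    by (rule mult_left_mono) simp
  then have "2 ^ ?k / 2 ^ card E * (ratio q / 2) \<le> real (nSyl q) * 2 ^ card (nrmprimes q - E)"
    by (simp add: ratio_def power_add field_simps)
  moreover have "2 ^ ?k / 2 ^ card E * (half_sum qs / 2) \<le> real (weight nSyl nrmprimes qs (insert q E))"
  proof (cases "q \<in> E")
    case True
    have "0 \<le> half_sum rs" for rs by (induction rs) (auto simp: ratio_def)
    then have "2 ^ ?k / 2 ^ card E * (half_sum qs / 2) \<le> 2 ^ ?k / 2 ^ card E * half_sum qs"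
      by (intro mult_left_mono) (auto simp: field_simps)
    moreover have "insert q E = E" using True by auto
    ultimately show ?thesis using Cons.IH[of E] Cons.prems by simp
  next
    case False
    then show ?thesis using Cons.IH[of "insert q E"] Cons.prems by (simp add: field_simps)
  qed
  ultimately show ?case by (simp add: algebra_simps add_divide_distrib)
qed simp

lemma half_sum_less:
  assumes "distinct qs" "set qs \<subseteq> \<pi>"
  shows "half_sum qs < 59 / 8"
proof -
  let ?k = "card (\<pi>)"
  have "real (8 * num_subgroups G) < real (59 * 2 ^ ?k)" using few_subgroups by (simp only: of_nat_less_iff)
  then have "8 * real (num_subgroups G) < 59 * 2 ^ ?k" by simp
  moreover have "weight nSyl nrmprimes qs {} \<le> num_subgroups G" using weight_bound[OF assms] by simp
  then have "real (weight nSyl nrmprimes qs {}) \<le> real (num_subgroups G)" by (simp only: of_nat_le_iff)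
  moreover have "2 ^ ?k * half_sum qs \<le> real (weight nSyl nrmprimes qs {})"
    using weight_ge_half_sum[OF assms, of "{}"] by simp
  ultimately have "8 * (2 ^ ?k * half_sum qs) < 59 * 2 ^ ?k" by linarith
  then have "2 ^ ?k * (8 * half_sum qs) < 2 ^ ?k * 59"
    by (simp only: mult.assoc mult.commute mult.left_commute)
  then have "8 * half_sum qs < 59" by simp
  then show ?thesis by simp
qed

text \<open>If \<open>r\<close> were lost, the order of the normalizer would be prime to
  \<open>r\<close>, and the full \<open>r\<close>-part of the order of \<open>G\<close> would divide
  \<open>nSyl q\<close>.\<close>

lemma nrmprimesI:
  assumes "q \<in> \<pi>" "r \<in> \<pi>" "r \<noteq> q" "r ^ j dvd order G" "\<not> r ^ j dvd nSyl q"
  shows "r \<in> nrmprimes q"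
proof (rule ccontr)
  assume "r \<notin> nrmprimes q"
  then have l: "r \<in> lost q" using assms by (simp add: lost_def)
  have "coprime (r ^ j) (order G div nSyl q)"
    using lost_dvd(1,3)[OF assms(1) l] by (simp add: prime_imp_coprime)
  moreover have "prime q" using assms(1) by auto
  then have "r ^ j dvd nSyl q * (order G div nSyl q)" using assms(4) nSyl_mult[of q] by simp
  ultimately have "r ^ j dvd nSyl q" by (simp add: coprime_dvd_mult_left_iff)
  then show False using assms(5) by simp
qed

lemma nrmprimes_not_dvd:
  assumes "q \<in> \<pi>" "r \<in> \<pi>" "r \<noteq> q" "\<not> r dvd nSyl q"
  shows "r \<in> nrmprimes q"
  using nrmprimesI[of q r 1] assms by auto

text \<open>The Sylow \<open>q\<close>-subgroups have prime order. If \<open>r\<close> did not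
  divide their number, a Sylow \<open>r\<close>-subgroup would centralize one of them, and
  \<open>q\<close> would divide the order of its normalizer.\<close>

lemma prime_dvd_nSyl_if_lost:
  assumes "q \<in> \<pi>" "r \<in> \<pi>" "q < r" "q \<notin> nrmprimes r" "\<not> q\<^sup>2 dvd order G"
  shows "r dvd nSyl q"
proof (rule ccontr)
  assume n: "\<not> r dvd nSyl q"
  have q: "prime q" and r: "prime r" using assms by auto
  have "q ^ 1 dvd order G" using assms(1) by auto
  moreover have "\<not> q ^ Suc 1 dvd order G" using assms(5) by (simp add: numeral_2_eq_2)
  ultimately have "multiplicity q (order G) = 1" by (rule multiplicity_eqI)
  then show False using prime_Syl_nrmprimes[OF q r assms(3) _ n] assms(4) by blast
qed

lemma weight_term: "A \<subseteq> nrmprimes q - E \<Longrightarrow> nSyl q * 2 ^ card A \<le> nSyl q * 2 ^ card (nrmprimes q - E)"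
  by (intro mult_le_mono2 power_increasing card_mono) (auto simp: finite_nrmprimes)

text \<open>Here and in the next lemmas the sets \<open>A\<close>, \<open>B\<close>, ... collect
  only primes known to survive in the normalizers, so partial information suffices for a
  bound.\<close>

lemma weight1:
  assumes "a \<in> \<pi>" "A \<subseteq> nrmprimes a"
  shows "2 + nSyl a * 2 ^ card A \<le> num_subgroups G"
proof -
  have "2 + weight nSyl nrmprimes [a] {} \<le> num_subgroups G" by (rule weight_bound) (use assms in auto)
  then show ?thesis using assms weight_term[of A a "{}"]
    unfolding weight.simps Diff_empty by linarith
qed

lemma weight2:
  assumes "a \<in> \<pi>" "A \<subseteq> nrmprimes a"
    "b \<in> \<pi>" "B \<subseteq> nrmprimes b - {a}" "distinct [a, b]"
  shows "2 + nSyl a * 2 ^ card A + nSyl b * 2 ^ card B \<le> num_subgroups G"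
proof -
  have "2 + weight nSyl nrmprimes [a, b] {} \<le> num_subgroups G" by (rule weight_bound) (use assms in auto)
  then show ?thesis using assms weight_term[of A a "{}"] weight_term[of B b "{a}"]
    unfolding weight.simps Diff_empty by linarith
qed

lemma weight3:
  assumes "a \<in> \<pi>" "A \<subseteq> nrmprimes a"
    "b \<in> \<pi>" "B \<subseteq> nrmprimes b - {a}"
    "c \<in> \<pi>" "C \<subseteq> nrmprimes c - {b, a}" "distinct [a, b, c]"
  shows "2 + nSyl a * 2 ^ card A + nSyl b * 2 ^ card B + nSyl c * 2 ^ card C \<le> num_subgroups G"
proof -
  have "2 + weight nSyl nrmprimes [a, b, c] {} \<le> num_subgroups G" by (rule weight_bound) (use assms in auto)
  then show ?thesis using assms weight_term[of A a "{}"] weight_term[of B b "{a}"] weight_term[of C c "{b, a}"]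
    unfolding weight.simps Diff_empty by linarith
qed

lemma weight4:
  assumes "a \<in> \<pi>" "A \<subseteq> nrmprimes a"
    "b \<in> \<pi>" "B \<subseteq> nrmprimes b - {a}"
    "c \<in> \<pi>" "C \<subseteq> nrmprimes c - {b, a}"
    "d \<in> \<pi>" "D \<subseteq> nrmprimes d - {c, b, a}" "distinct [a, b, c, d]"
  shows "2 + nSyl a * 2 ^ card A + nSyl b * 2 ^ card B + nSyl c * 2 ^ card C + nSyl d * 2 ^ card D \<le> num_subgroups G"
proof -
  have "2 + weight nSyl nrmprimes [a, b, c, d] {} \<le> num_subgroups G"
    by (rule weight_bound) (use assms in auto)
  then show ?thesis using assms weight_term[of A a "{}"] weight_term[of B b "{a}"] weight_term[of C c "{b, a}"] weight_term[of D d "{c, b, a}"]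
    unfolding weight.simps Diff_empty by linarith
qed

lemma prime_dvd_nSyl_mem:
  assumes "q \<in> \<pi>" "prime r" "r dvd nSyl q"
  shows "r \<in> \<pi>"
  using assms nSyl_facts(2)[OF assms(1)] order_pos by (auto simp: prime_factors_dvd intro: dvd_trans)

lemma candidate_nSyl:
  assumes q: "q \<in> \<pi>" and p: "p \<in> \<pi>"
    "\<And>r. r \<in> \<pi> \<Longrightarrow> r \<le> p"
  shows "candidate q p (nSyl q)"
proof -
  have m: "nSyl q mod q = 1" using nSyl_gt[OF q] by simp
  then have e: "nSyl q = q * (nSyl q div q) + 1" by (metis mult_div_mod_eq)
  have "nSyl q div q \<noteq> 0" using e nSyl_ne_one[OF q] by (metis add_0 mult_0_right)
  moreover have "nSyl q div q \<noteq> 1" using e nSyl_ne_succ[OF q] by (metis mult_1_right)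
  ultimately have "2 \<le> nSyl q div q" by linarith
  then have "q * 2 \<le> q * (nSyl q div q)" by (rule mult_le_mono2)
  then have "2 * q + 1 \<le> nSyl q" using e by linarith
  moreover have "r \<le> p" if "r \<in> {3, 5, 7, 11, 13, 17, 19, 23, 29}" "r dvd nSyl q" for r
    using p(2)[OF prime_dvd_nSyl_mem[OF q _ that(2)]] that(1) by auto
  ultimately show ?thesis using m prime_le_nSyl[OF q p(1)] unfolding candidate_def by auto
qed

end

context minimal_counterexample
begin

definition largest_prime where
  "largest_prime p \<longleftrightarrow> p \<in> \<pi> \<and> (\<forall>r\<in>\<pi>. r \<le> p)"

lemma largest_primeD:
  assumes "largest_prime p"
  shows "p \<in> \<pi>" "\<And>r. r \<in> \<pi> \<Longrightarrow> r \<le> p"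
  using assms by (auto simp: largest_prime_def)

lemma candidateD:
  assumes "\<forall>x\<in>set small_index_list. candidate q p (fst x) \<longrightarrow> Q x"
    "q \<in> \<pi>" "largest_prime p"
  shows "Q (nSyl q, omega_bound (nSyl q))"
  using assms(1) nSyl_lost_bound(4)[OF assms(2)] candidate_nSyl[OF assms(2) largest_primeD[OF assms(3)]]
  by fastforce

lemma ratio_candidate:
  assumes "\<forall>x\<in>set small_index_list. candidate q p (fst x) \<longrightarrow> b * 2 ^ snd x \<le> 4 * fst x"
    "q \<in> \<pi>" "largest_prime p"
  shows "real b / 4 \<le> ratio q"
  using candidateD[OF assms] ratio_bound[OF assms(2)] by simp

lemma ratio_index:
  assumes "\<forall>x\<in>set small_index_list. p \<le> fst x \<longrightarrow> b * 2 ^ snd x \<le> 4 * fst x"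
    "q \<in> \<pi>" "largest_prime p"
  shows "real b / 4 \<le> ratio q"
proof -
  have "p \<le> nSyl q" using prime_le_nSyl[OF assms(2) largest_primeD(1)[OF assms(3)]] .
  then have "b * 2 ^ omega_bound (nSyl q) \<le> 4 * nSyl q"
    using assms(1) nSyl_lost_bound(4)[OF assms(2)] by fastforce
  then show ?thesis using ratio_bound[OF assms(2)] by blast
qed

lemma ratio_value:
  assumes "q \<in> \<pi>" "nSyl q = n" "b * 2 ^ omega_bound n \<le> 4 * n"
  shows "real b / 4 \<le> ratio q"
  using ratio_bound[OF assms(1), of b] assms(2,3) by simp

lemma ratio_one_lost:
  assumes "q \<in> \<pi>" "lost q \<subseteq> {r}"
  shows "real (nSyl q) / 2 \<le> ratio q"
proof -
  have "card (lost q) \<le> 1" using card_mono[OF _ assms(2)] by simp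
  then have "(2 :: real) ^ card (lost q) \<le> 2 ^ 1" by (rule power_increasing) simp
  then have "real (nSyl q) * 2 ^ card (lost q) \<le> real (nSyl q) * 2" by (intro mult_left_mono) auto
  then show ?thesis by (simp add: ratio_def field_simps)
qed

lemma lost_subset:
  assumes "q \<in> \<pi>" "nSyl q dvd m" "m = prod_list ps" "\<forall>x\<in>set ps. prime x"
  shows "lost q \<subseteq> set ps"
proof
  fix r assume r: "r \<in> lost q"
  have "prime r" "r dvd m" using lost_dvd[OF assms(1) r] assms(2) by (auto intro: dvd_trans)
  moreover have "m > 0" using assms(3,4) by (induction ps arbitrary: m) (auto simp: prime_gt_0_nat)
  ultimately show "r \<in> set ps" using prime_factors_prod_list[OF assms(3,4)] by (auto simp: prime_factors_dvd)
qed

lemma half_sum_two: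
  assumes "a \<in> \<pi>" "b \<in> \<pi>" "a \<noteq> b"
  shows "4 * ratio a + 2 * ratio b < 59"
  using half_sum_less[of "[a, b]"] assms by (simp add: field_simps)

lemma half_sum_three:
  assumes "a \<in> \<pi>" "b \<in> \<pi>" "c \<in> \<pi>" "distinct [a, b, c]"
  shows "4 * ratio a + 2 * ratio b + ratio c < 59"
  using half_sum_less[of "[a, b, c]"] assms by (simp add: field_simps)

lemma half_sum_one: "a \<in> \<pi> \<Longrightarrow> 4 * ratio a < 59"
  using half_sum_less[of "[a]"] by (simp add: field_simps)

text \<open>In most cases the ratios of two or three primes from the tables already sum to too much.
  The pairs (13, 40) and (17, 35) need more: there a prime lost by \<open>p\<close> divides the
  order only once, so \<open>p\<close> divides its Sylow index.\<close>

lemma largest_prime_ge_11: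
  assumes m: "largest_prime p" and
    c: "(p, nSyl p) \<in> {(11, 45), (11, 56), (11, 210), (13, 27), (13, 40), (13, 66), (13, 105),
      (17, 35), (17, 52), (19, 39), (19, 210), (23, 70)}"
  shows False
proof -
  have p: "p \<in> \<pi>" using largest_primeD(1)[OF m] .
  have mem: "r \<in> \<pi>" if "prime r" "r dvd nSyl p" for r using prime_dvd_nSyl_mem[OF p that] .
  note om = small_index_numeral
  consider "p = 11" "nSyl p = 45" | "p = 11" "nSyl p = 56" | "p = 11" "nSyl p = 210"
    | "p = 13" "nSyl p = 27" | "p = 13" "nSyl p = 40" | "p = 13" "nSyl p = 66" | "p = 13" "nSyl p = 105"
    | "p = 17" "nSyl p = 35" | "p = 17" "nSyl p = 52" | "p = 19" "nSyl p = 39" | "p = 19" "nSyl p = 210"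
    | "p = 23" "nSyl p = 70"
    using c by auto
  then show False
  proof cases
    case 1
    have r: "3 \<in> \<pi>" "5 \<in> \<pi>" using mem[of 3] mem[of 5] 1 by simp_all
    have "45 / 4 \<le> ratio p" using ratio_value[OF p 1(2), of 45] by (simp add: om)
    moreover have "22 / 4 \<le> ratio 3" using ratio_candidate[OF candidate_bound_3_11 r(1)] m 1 by simp
    moreover have "21 / 4 \<le> ratio 5" using ratio_candidate[OF candidate_bound_5_11 r(2)] m 1 by simp
    ultimately show False using half_sum_three[OF p r] 1 by simp
  next
    case 2
    have r: "2 \<in> \<pi>" using mem[of 2] 2 by simp_all
    have "56 / 4 \<le> ratio p" using ratio_value[OF p 2(2), of 56] by (simp add: om)
    moreover have "15 / 4 \<le> ratio 2" using ratio_candidate[OF candidate_bound_2_11 r(1)] m 2 by simp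
    ultimately show False using half_sum_two[OF p r] 2 by simp
  next
    case 3
    have r: "2 \<in> \<pi>" using mem[of 2] 3 by simp_all
    have "52 / 4 \<le> ratio p" using ratio_value[OF p 3(2), of 52] by (simp add: om)
    moreover have "15 / 4 \<le> ratio 2" using ratio_candidate[OF candidate_bound_2_11 r(1)] m 3 by simp
    ultimately show False using half_sum_two[OF p r] 3 by simp
  next
    case 4
    have r: "3 \<in> \<pi>" using mem[of 3] 4 by simp_all
    have "54 / 4 \<le> ratio p" using ratio_value[OF p 4(2), of 54] by (simp add: om)
    moreover have "14 / 4 \<le> ratio 3" using ratio_index[OF index_bound_13 r(1)] m 4 by simp
    ultimately show False using half_sum_two[OF p r] 4 by simp
  next
    case 5
    have r: "2 \<in> \<pi>" "5 \<in> \<pi>" using mem[of 2] mem[of 5] 5 by simp_all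
    have "nSyl p dvd 40" using 5(2) by simp
    then have "lost p \<subseteq> set [2, 2, 2, 5]" by (rule lost_subset[OF p]) simp_all
    then have sub: "lost p \<subseteq> {2, 5}" by simp
    have both: "t \<in> lost p" if t: "t \<in> {2, 5}" for t
    proof (rule ccontr)
      assume "t \<notin> lost p"
      \<comment> \<open>\<open>7 - t\<close> exchanges 2 and 5. With only one prime lost the ratio
        would be at least 20, beyond 59/4.\<close>
      then have "lost p \<subseteq> {7 - t}" using sub t by auto
      then have "real 40 / 2 \<le> ratio p" using ratio_one_lost[OF p] 5 by simp
      then show False using half_sum_one[OF p] by simp
    qed
    have "\<not> 5\<^sup>2 dvd order G"
      using nrmprimesI[OF p r(2), of 2] both[of 5] 5 by (auto simp: lost_def)
    \<comment> \<open>Being lost by 13, the prime 5 divides the order once, so its index is a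
      multiple of 13; the only candidate is 26. Since 8 divides the order but not 26, the prime 2 is
      not lost by 5, and the ratio of 5 is at least 13.\<close>
    then have "13 dvd nSyl 5"
      using prime_dvd_nSyl_if_lost[OF r(2) p] both[of 5] 5 by (simp add: lost_def)
    moreover have "nSyl 5 \<in> {16, 21, 26, 36, 56, 66}" using candidateD[OF candidates_5_13 r(2)] m 5 by simp
    ultimately have n5: "nSyl 5 = 26" by auto
    have "8 dvd nSyl p" using 5(2) by simp
    then have "8 dvd order G" using nSyl_facts(2)[OF p] by (rule dvd_trans)
    then have "2 \<in> nrmprimes 5" using nrmprimesI[OF r(2,1), of 3] n5 by simp
    moreover have "nSyl 5 dvd 26" using n5 by simp
    then have "lost 5 \<subseteq> set [2, 13]" by (rule lost_subset[OF r(2)]) simp_all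
    ultimately have "lost 5 \<subseteq> {13}" by (auto simp: lost_def)
    then have "13 \<le> ratio 5" using ratio_one_lost[OF r(2)] n5 by simp
    moreover have "40 / 4 \<le> ratio p" using ratio_value[OF p 5(2), of 40] by (simp add: om)
    ultimately show False using half_sum_two[OF p r(2)] 5 by simp
  next
    case 6
    have r: "11 \<in> \<pi>" "3 \<in> \<pi>" using mem[of 11] mem[of 3] 6 by simp_all
    have "33 / 4 \<le> ratio p" using ratio_value[OF p 6(2), of 33] by (simp add: om)
    moreover have "39 / 4 \<le> ratio 11" using ratio_candidate[OF candidate_bound_11_13 r(1)] m 6 by simp
    moreover have "22 / 4 \<le> ratio 3" using ratio_candidate[OF candidate_bound_3_13 r(2)] m 6 by simp
    \<comment> \<open>The prime 11 comes first: the bounds give 39 + 16.5 + 5.5 = 61, whereas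
      starting with 13 gives only 33 + 19.5 + 5.5 = 58.\<close>
    ultimately show False using half_sum_three[OF r(1) p r(2)] 6 by simp
  next
    case 7
    have r: "3 \<in> \<pi>" using mem[of 3] 7 by simp_all
    have "52 / 4 \<le> ratio p" using ratio_value[OF p 7(2), of 52] by (simp add: om)
    moreover have "22 / 4 \<le> ratio 3" using ratio_candidate[OF candidate_bound_3_13 r(1)] m 7 by simp
    ultimately show False using half_sum_two[OF p r] 7 by simp
  next
    case 8
    have r: "5 \<in> \<pi>" "7 \<in> \<pi>" using mem[of 5] mem[of 7] 8 by simp_all
    have "nSyl p dvd 35" using 8(2) by simp
    then have "lost p \<subseteq> set [5, 7]" by (rule lost_subset[OF p]) simp_all
    then have sub: "lost p \<subseteq> {5, 7}" by simp
    have l7: "7 \<in> lost p"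
    proof (rule ccontr)
      assume "7 \<notin> lost p"
      then have "lost p \<subseteq> {5}" using sub by auto
      then have "real 35 / 2 \<le> ratio p" using ratio_one_lost[OF p] 8 by simp
      then show False using half_sum_one[OF p] by simp
    qed
    have "\<not> 7\<^sup>2 dvd order G"
      using nrmprimesI[OF p r(2), of 2] l7 8 by (auto simp: lost_def)
    then have "17 dvd nSyl 7"
      using prime_dvd_nSyl_if_lost[OF r(2) p] l7 8 by (simp add: lost_def)
    then show False using candidateD[OF candidates_7_17 r(2)] m 8 by simp
  next
    case 9
    have r: "2 \<in> \<pi>" using mem[of 2] 9 by simp_all
    have "52 / 4 \<le> ratio p" using ratio_value[OF p 9(2), of 52] by (simp add: om)
    moreover have "15 / 4 \<le> ratio 2" using ratio_index[OF index_bound_17 r(1)] m 9 by simp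
    ultimately show False using half_sum_two[OF p r] 9 by simp
  next
    case 10
    have r: "13 \<in> \<pi>" "3 \<in> \<pi>" using mem[of 13] mem[of 3] 10 by simp_all
    have "39 / 4 \<le> ratio p" using ratio_value[OF p 10(2), of 39] by (simp add: om)
    moreover have "33 / 4 \<le> ratio 13" using ratio_candidate[OF candidate_bound_13_19 r(1)] m 10 by simp
    moreover have "22 / 4 \<le> ratio 3" using ratio_candidate[OF candidate_bound_3_19 r(2)] m 10 by simp
    ultimately show False using half_sum_three[OF p r] 10 by simp
  next
    case 11
    have r: "3 \<in> \<pi>" using mem[of 3] 11 by simp_all
    have "52 / 4 \<le> ratio p" using ratio_value[OF p 11(2), of 52] by (simp add: om)
    moreover have "22 / 4 \<le> ratio 3" using ratio_candidate[OF candidate_bound_3_19 r(1)] m 11 by simp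
    ultimately show False using half_sum_two[OF p r] 11 by simp
  next
    case 12
    have r: "7 \<in> \<pi>" "2 \<in> \<pi>" using mem[of 7] mem[of 2] 12 by simp_all
    have "35 / 4 \<le> ratio p" using ratio_value[OF p 12(2), of 35] by (simp add: om)
    moreover have "36 / 4 \<le> ratio 7" using ratio_candidate[OF candidate_bound_7_23 r(1)] m 12 by simp
    moreover have "33 / 4 \<le> ratio 2" using ratio_candidate[OF candidate_bound_2_23 r(2)] m 12 by simp
    ultimately show False using half_sum_three[OF r(1) p r(2)] 12 by simp
  qed
qed

end

section \<open>Largest prime divisor at most 7, and the final contradiction\<close>

context minimal_counterexample
begin

lemma not_pow_dvd_order:
  assumes "q \<in> \<pi>" "r \<in> \<pi>" "r \<noteq> q" "r \<notin> nrmprimes q" "\<not> r ^ j dvd nSyl q"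
  shows "\<not> r ^ j dvd order G"
  using nrmprimesI[of q r j] assms by blast

lemma largest_prime_subset:
  assumes "largest_prime p" "p < 17"
  shows "\<pi> \<subseteq> {r \<in> {2, 3, 5, 7, 11, 13}. r \<le> p}"
proof
  fix r assume r: "r \<in> \<pi>"
  then have "prime r" "r \<le> p" using largest_primeD(2)[OF assms(1)] by auto
  then show "r \<in> {r \<in> {2, 3, 5, 7, 11, 13}. r \<le> p}" using small_prime_cases[of r] assms(2) by auto
qed

lemma subs_of_prime_power: "prime r \<Longrightarrow> r ^ a dvd order G \<Longrightarrow> 1 \<le> card (subs_of (r ^ a))"
  using sylow_thm[OF _ is_group _ fin, of r a] subs_of_pos by (metis dvdE)

text \<open>Counting takes the place of Burnside's theorem on two primes. In the last case both
  primes are lost, the Sylow subgroups have orders 16 and 9, and at least 30 subgroups are found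
  where 8 times their number must stay below 236.\<close>

lemma largest_prime_3:
  assumes m: "largest_prime 3" and n: "nSyl 3 = 16"
  shows False
proof -
  have r3: "3 \<in> \<pi>" using largest_primeD(1)[OF m] .
  have r2: "2 \<in> \<pi>" using prime_dvd_nSyl_mem[OF r3, of 2] n by simp
  have "\<pi> \<subseteq> {2, 3}" using largest_prime_subset[OF m] by auto
  then have few: "8 * num_subgroups G < 59 * 4" using few_subgroups_card[of "{2, 3}"] by simp
  have "nSyl 2 \<in> {9, 27}" using candidateD[OF candidates_2_3 r2 m] by simp
  then consider "nSyl 2 = 27" | "nSyl 2 = 9" "2 \<in> nrmprimes 3" | "nSyl 2 = 9" "3 \<in> nrmprimes 2"
    | "nSyl 2 = 9" "2 \<notin> nrmprimes 3" "3 \<notin> nrmprimes 2" by auto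
  then show False
  proof cases
    case 1
    have "54 / 4 \<le> ratio 2" using ratio_value[OF r2 1, of 54] by (simp add: small_index_numeral)
    moreover have "32 / 4 \<le> ratio 3" using ratio_value[OF r3 n, of 32] by (simp add: small_index_numeral)
    ultimately show False using half_sum_two[OF r2 r3] by simp
  next
    case 2
    then show False using weight1[OF r3, of "{2}"] few n by simp
  next
    case 3
    then show False using weight2[OF r2 _ r3, of "{3}" "{}"] few n by simp
  next
    case 4
    have d: "2 ^ 4 dvd order G" "3 ^ 2 dvd order G"
      using nSyl_facts(2)[OF r3] nSyl_facts(2)[OF r2] n 4(1) by auto
    have "\<not> 2 ^ Suc 4 dvd order G" using not_pow_dvd_order[OF r3 r2 _ 4(2), of 5] n by simp
    then have m2: "multiplicity 2 (order G) = 4" using d(1) by (intro multiplicity_eqI)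
    have "\<not> 3 ^ Suc 2 dvd order G" using not_pow_dvd_order[OF r2 r3 _ 4(3), of 3] 4(1) by simp
    then have m3: "multiplicity 3 (order G) = 2" using d(2) by (intro multiplicity_eqI)
    have s: "card (subs_of 16) = 9" "card (subs_of 9) = 16"
      using subs_of_Syl[of 2] subs_of_Syl[of 3] m2 m3 n 4(1) by auto
    have pw: "2 ^ a dvd order G" if "a \<le> 4" for a
      using d(1) le_imp_power_dvd[OF that, of "2 :: nat"] dvd_trans by blast
    have t: "1 \<le> card (subs_of 2)" "1 \<le> card (subs_of 4)" "1 \<le> card (subs_of 8)"
      using subs_of_prime_power[of 2 1] subs_of_prime_power[of 2 2] subs_of_prime_power[of 2 3]
        pw[of 1] pw[of 2] pw[of 3] by simp_all
    \<comment> \<open>The order is at least 144, so the whole group counts in addition to the orders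
      up to 16.\<close>
    have "coprime (2 ^ 4) (3 ^ 2 :: nat)" by (simp add: primes_coprime del: power_numeral)
    then have "2 ^ 4 * 3 ^ 2 dvd order G" using d by (intro divides_mult)
    then have "2 ^ 4 * 3 ^ 2 \<le> order G" using order_pos by (rule dvd_imp_le)
    then show False
      using sum_subs_of_le[of "{1, 2, 4, 8, 9, 16, order G}"] subs_of_one subs_of_order s t few by simp
  qed
qed

lemma largest_prime_5:
  assumes m: "largest_prime 5" and n: "nSyl 5 \<in> {16, 36}"
  shows False
proof -
  have r5: "5 \<in> \<pi>" using largest_primeD(1)[OF m] .
  have r2: "2 \<in> \<pi>" using prime_dvd_nSyl_mem[OF r5, of 2] n by auto
  have sub: "\<pi> \<subseteq> {2, 3, 5}" using largest_prime_subset[OF m] by auto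
  have "nSyl 2 \<in> {5, 9, 15, 25, 27, 45}" using candidateD[OF candidates_2_5 r2 m] by simp
  moreover have "nSyl 2 \<noteq> 5"
  proof
    assume "nSyl 2 = 5"
    \<comment> \<open>The group embeds into the symmetric group of degree 5, but neither 16 nor 36
      divides 120.\<close>
    then have "order G dvd fact 5" using nSyl_facts(4)[OF r2] by simp
    then have "nSyl 5 dvd fact 5" using nSyl_facts(2)[OF r5] dvd_trans by blast
    then show False using n by (auto simp: fact_numeral)
  qed
  ultimately have n2: "nSyl 2 \<in> {9, 15, 25, 27, 45}" by blast
  show False
  proof (cases "3 \<in> \<pi>")
    case False
    have n16: "nSyl 5 = 16" using prime_dvd_nSyl_mem[OF r5, of 3] n False by auto
    have "nSyl 2 = 25" using prime_dvd_nSyl_mem[OF r2, of 3] n2 False by auto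
    moreover have "\<pi> \<subseteq> {2, 5}" using sub False by auto
    then have "8 * num_subgroups G < 59 * 4" using few_subgroups_card[of "{2, 5}"] by simp
    ultimately show False using weight2[OF r5 _ r2, of "{}" "{}"] n16 by simp
  next
    case r3: True
    have few: "8 * num_subgroups G < 59 * 8" using few_subgroups_card[OF sub] by simp
    have "nSyl 3 \<in> {10, 16, 25, 40}" using candidateD[OF candidates_3_5 r3 m] by simp
    then have n3: "10 \<le> nSyl 3" by auto
    have "nSyl 5 = 36 \<or> nSyl 5 = 16 \<and> 3 \<in> nrmprimes 5"
      using n nrmprimes_not_dvd[OF r5 r3] by auto
    moreover have "nSyl 2 = 9 \<and> 5 \<in> nrmprimes 2 \<or> 15 \<le> nSyl 2"
      using n2 nrmprimes_not_dvd[OF r2 r5] by auto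
    ultimately show False
      using weight3[OF r2 _ r5 _ r3, of "{5}" "{3}" "{}"] weight3[OF r5 _ r2 _ r3, of "{3}" "{}" "{}"]
        weight3[OF r2 _ r5 _ r3, of "{5}" "{}" "{}"] weight3[OF r5 _ r2 _ r3, of "{}" "{}" "{}"] few n3
      by auto
  qed
qed

text \<open>As 15 is squarefree, 3 and 5 each divide the order exactly once if lost by 7 and at
  least twice otherwise. The first alternative makes larger primes divide the Sylow index of the
  lost prime, the second forces further primes into normalizers or large indices.\<close>

lemma largest_prime_7_15:
  assumes m: "largest_prime 7" and n: "nSyl 7 = 15"
  shows False
proof -
  have r7: "7 \<in> \<pi>" using largest_primeD(1)[OF m] .
  have r3: "3 \<in> \<pi>" and r5: "5 \<in> \<pi>"
    using prime_dvd_nSyl_mem[OF r7, of 3] prime_dvd_nSyl_mem[OF r7, of 5] n by auto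
  have sub: "\<pi> \<subseteq> {2, 3, 5, 7}" using largest_prime_subset[OF m] by auto
  have n3: "nSyl 3 \<in> {7, 10, 16, 25, 28, 40, 70}" using candidateD[OF candidates_3_7 r3 m] by simp
  have n5: "nSyl 5 \<in> {16, 21, 36, 56}" using candidateD[OF candidates_5_7 r5 m] by simp
  have lost3: "\<not> 3\<^sup>2 dvd order G" if "3 \<notin> nrmprimes 7"
    using not_pow_dvd_order[OF r7 r3 _ that, of 2] n by simp
  have lost5: "\<not> 5\<^sup>2 dvd order G" if "5 \<notin> nrmprimes 7"
    using not_pow_dvd_order[OF r7 r5 _ that, of 2] n by simp
  have o: "order G = 3 * (5 * (order G div 15))" "order G = 5 * (3 * (order G div 15))"
    using nSyl_mult[of 7] n by simp_all
  have keep5: "5\<^sup>2 dvd order G" if "5 \<in> nrmprimes 7"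
  proof -
    have "5 dvd order G div 15" using that n by (auto simp: nrmprimes_def)
    then have "5 * 5 dvd 5 * (order G div 15)" by (rule mult_dvd_mono[OF dvd_refl])
    then have "5 * 5 dvd order G" by (subst o(1)) (rule dvd_mult)
    then show ?thesis by (simp only: power2_eq_square)
  qed
  have keep3: "3\<^sup>2 dvd order G" if "3 \<in> nrmprimes 7"
  proof -
    have "3 dvd order G div 15" using that n by (auto simp: nrmprimes_def)
    then have "3 * 3 dvd 3 * (order G div 15)" by (rule mult_dvd_mono[OF dvd_refl])
    then have "3 * 3 dvd order G" by (subst o(2)) (rule dvd_mult)
    then show ?thesis by (simp only: power2_eq_square)
  qed
  \<comment> \<open>The group embeds into the symmetric group of degree \<open>nSyl r\<close>, and
    25 does not divide the factorial of 9.\<close>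
  have ge10: "10 \<le> nSyl r" if "5 \<in> nrmprimes 7" "r \<in> \<pi>" for r
  proof (rule ccontr)
    assume "\<not> 10 \<le> nSyl r"
    then have "fact (nSyl r) dvd (fact 9 :: nat)" by (intro fact_dvd) simp
    then have "5\<^sup>2 dvd (fact 9 :: nat)" using keep5[OF that(1)] nSyl_facts(4)[OF that(2)] dvd_trans by blast
    then show False by (simp add: fact_numeral)
  qed
  show False
  proof (cases "2 \<in> \<pi>")
    case False
    have n5': "nSyl 5 = 21" using n5 prime_dvd_nSyl_mem[OF r5, of 2] False by auto
    have n3': "nSyl 3 = 7 \<or> nSyl 3 = 25" using n3 prime_dvd_nSyl_mem[OF r3, of 2] False by auto
    have "\<pi> \<subseteq> {3, 5, 7}" using sub False by auto
    then have few: "8 * num_subgroups G < 59 * 8" using few_subgroups_card[of "{3, 5, 7}"] by simp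
    have "nSyl 3 = 7" using n3' weight3[OF r7 _ r5 _ r3, of "{}" "{}" "{}"] n n5' few by auto
    \<comment> \<open>If 3 were lost by both 7 and 5, it would divide the order once, and 5 would
      divide \<open>nSyl 3 = 7\<close>.\<close>
    moreover have "3 \<in> nrmprimes 7 \<or> 3 \<in> nrmprimes 5"
      using prime_dvd_nSyl_if_lost[OF r3 r5] lost3 calculation by auto
    ultimately show False
      using weight3[OF r7 _ r5 _ r3, of "{3}" "{}" "{}"] weight3[OF r7 _ r5 _ r3, of "{}" "{3}" "{}"] n n5' few by auto
  next
    case r2: True
    have few: "8 * num_subgroups G < 59 * 16" using few_subgroups_card[OF sub] by simp
    have k2: "2 \<in> nrmprimes 7" using nrmprimes_not_dvd[OF r7 r2] n by simp
    have n2: "nSyl 2 \<in> {7, 9, 15, 21, 25, 27, 35, 45, 105}" using candidateD[OF candidates_2_7 r2 m] by simp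
    show False
    proof (cases "5 \<in> nrmprimes 7")
      case k5: True
      have "15 \<le> nSyl 2" using n2 ge10[OF k5 r2] by auto
      moreover have "10 \<le> nSyl 3" using ge10[OF k5 r3] .
      moreover have "32 \<le> nSyl 5 \<or> 16 \<le> nSyl 5 \<and> (2 \<in> nrmprimes 5 \<or> 3 \<in> nrmprimes 5)"
        using n5 nrmprimes_not_dvd[OF r5 r2] nrmprimes_not_dvd[OF r5 r3] by auto
      ultimately show False
        using weight4[OF r7 _ r5 _ r3 _ r2, of "{2, 5}" "{}" "{}" "{}"] weight4[OF r7 _ r5 _ r3 _ r2, of "{2, 5}" "{2}" "{}" "{}"]
          weight4[OF r7 _ r5 _ r3 _ r2, of "{2, 5}" "{3}" "{}" "{}"] k2 k5 n few by auto
    next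
      case l5: False
      have "7 dvd nSyl 5" using prime_dvd_nSyl_if_lost[OF r5 r7 _ l5 lost5[OF l5]] by simp
      then have n5': "nSyl 5 = 21 \<or> nSyl 5 = 56" using n5 by auto
      have "nSyl 5 \<noteq> 56"
      proof
        assume 56: "nSyl 5 = 56"
        then have "3 \<in> nrmprimes 5" using nrmprimes_not_dvd[OF r5 r3] by simp
        then show False using weight2[OF r7 _ r5, of "{2}" "{3}"] k2 56 few n by simp
      qed
      then have n5'': "nSyl 5 = 21" using n5' by blast
      have k52: "2 \<in> nrmprimes 5" using nrmprimes_not_dvd[OF r5 r2] n5'' by simp
      show False
      proof (cases "3 \<in> nrmprimes 7")
        case k3: True
        have "3 \<in> nrmprimes 5" using nrmprimesI[OF r5 r3 _ keep3[OF k3]] n5'' by simp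
        then show False using weight2[OF r7 _ r5, of "{2, 3}" "{2, 3}"] k2 k3 k52 n5'' few n by simp
      next
        case l3: False
        have "7 dvd nSyl 3" using prime_dvd_nSyl_if_lost[OF r3 r7 _ l3 lost3[OF l3]] by simp
        then have "nSyl 3 = 7 \<or> nSyl 3 = 28 \<or> nSyl 3 = 70" using n3 by auto
        moreover have "3 \<in> nrmprimes 5" if "nSyl 3 = 7"
          using prime_dvd_nSyl_if_lost[OF r3 r5 _ _ lost3[OF l3]] that by auto
        moreover have "5 \<in> nrmprimes 3" if "nSyl 3 = 28" using nrmprimes_not_dvd[OF r3 r5] that by simp
        ultimately show False
          using weight2[OF r7 _ r5, of "{2}" "{2, 3}"] weight3[OF r7 _ r3 _ r5, of "{2}" "{5}" "{2}"]
            weight3[OF r7 _ r5 _ r3, of "{2}" "{2}" "{}"] weight3[OF r7 _ r5 _ r3, of "{2}" "{2, 3}" "{}"] k2 k52 n5'' few n by auto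
      qed
    qed
  qed
qed

lemma largest_prime_7_36:
  assumes m: "largest_prime 7" and n: "nSyl 7 = 36"
  shows False
proof -
  have r7: "7 \<in> \<pi>" using largest_primeD(1)[OF m] .
  have r3: "3 \<in> \<pi>" and r2: "2 \<in> \<pi>"
    using prime_dvd_nSyl_mem[OF r7, of 3] prime_dvd_nSyl_mem[OF r7, of 2] n by auto
  have sub: "\<pi> \<subseteq> {2, 3, 5, 7}" using largest_prime_subset[OF m] by auto
  have n3: "nSyl 3 \<in> {7, 10, 16, 25, 28, 40, 70}" using candidateD[OF candidates_3_7 r3 m] by simp
  have n2: "nSyl 2 \<in> {7, 9, 15, 21, 25, 27, 35, 45, 105}" using candidateD[OF candidates_2_7 r2 m] by simp
  show False
  proof (cases "5 \<in> \<pi>")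
    case False
    have "\<pi> \<subseteq> {2, 3, 7}" using sub False by auto
    then have few: "8 * num_subgroups G < 59 * 8" using few_subgroups_card[of "{2, 3, 7}"] by simp
    have "nSyl 2 = 7 \<and> 3 \<in> nrmprimes 2 \<or> nSyl 2 = 9 \<or> 15 \<le> nSyl 2"
      using n2 nrmprimes_not_dvd[OF r2 r3] by auto
    moreover have "nSyl 3 = 7 \<and> 2 \<in> nrmprimes 3 \<or> 16 \<le> nSyl 3" "7 \<le> nSyl 3"
      using n3 nrmprimes_not_dvd[OF r3 r2] prime_dvd_nSyl_mem[OF r3, of 5] False by auto
    \<comment> \<open>The tightest case is \<open>nSyl 2 = nSyl 3 = 7\<close>, with 2 + 36 + 14 + 7
      = 59.\<close>
    ultimately show False
      using weight3[OF r7 _ r2 _ r3, of "{}" "{3}" "{}"] weight3[OF r7 _ r3 _ r2, of "{}" "{2}" "{}"]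
        weight3[OF r7 _ r2 _ r3, of "{}" "{}" "{}"] n few by auto
  next
    case r5: True
    have few: "8 * num_subgroups G < 59 * 16" using few_subgroups_card[OF sub] by simp
    have k5: "5 \<in> nrmprimes 7" using nrmprimes_not_dvd[OF r7 r5] n by simp
    have n5: "nSyl 5 \<in> {16, 21, 36, 56}" using candidateD[OF candidates_5_7 r5 m] by simp
    \<comment> \<open>With 5 already in the normalizer, a second prime would give 2 + 36 * 4 = 146
      subgroups, while fewer than 118 are allowed.\<close>
    have no2: "2 \<notin> nrmprimes 7" and no3: "3 \<notin> nrmprimes 7"
      using weight1[OF r7, of "{2, 5}"] weight1[OF r7, of "{3, 5}"] k5 n few by auto
    \<comment> \<open>The prime 2 is lost and 8 does not divide 36, so 8 does not divide the order;
      this removes 16 and 56 from the candidates for \<open>nSyl 5\<close>.\<close>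
    have "\<not> 2 ^ 3 dvd order G" using not_pow_dvd_order[OF r7 r2 _ no2, of 3] n by simp
    then have "\<not> 2 ^ 3 dvd nSyl 5" using nSyl_facts(2)[OF r5] dvd_trans by blast
    then have "nSyl 5 = 21 \<or> nSyl 5 = 36" using n5 by auto
    moreover have "2 \<in> nrmprimes 5 \<and> 3 \<in> nrmprimes 5" if "nSyl 5 = 21"
    proof -
      have "3\<^sup>2 dvd nSyl 7" using n by simp
      then have "3\<^sup>2 dvd order G" using nSyl_facts(2)[OF r7] dvd_trans by blast
      then show ?thesis using nrmprimesI[OF r5 r3, of 2] nrmprimes_not_dvd[OF r5 r2] that by simp
    qed
    ultimately show False
      using weight2[OF r7 _ r5, of "{5}" "{2, 3}"] weight4[OF r7 _ r5 _ r2 _ r3, of "{5}" "{}" "{}" "{}"]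
        k5 n n2 n3 few by auto
  qed
qed

lemma largest_prime_7_50:
  assumes m: "largest_prime 7" and n: "nSyl 7 = 50"
  shows False
proof -
  have r7: "7 \<in> \<pi>" using largest_primeD(1)[OF m] .
  have r5: "5 \<in> \<pi>" using prime_dvd_nSyl_mem[OF r7, of 5] n by simp
  have "50 / 4 \<le> ratio 7" using ratio_value[OF r7 n, of 50] by (simp add: small_index_numeral)
  moreover have "21 / 4 \<le> ratio 5" using ratio_candidate[OF candidate_bound_5_7 r5 m] by simp
  ultimately show False using half_sum_two[OF r7 r5] by simp
qed

lemma contradiction: False
proof -
  have "order G \<noteq> 1"
  proof
    assume "order G = 1"
    then have "carrier G = {\<one>}" using order_one_triv_iff by simp
    then have "solvable (G\<lparr>carrier := carrier G\<rparr>)" by (intro solvable_comm[OF subgroup_self]) simp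
    then show False using not_solvable by simp
  qed
  then have "\<pi> \<noteq> {}" using prime_factors_eq_empty_iff[OF order_pos] by simp
  then obtain p where m: "largest_prime p"
    unfolding largest_prime_def using Max_in[of \<pi>] Max_ge[of \<pi>] by blast
  have p: "p \<in> \<pi>" and pp: "prime p" using largest_primeD(1)[OF m] by auto
  have c: "candidate p p (nSyl p)" using candidate_nSyl[OF p p] largest_primeD(2)[OF m] by blast
  have t: "(nSyl p, omega_bound (nSyl p)) \<in> set small_index_list" using nSyl_lost_bound(4)[OF p] .
  \<comment> \<open>The largest index 210 together with \<open>2 * p + 1 \<le> nSyl p\<close>
    explains the range of the prime table.\<close>
  have "\<forall>x\<in>set small_index_list. fst x \<le> 210" by (simp add: small_index_list_def)
  then have "nSyl p \<le> 210" using t by fastforce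
  moreover have "2 * p + 1 \<le> nSyl p" using c by (auto simp: candidate_def split: if_splits)
  ultimately have p105: "p < 105" by linarith
  have "(p, nSyl p) \<in> {(3, 16), (5, 16), (5, 36), (7, 15), (7, 36), (7, 50)} \<union> {(11, 45), (11, 56),
    (11, 210),
      (13, 27), (13, 40), (13, 66), (13, 105), (17, 35), (17, 52), (19, 39), (19, 210), (23, 70)}"
    using max_prime_table[THEN bspec, OF prime_less_105[OF pp p105], THEN bspec, OF t] c
    unfolding fst_conv by (simp only: insert_iff Un_iff empty_iff simp_thms disj_ac)
  moreover have "(p, nSyl p) \<notin> {(3, 16), (5, 16), (5, 36), (7, 15), (7, 36), (7, 50)}"
    using m largest_prime_3 largest_prime_5 largest_prime_7_15 largest_prime_7_36 largest_prime_7_50 by auto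
  ultimately have "(p, nSyl p) \<in> {(11, 45), (11, 56), (11, 210),
      (13, 27), (13, 40), (13, 66), (13, 105), (17, 35), (17, 52), (19, 39), (19, 210), (23, 70)}"
    by (meson UnE)
  then show False by (rule largest_prime_ge_11[OF m])
qed

end

section \<open>Induction on the order and transfer to arbitrary carriers\<close>

lemma few_subgroups_imp_solvable_nat:
  fixes G :: "nat monoid"
  assumes "fin_group G" "8 * num_subgroups G < 59 * 2 ^ card (prime_factors (order G))"
  shows "solvable G"
  using assms
proof (induction "order G" arbitrary: G rule: less_induct)
  case less
  show ?case
  proof (rule ccontr)
    assume "\<not> solvable G"
    then have "minimal_counterexample G"
      unfolding minimal_counterexample_def minimal_counterexample_axioms_def
      using less by (meson not_le)
    then show False by (rule minimal_counterexample.contradiction)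
  qed
qed

theorem theorem5p8:
  fixes G (structure)
  assumes "group G" and "finite (carrier G)" and "subgroup_ratio G < 59 / 8"
  shows "solvable G"
proof -
  have f: "fin_group G" using assms(1,2) by (simp add: fin_group_def fin_group_axioms_def)
  then obtain H :: "nat monoid" and h where H: "fin_group H" "h \<in> iso G H" using ex_nat_iso by blast
  have gH: "group H" using H(1) by (simp add: fin_group_def)
  have "real (8 * num_subgroups G) < real (59 * 2 ^ card (prime_factors (order G)))"
    using assms(3) by (simp add: subgroup_ratio_def num_prime_divisors_def field_simps)
  then have "8 * num_subgroups G < 59 * 2 ^ card (prime_factors (order G))" by (simp only: of_nat_less_iff)
  then have "solvable H"
    using few_subgroups_imp_solvable_nat[OF H(1)] iso_num_subgroups[OF assms(1) gH H(2)] iso_order[OF H(2)] by simp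
  then show ?thesis using iso_solvable[OF assms(1) gH H(2)] by blast
qed

end
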